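(* Let $B=\mathbf{I}$ and let $f:\mathbb{R}^d\to\mathbb{R}$ be Lipschitz continuous with constant $L_0>0$ with respect to the Euclidean norm. Let $0<\delta<1$, $0<\gamma\le\min\{5L_0,1\}$ and let $\mu>0$ satisfy $\mu\le\frac{\delta}{\sqrt{d\pi e}}\left(\frac{\gamma}{4L_0}\right)^{1/d}$. Let $L_1(f_\mu)>0$ be the Lipschitz constant of the gradient of $f_\mu$, and let $\sigma\ge 0$ satisfy $E_u[\|G_\mu(z;u)-F_\mu(z)\|^2]\le\sigma^2$ for all $z\in\mathbb{R}^d$. Suppose that for some $\rho\in[0,\frac{1}{4L_1(f_\mu)})$ there is $z^*\in\mathbb{R}^d$ such that $\langle F_\mu(z),z-z^*\rangle+\frac{\rho}{2}\|F_\mu(z)\|^2\ge0$ for all $z\in\mathbb{R}^d$. Let $\{z_k\},\{\hat z_k\}$ be generated by the zeroth-order extragradient algorithm (ZO-EG, unconstrained) with constant step sizes $h_1,h_2>0$ satisfying $h_1\le\frac{1}{L_1(f_\mu)}$ and $h_2\in\left(\sqrt{\frac{\rho}{L_1(f_\mu)}},\frac{h_1}{2}\right]$. Let $r_0=\|z_0-z^*\|$ and $\epsilon>0$. If $$\mu\le\frac{\delta}{\sqrt{d\pi e}}\left(\frac{\epsilon}{8L_0}\right)^{1/d}\quad\text{and}\quad N\ge\left\lceil\left(\frac{8r_0^2L_1(f_\mu)}{L_1(f_\mu)h_2^2-\rho}\right)\epsilon^{-2}-1\right\rceil,$$ then there exists $k\in\{0,\dots,N\}$ such that the iterate $\hat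 z_k$ of the algorithm is, in expectation, a $(\delta,\bar\epsilon)$-Goldstein stationary point of $f$ with $\bar\epsilon=\epsilon+\sqrt{\frac{3}{L_1(f_\mu)(L_1(f_\mu)h_2^2-\rho)}}\,\sigma$, i.e. $$E_{\mathcal{U}_k}\left[\min\{\|g\|:g\in\partial_\delta f(\hat z_k)\}\right]\le\bar\epsilon.$$
   Context: $n,m\in\mathbb{N}$, $d=n+m$, points $z=(x,y)\in\mathbb{R}^n\times\mathbb{R}^m=\mathbb{R}^d$; since $B=\mathbf{I}$, $\|\cdot\|$ is the Euclidean norm and $\langle\cdot,\cdot\rangle$ the Euclidean inner product. In $\sqrt{d\pi e}$, $e$ is Euler's number. For $\mu>0$ the Gaussian smoothing of $f$ is $f_\mu(z)=E_u[f(z+\mu u)]$ with $u\sim\mathcal{N}(0,\mathbf{I})$ (it is continuously differentiable with Lipschitz gradient when $f$ is Lipschitz), and $F_\mu(z)=(\nabla_x f_\mu(z),-\nabla_y f_\mu(z))$. For $u=(u_1,u_2)\in\mathbb{R}^n\times\mathbb{R}^m$ the random oracle is $G_\mu(z;u)=\frac{f(z+\mu u)-f(z)}{\mu}\,(u_1,-u_2)$. ZO-EG (unconstrained): given $z_0\in\mathbb{R}^d$, for $k=0,1,\dots,N$: sample $\hat u_k\sim\mathcal{N}(0,\mathbf{I})$ and set $\hat z_k=z_k-h_1G_\mu(z_k;\hat u_k)$; sample $u_k\sim\mathcal{N}(0,\mathbf{I})$ and set $z_{k+1}=z_k-h_2G_\mu(\hat z_k;u_k)$. All sampled vectors are independent.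 $\mathcal{U}_k=[(u_0,\hat u_0),\dots,(u_k,\hat u_k)]$ and $E_{\mathcal{U}_k}$ is expectation over $\mathcal{U}_k$. $\partial f(z)$ denotes the Clarke generalized gradient: the convex hull of all limits $\lim\nabla f(w_j)$ with $w_j\to z$ and $f$ differentiable at $w_j$. The $\delta$-Goldstein subdifferential is $\partial_\delta f(z)=\operatorname{conv}\big(\bigcup_{z'\in\mathbb{B}_\delta(z)}\partial f(z')\big)$, $\mathbb{B}_\delta(z)$ being the closed ball of radius $\delta$ around $z$. A point $z$ is $(\delta,\epsilon)$-Goldstein stationary if $\min\{\|g\|:g\in\partial_\delta f(z)\}\le\epsilon$. *)

theory Defs
  imports "HOL-Probability.Probability"
begin

definition grad :: "('a::real_inner \<Rightarrow> real) \<Rightarrow> 'a \<Rightarrow> 'a" where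
  "grad f x = (THE g. GDERIV f x :> g)"

(* The law N(0, I): the coordinates are independent standard normal variables. *)
definition std_gaussian :: "'a::euclidean_space measure" where
  "std_gaussian = density lborel (\<lambda>u. ennreal (\<Prod>b\<in>Basis. std_normal_density (u \<bullet> b)))"

definition gaussian_smoothing ::
    "('a::euclidean_space \<Rightarrow> real) \<Rightarrow> real \<Rightarrow> 'a \<Rightarrow> real" where
  "gaussian_smoothing f \<mu> z = (\<integral>u. f (z + \<mu> *\<^sub>R u) \<partial>std_gaussian)"

definition F_smooth ::
    "('a::euclidean_space \<times> 'b::euclidean_space \<Rightarrow> real) \<Rightarrow> real \<Rightarrow> 'a \<times> 'b \<Rightarrow> 'a \<times> 'b" where
  "F_smooth f \<mu> z =
    (grad (\<lambda>x. gaussian_smoothing f \<mu> (x, snd z)) (fst z),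
     - grad (\<lambda>y. gaussian_smoothing f \<mu> (fst z, y)) (snd z))"

definition G_oracle ::
    "('a::euclidean_space \<times> 'b::euclidean_space \<Rightarrow> real) \<Rightarrow> real \<Rightarrow> 'a \<times> 'b \<Rightarrow> 'a \<times> 'b \<Rightarrow> 'a \<times> 'b" where
  "G_oracle f \<mu> z u = ((f (z + \<mu> *\<^sub>R u) - f z) / \<mu>) *\<^sub>R (fst u, - snd u)"

definition zoeg_extrapolate ::
    "('a::euclidean_space \<times> 'b::euclidean_space \<Rightarrow> real) \<Rightarrow> real \<Rightarrow> real \<Rightarrow> 'a \<times> 'b \<Rightarrow> 'a \<times> 'b \<Rightarrow> 'a \<times> 'b" where
  "zoeg_extrapolate f \<mu> h\<^sub>1 z v = z - h\<^sub>1 *\<^sub>R G_oracle f \<mu> z v"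

(* The iterates for a realisation v = (v_0, v_1, ...) of the samples drawn in the
   extrapolation steps and u = (u_0, u_1, ...) of those drawn in the update steps. *)
primrec zoeg_z ::
    "('a::euclidean_space \<times> 'b::euclidean_space \<Rightarrow> real) \<Rightarrow> real \<Rightarrow> real \<Rightarrow> real \<Rightarrow> 'a \<times> 'b \<Rightarrow>
     (nat \<Rightarrow> 'a \<times> 'b) \<Rightarrow> (nat \<Rightarrow> 'a \<times> 'b) \<Rightarrow> nat \<Rightarrow> 'a \<times> 'b" where
  "zoeg_z f \<mu> h\<^sub>1 h\<^sub>2 z\<^sub>0 v u 0 = z\<^sub>0"
| "zoeg_z f \<mu> h\<^sub>1 h\<^sub>2 z\<^sub>0 v u (Suc k) =
    zoeg_z f \<mu> h\<^sub>1 h\<^sub>2 z\<^sub>0 v u k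
      - h\<^sub>2 *\<^sub>R G_oracle f \<mu> (zoeg_extrapolate f \<mu> h\<^sub>1 (zoeg_z f \<mu> h\<^sub>1 h\<^sub>2 z\<^sub>0 v u k) (v k)) (u k)"

definition zoeg_zhat ::
    "('a::euclidean_space \<times> 'b::euclidean_space \<Rightarrow> real) \<Rightarrow> real \<Rightarrow> real \<Rightarrow> real \<Rightarrow> 'a \<times> 'b \<Rightarrow>
     (nat \<Rightarrow> 'a \<times> 'b) \<Rightarrow> (nat \<Rightarrow> 'a \<times> 'b) \<Rightarrow> nat \<Rightarrow> 'a \<times> 'b" where
  "zoeg_zhat f \<mu> h\<^sub>1 h\<^sub>2 z\<^sub>0 v u k =
    zoeg_extrapolate f \<mu> h\<^sub>1 (zoeg_z f \<mu> h\<^sub>1 h\<^sub>2 z\<^sub>0 v u k) (v k)"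

definition clarke_subdifferential :: "('a::euclidean_space \<Rightarrow> real) \<Rightarrow> 'a \<Rightarrow> 'a set" where
  "clarke_subdifferential f z =
    convex hull {g. \<exists>w. w \<longlonglongrightarrow> z \<and> (\<forall>j. f differentiable (at (w j))) \<and>
                        (\<lambda>j. grad f (w j)) \<longlonglongrightarrow> g}"

definition goldstein_subdifferential ::
    "('a::euclidean_space \<Rightarrow> real) \<Rightarrow> real \<Rightarrow> 'a \<Rightarrow> 'a set" where
  "goldstein_subdifferential f \<delta> z = convex hull (\<Union>z'\<in>cball z \<delta>. clarke_subdifferential f z')"

(* min {norm g | g in the Goldstein subdifferential}. LEAST is a genuine minimum: it has a
   specified value only if the minimum is attained, which holds for locally Lipschitz f. *)
definition goldstein_min_norm ::
    "('a::euclidean_space \<Rightarrow> real) \<Rightarrow> real \<Rightarrow> 'a \<Rightarrow> real" where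
  "goldstein_min_norm f \<delta> z = (LEAST r. r \<in> norm ` goldstein_subdifferential f \<delta> z)"

end

theory Submission
  imports Defs
begin

text \<open>
  By Rademacher's theorem the gradient of the Gaussian smoothing at \<open>z\<close> is the average of
  the gradients of \<open>f\<close> at \<open>z + \<mu> u\<close>. Those with \<open>\<mu> \<parallel>u\<parallel> \<le> \<delta>\<close> lie in the
  Goldstein subdifferential, and by a Chernoff bound the others have total weight at most
  \<open>\<epsilon> / (8 L\<^sub>0)\<close>. Testing the average against the element of least norm shows that this least norm
  exceeds the norm of the smoothed gradient by at most \<open>\<epsilon> / 4\<close>.
  For the iteration, the weak Minty inequality makes the expected squared distance to the solution
  decrease by a multiple of \<open>\<parallel>F (zhat k)\<parallel>\<^sup>2\<close> up to \<open>3 \<sigma>\<^sup>2 / L\<^sub>1\<^sup>2\<close>; summing over \<open>k\<close>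
  bounds the smallest expected squared gradient norm.

  Rademacher's theorem: one-sided directional derivatives exist almost everywhere by Vitali covering
  on lines and Fubini; they are additive in the direction because the translation of a box by a small
  vector changes its integral by little; finitely many directions then control all others by the
  Lipschitz condition.
\<close>

section \<open>Rademacher's theorem\<close>

text \<open>Two obstacles shape the formal argument. The expectation of the least norm is meaningful
  only if that norm is a measurable function of the point. It is lower semicontinuous, because the
  closure of the graph of the gradient is closed and its gradient component stays in a ball of
  radius the Lipschitz constant. The iterates are not known in advance to have finite second
  moments. The recursion for the expected squared distance is therefore run with nonnegative
  integrals in \<open>ennreal\<close>, where no integrability has to be assumed, and finiteness of
  the moments comes out of the telescoped sum. Measurability of the full gradient is avoided as
  well: every average of gradients that is needed is taken in one fixed direction, and a directional
  derivative along a fixed sequence of increments is visibly Borel.\<close>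

lemma Vitali_cover_right_intervals:
  fixes E U :: "real set"
  assumes U: "open U" "E \<subseteq> U"
    and P: "\<And>x e. x \<in> E \<Longrightarrow> 0 < e \<Longrightarrow> \<exists>t. 0 < t \<and> t < e \<and> P x t"
  obtains C where "countable C" "C \<subseteq> {(x, t). x \<in> E \<and> 0 < t \<and> {x..x + t} \<subseteq> U \<and> P x t}"
    "disjoint_family_on (\<lambda>(x, t). {x..x + t}) C" "negligible (E - (\<Union>(x, t)\<in>C. {x..x + t}))"
proof -
  define K where "K = {(x, t). x \<in> E \<and> 0 < t \<and> {x..x + t} \<subseteq> U \<and> P x t}"
  \<comment> \<open>The covering theorem accepts balls that contain \<open>x\<close> without being
    centred at it, so the interval to the right of \<open>x\<close> is presented as the ball around
    its midpoint.\<close>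
  define c where "c = (\<lambda>(x::real, t). x + t / 2)"
  define r where "r = (\<lambda>(x::real, t::real). t / 2)"
  have cball: "cball (c i) (r i) = (\<lambda>(x, t). {x..x + t}) i" for i
    by (auto simp: c_def r_def cball_eq_atLeastAtMost split: prod.split)
  have r: "0 < r i" if "i \<in> K" for i
    using that by (auto simp: K_def r_def)
  have S: "\<exists>i. i \<in> K \<and> x \<in> cball (c i) (r i) \<and> r i < d" if x: "x \<in> E" and d: "0 < d" for x d
  proof -
    obtain e where e: "e > 0" "cball x e \<subseteq> U"
      using U x by (meson open_contains_cball subsetD)
    obtain t where t: "0 < t" "t < min d e" "P x t"
      using P[OF x, of "min d e"] d e by auto
    have "{x..x + t} \<subseteq> cball x e"
      using t by (auto simp: dist_real_def)
    then have "(x, t) \<in> K"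
      using x t e by (auto simp: K_def)
    moreover have "x \<in> cball (c (x, t)) (r (x, t))" "r (x, t) < d"
      using t unfolding cball by (auto simp: r_def)
    ultimately show ?thesis by blast
  qed
  obtain C where "countable C" "C \<subseteq> K"
     "pairwise (\<lambda>i j. disjnt (cball (c i) (r i)) (cball (c j) (r j))) C"
     "negligible (E - (\<Union>i \<in> C. cball (c i) (r i)))"
    using Vitali_covering_theorem_cballs[of K r E c] r S by blast
  then show ?thesis
    by (intro that[of C]) (auto simp: K_def[symmetric] cball disjoint_family_on_def pairwise_def disjnt_def)
qed

text \<open>Two nested Vitali coverings compare length with the Stieltjes measure
  \<open>\<nu>\<close> of \<open>g\<close>. Intervals on which \<open>g\<close> grows slowly cover
  almost all of \<open>E\<close> inside a slightly larger open set, so their union has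
  \<open>\<nu>\<close>-mass at most about \<open>a\<close> times the length of \<open>E\<close>.
  Inside them, intervals on which \<open>g\<close> grows fast again cover almost all of
  \<open>E\<close> and force the \<open>\<nu>\<close>-mass to be at least \<open>b\<close> times
  that length. Continuity of \<open>g\<close> excludes atoms, so closed intervals have the expected
  mass.\<close>

lemma mono_Dini_gap_null:
  fixes g :: "real \<Rightarrow> real"
  assumes g: "mono g" "continuous_on UNIV g"
    and ab: "0 < a" "a < b"
    and E: "E \<in> sets borel" "emeasure lborel E < \<infinity>"
    and lo: "\<And>x e. x \<in> E \<Longrightarrow> 0 < e \<Longrightarrow> \<exists>t. 0 < t \<and> t < e \<and> g (x + t) - g x < a * t"
    and hi: "\<And>x e. x \<in> E \<Longrightarrow> 0 < e \<Longrightarrow> \<exists>t. 0 < t \<and> t < e \<and> b * t < g (x + t) - g x"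
  shows "emeasure lborel E = 0"
proof -
  define \<nu> where "\<nu> = interval_measure g"
  define I where "I = (\<lambda>(x::real, t). {x..x + t})"
  have [measurable]: "E \<in> sets borel" by (rule E)
  have sets_\<nu>: "sets \<nu> = sets borel" by (simp add: \<nu>_def)
  have Iborel: "I i \<in> sets borel" for i by (auto simp: I_def split: prod.split)
  have \<nu>: "emeasure \<nu> (I (x, t)) = ennreal (g (x + t) - g x)" "emeasure lborel (I (x, t)) = ennreal t"
    if "0 < t" for x t
    unfolding \<nu>_def I_def using that g
    by (auto intro!: emeasure_interval_measure_Icc monoD[OF g(1)])
  have UN: "emeasure \<nu> (\<Union>(I ` C)) = (\<integral>\<^sup>+i. emeasure \<nu> (I i) \<partial>count_space C)"
    "emeasure lborel (\<Union>(I ` C)) = (\<integral>\<^sup>+i. emeasure lborel (I i) \<partial>count_space C)"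
    if "countable C" "disjoint_family_on I C" for C
    using that by (auto intro!: emeasure_UN_countable simp: Iborel sets_\<nu>)
  have null0: "emeasure lborel S = 0" if "negligible S" "S \<in> sets borel" for S :: "real set"
    using that by (simp add: negligible_iff_null_sets null_sets_def)
  have Elm: "E \<in> lmeasurable"
    using E by (auto simp: fmeasurable_def)
  have key: "ennreal b * emeasure lborel E \<le> ennreal a * (emeasure lborel E + ennreal \<eta>)" if \<eta>: "\<eta> > 0" for \<eta>
  proof -
    obtain U where U: "open U" "E \<subseteq> U" "U - E \<in> lmeasurable" "emeasure lebesgue (U - E) < ennreal \<eta>"
      using sets_lebesgue_outer_open[of E \<eta>] E \<eta> by auto
    have "emeasure lborel U = emeasure lborel (E \<union> (U - E))"
      using U by (simp add: Un_absorb1)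
    also have "\<dots> \<le> emeasure lborel E + emeasure lborel (U - E)"
      using U(1) by (intro emeasure_subadditive) auto
    also have "emeasure lborel (U - E) \<le> ennreal \<eta>"
      using U by simp
    finally have lU: "emeasure lborel U \<le> emeasure lborel E + ennreal \<eta>"
      by (simp add: add_left_mono)
    obtain C where C: "countable C" "C \<subseteq> {(x, t). x \<in> E \<and> 0 < t \<and> {x..x + t} \<subseteq> U \<and> g (x + t) - g x < a * t}"
      "disjoint_family_on I C" "negligible (E - \<Union>(I ` C))"
      using Vitali_cover_right_intervals[of U E "\<lambda>x t. g (x + t) - g x < a * t", OF U(1,2) lo]
      unfolding I_def by (metis (no_types, lifting))
    \<comment> \<open>The second covering has to live in an open set, so the first one is replaced
      by its open interiors. Only countably many endpoints are lost.\<close>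
    define V where "V = (\<Union>(x, t)\<in>C. {x<..<x + t})"
    have V: "open V" "V \<subseteq> \<Union>(I ` C)" by (auto simp: V_def I_def)
    have CU: "\<Union>(I ` C) \<subseteq> U" using C(2) by (fastforce simp: I_def)
    have CI: "\<Union>(I ` C) \<in> sets borel" by (intro sets.countable_UN' C(1)) (auto intro: Iborel)
    have "emeasure \<nu> V \<le> emeasure \<nu> (\<Union>(I ` C))"
      using V CI by (intro emeasure_mono) (auto simp: sets_\<nu>)
    also have "\<dots> = (\<integral>\<^sup>+i. emeasure \<nu> (I i) \<partial>count_space C)" using UN C by blast
    also have "\<dots> \<le> (\<integral>\<^sup>+i. ennreal a * emeasure lborel (I i) \<partial>count_space C)"
    proof (intro nn_integral_mono)
      fix i assume "i \<in> space (count_space C)"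
      then obtain x t where i: "i = (x, t)" "0 < t" "g (x + t) - g x < a * t" using C(2) by auto
      then show "emeasure \<nu> (I i) \<le> ennreal a * emeasure lborel (I i)"
        using ab by (auto simp: \<nu> ennreal_mult[symmetric] intro!: ennreal_leI)
    qed
    also have "\<dots> = ennreal a * emeasure lborel (\<Union>(I ` C))"
      using UN C by (simp add: nn_integral_cmult)
    also have "\<dots> \<le> ennreal a * emeasure lborel U"
      using CU U(1) by (intro mult_left_mono emeasure_mono) auto
    also have "\<dots> \<le> ennreal a * (emeasure lborel E + ennreal \<eta>)"
      by (intro mult_left_mono lU) auto
    finally have 1: "emeasure \<nu> V \<le> ennreal a * (emeasure lborel E + ennreal \<eta>)" .
    obtain D where D: "countable D" "D \<subseteq> {(x, t). x \<in> E \<inter> V \<and> 0 < t \<and> {x..x + t} \<subseteq> V \<and> b * t < g (x + t) - g x}"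
      "disjoint_family_on I D" "negligible (E \<inter> V - \<Union>(I ` D))"
      using Vitali_cover_right_intervals[of V "E \<inter> V" "\<lambda>x t. b * t < g (x + t) - g x", OF V(1) _ hi]
      unfolding I_def by (metis (no_types, lifting) IntD1 inf_le2)
    have DV: "\<Union>(I ` D) \<subseteq> V" using D(2) by (fastforce simp: I_def)
    have DI: "\<Union>(I ` D) \<in> sets borel" by (intro sets.countable_UN' D(1)) (auto intro: Iborel)
    have "\<Union>(I ` C) - V \<subseteq> fst ` C \<union> (\<lambda>(x, t). x + t) ` C"
      by (force simp: I_def V_def image_iff)
    then have "negligible (\<Union>(I ` C) - V)"
      by (rule negligible_subset[rotated]) (use C(1) in \<open>auto simp: negligible_iff_null_sets intro!: null_sets_completionI countable_imp_null_set_lborel\<close>)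
    with C(4) D(4) have "negligible ((E - \<Union>(I ` C)) \<union> (\<Union>(I ` C) - V) \<union> (E \<inter> V - \<Union>(I ` D)))"
      by (intro negligible_Un)
    then have "negligible (E - \<Union>(I ` D))"
      by (rule negligible_subset) auto
    then have z: "emeasure lborel (E - \<Union>(I ` D)) = 0"
      using DI by (intro null0) auto
    have "emeasure lborel E \<le> emeasure lborel (\<Union>(I ` D) \<union> (E - \<Union>(I ` D)))"
      using DI by (intro emeasure_mono) auto
    also have "\<dots> \<le> emeasure lborel (\<Union>(I ` D)) + emeasure lborel (E - \<Union>(I ` D))"
      using DI by (intro emeasure_subadditive) auto
    finally have "emeasure lborel E \<le> emeasure lborel (\<Union>(I ` D))" by (simp add: z)
    then have "ennreal b * emeasure lborel E \<le> ennreal b * emeasure lborel (\<Union>(I ` D))"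
      by (intro mult_left_mono) auto
    also have "\<dots> = (\<integral>\<^sup>+i. ennreal b * emeasure lborel (I i) \<partial>count_space D)"
      using UN D by (simp add: nn_integral_cmult)
    also have "\<dots> \<le> (\<integral>\<^sup>+i. emeasure \<nu> (I i) \<partial>count_space D)"
    proof (intro nn_integral_mono)
      fix i assume "i \<in> space (count_space D)"
      then obtain x t where i: "i = (x, t)" "0 < t" "b * t < g (x + t) - g x" using D(2) by auto
      then show "ennreal b * emeasure lborel (I i) \<le> emeasure \<nu> (I i)"
        using ab by (auto simp: \<nu> ennreal_mult[symmetric] intro!: ennreal_leI)
    qed
    also have "\<dots> = emeasure \<nu> (\<Union>(I ` D))" using UN D by simp
    also have "\<dots> \<le> emeasure \<nu> V"
      using V DV by (intro emeasure_mono) (auto simp: sets_\<nu>)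
    also note 1
    finally show ?thesis .
  qed
  define m where "m = measure lborel E"
  have m: "emeasure lborel E = ennreal m" "m \<ge> 0"
    using E by (auto simp: m_def emeasure_eq_ennreal_measure)
  have "b * m \<le> a * (m + \<eta>)" if "\<eta> > 0" for \<eta>
    using key[OF that] that ab m(2) by (simp add: m(1) ennreal_mult[symmetric] ennreal_plus[symmetric] del: ennreal_plus)
  \<comment> \<open>The choice \<open>\<eta> = (b - a) * m / (2 * a)\<close> turns the excess
    \<open>a * \<eta>\<close> into half of \<open>(b - a) * m\<close>, which is too small to close
    the gap unless \<open>m = 0\<close>.\<close>
  then have "b * m \<le> a * (m + (b - a) * m / (2 * a))" if "m > 0"
    using ab that by simp
  then have "b * m \<le> a * m + (b - a) * m / 2" if "m > 0"
    using ab that by (simp add: distrib_left)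
  moreover have "b * m - a * m = (b - a) * m" by (rule left_diff_distrib[symmetric])
  ultimately have "(b - a) * m \<le> 0" if "m > 0"
    using that by linarith
  then have "\<not> m > 0"
    using ab by (fastforce simp: mult_le_0_iff)
  then show ?thesis using m by simp
qed

lemma lipschitz_real_bound:
  fixes f :: "'a::real_normed_vector \<Rightarrow> real"
  assumes "L-lipschitz_on UNIV f"
  shows "\<bar>f x - f y\<bar> \<le> L * norm (x - y)"
  using lipschitz_onD[OF assms, of x y] by (simp add: dist_norm)

text \<open>Adding \<open>L * x\<close> makes \<open>g\<close> increasing and shifts both slopes by
  \<open>L\<close>. The shifted lower slope \<open>a + L\<close> is positive because some quotient
  lies below \<open>a\<close> and all quotients are at least \<open>- L\<close>; this is where a
  point of \<open>E\<close> is needed. Cutting \<open>E\<close> to bounded intervals supplies finite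
  measure.\<close>

lemma lipschitz_Dini_gap_null:
  fixes g :: "real \<Rightarrow> real"
  assumes g: "L-lipschitz_on UNIV g"
    and ab: "a < b"
    and E: "E \<in> sets borel"
    and lo: "\<And>x e. x \<in> E \<Longrightarrow> 0 < e \<Longrightarrow> \<exists>t. 0 < t \<and> t < e \<and> g (x + t) - g x < a * t"
    and hi: "\<And>x e. x \<in> E \<Longrightarrow> 0 < e \<Longrightarrow> \<exists>t. 0 < t \<and> t < e \<and> b * t < g (x + t) - g x"
  shows "emeasure lborel E = 0"
proof (cases "E = {}")
  case False
  then obtain x0 where "x0 \<in> E" by auto
  have lip: "\<bar>g x - g y\<bar> \<le> L * \<bar>x - y\<bar>" for x y
    using lipschitz_real_bound[OF g] by simp
  obtain t0 where t0: "0 < t0" "g (x0 + t0) - g x0 < a * t0"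
    using lo[OF \<open>x0 \<in> E\<close>, of 1] by auto
  have "- (L * t0) \<le> g (x0 + t0) - g x0"
    using lip[of "x0 + t0" x0] t0 by simp
  with t0 have "0 < (a + L) * t0" by (simp add: algebra_simps)
  with t0 have aL: "0 < a + L" by (simp add: zero_less_mult_iff)
  define h where "h x = g x + L * x" for x
  have mono: "mono h"
  proof (rule monoI)
    fix x y :: real assume "x \<le> y"
    with lip[of x y] show "h x \<le> h y" by (simp add: h_def algebra_simps)
  qed
  have cont: "continuous_on UNIV h"
    unfolding h_def by (intro continuous_intros lipschitz_on_continuous_on[OF g])
  have "emeasure lborel (E \<inter> {-real n..real n}) = 0" for n
  proof (rule mono_Dini_gap_null[OF mono cont aL])
    show "a + L < b + L" using ab by simp
    show "E \<inter> {- real n..real n} \<in> sets borel" using E by auto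
    have "emeasure lborel (E \<inter> {- real n..real n}) \<le> emeasure lborel {- real n..real n}"
      using E by (intro emeasure_mono) auto
    also have "\<dots> < \<infinity>" by simp
    finally show "emeasure lborel (E \<inter> {- real n..real n}) < \<infinity>" .
  next
    fix x e :: real assume x: "x \<in> E \<inter> {- real n..real n}" "0 < e"
    show "\<exists>t>0. t < e \<and> h (x + t) - h x < (a + L) * t"
      using lo[of x e] x by (auto simp: h_def algebra_simps)
    show "\<exists>t>0. t < e \<and> (b + L) * t < h (x + t) - h x"
      using hi[of x e] x by (auto simp: h_def algebra_simps)
  qed
  then have "emeasure lborel (\<Union>n. E \<inter> {-real n..real n}) = 0"
    using E by (intro emeasure_UN_eq_0) auto
  also have "(\<Union>n. E \<inter> {-real n..real n}) = E"
  proof -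
    have "\<exists>n. \<bar>x\<bar> \<le> real n" for x :: real by (rule real_arch_simple)
    then show ?thesis by (auto simp: abs_le_iff) (metis abs_le_iff minus_le_iff)
  qed
  finally show ?thesis .
qed auto

text \<open>No change of coordinates is needed: the indicator of \<open>N\<close> at
  \<open>x + t *\<^sub>R v\<close> is integrated over all \<open>x\<close> and all real
  \<open>t\<close>. Integrating over \<open>t\<close> first gives zero by assumption; integrating
  over \<open>x\<close> first gives the measure of \<open>N\<close> for every \<open>t\<close>,
  hence that measure times infinity.\<close>

lemma lborel_null_if_lines_null:
  fixes N :: "'a::euclidean_space set"
  assumes N: "N \<in> sets borel" and null: "\<And>x. emeasure lborel {t::real. x + t *\<^sub>R v \<in> N} = 0"
  shows "emeasure lborel N = 0"
proof -
  have [measurable]: "N \<in> sets borel" by (rule N)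
  have sh: "(\<integral>\<^sup>+x. indicator N (x + t *\<^sub>R v) \<partial>lborel) = emeasure lborel N" for t :: real
  proof -
    have "emeasure lborel N = (\<integral>\<^sup>+x. indicator N x \<partial>distr lborel borel ((+) (t *\<^sub>R v)))"
      by (simp add: lborel_distr_plus)
    also have "\<dots> = (\<integral>\<^sup>+x. indicator N (t *\<^sub>R v + x) \<partial>lborel)"
      by (subst nn_integral_distr) auto
    finally show ?thesis by (simp add: add.commute)
  qed
  have "(\<integral>\<^sup>+x. \<integral>\<^sup>+t. indicator N (x + t *\<^sub>R v) \<partial>(lborel::real measure) \<partial>lborel)
     = (\<integral>\<^sup>+t. \<integral>\<^sup>+x. indicator N (x + t *\<^sub>R v) \<partial>lborel \<partial>(lborel::real measure))"
    by (rule lborel_pair.Fubini') measurable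
  moreover have "(\<integral>\<^sup>+t. indicator N (x + t *\<^sub>R v) \<partial>(lborel::real measure)) = 0" for x
  proof -
    have "(\<integral>\<^sup>+t. indicator N (x + t *\<^sub>R v) \<partial>(lborel::real measure)) = (\<integral>\<^sup>+t. indicator {t. x + t *\<^sub>R v \<in> N} t \<partial>lborel)"
      by (intro nn_integral_cong) (auto simp: indicator_def)
    also have "\<dots> = emeasure lborel {t. x + t *\<^sub>R v \<in> N}"
      by (intro nn_integral_indicator) measurable
    finally show ?thesis by (simp add: null)
  qed
  ultimately have "emeasure lborel N * (\<infinity>::ennreal) = 0"
    by (simp add: sh)
  then show ?thesis by (simp add: ennreal_mult_eq_top_iff)
qed

text \<open>The existential over the uncountably many \<open>t\<close> is harmless: for each
  \<open>t\<close> the condition on \<open>x\<close> is open by continuity, so the union is open and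
  only the intersection over \<open>n\<close> has to be countable.\<close>

lemma Dini_gap_borel:
  fixes f :: "'a::euclidean_space \<Rightarrow> real"
  assumes "continuous_on UNIV f"
  shows "{x. \<forall>n. \<exists>t. 0 < t \<and> t < 1 / real (Suc n) \<and> f (x + t *\<^sub>R v) - f x < a * t} \<in> sets borel"
    "{x. \<forall>n. \<exists>t. 0 < t \<and> t < 1 / real (Suc n) \<and> b * t < f (x + t *\<^sub>R v) - f x} \<in> sets borel"
proof -
  have c: "continuous_on UNIV (\<lambda>x. f (x + t *\<^sub>R v) - f x)" for t
    by (intro continuous_intros continuous_on_compose2[OF assms]) auto
  have "{x. \<forall>n. \<exists>t. 0 < t \<and> t < 1 / real (Suc n) \<and> f (x + t *\<^sub>R v) - f x < a * t}
     = (\<Inter>n. \<Union>t\<in>{0<..<1 / real (Suc n)}. {x. f (x + t *\<^sub>R v) - f x < a * t})"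
    by (simp add: set_eq_iff Bex_def conj_assoc del: of_nat_Suc)
  also have "\<dots> \<in> sets borel"
    by (intro sets.countable_INT'' borel_open open_UN ballI open_Collect_less c continuous_intros) auto
  finally show "{x. \<forall>n. \<exists>t. 0 < t \<and> t < 1 / real (Suc n) \<and> f (x + t *\<^sub>R v) - f x < a * t} \<in> sets borel" .
  have "{x. \<forall>n. \<exists>t. 0 < t \<and> t < 1 / real (Suc n) \<and> b * t < f (x + t *\<^sub>R v) - f x}
     = (\<Inter>n. \<Union>t\<in>{0<..<1 / real (Suc n)}. {x. b * t < f (x + t *\<^sub>R v) - f x})"
    by (simp add: set_eq_iff Bex_def conj_assoc del: of_nat_Suc)
  also have "\<dots> \<in> sets borel"
    by (intro sets.countable_INT'' borel_open open_UN ballI open_Collect_less c continuous_intros) auto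
  finally show "{x. \<forall>n. \<exists>t. 0 < t \<and> t < 1 / real (Suc n) \<and> b * t < f (x + t *\<^sub>R v) - f x} \<in> sets borel" .
qed

lemma AE_no_Dini_gap:
  fixes f :: "'a::euclidean_space \<Rightarrow> real"
  assumes f: "L-lipschitz_on UNIV f" and ab: "a < b"
  shows "AE x in lborel. \<not> ((\<forall>n. \<exists>t. 0 < t \<and> t < 1 / real (Suc n) \<and> f (x + t *\<^sub>R v) - f x < a * t)
    \<and> (\<forall>n. \<exists>t. 0 < t \<and> t < 1 / real (Suc n) \<and> b * t < f (x + t *\<^sub>R v) - f x))"
proof -
  define N where "N = {x. \<forall>n. \<exists>t. 0 < t \<and> t < 1 / real (Suc n) \<and> f (x + t *\<^sub>R v) - f x < a * t}
    \<inter> {x. \<forall>n. \<exists>t. 0 < t \<and> t < 1 / real (Suc n) \<and> b * t < f (x + t *\<^sub>R v) - f x}"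
  have N[measurable]: "N \<in> sets borel"
    unfolding N_def by (intro sets.Int Dini_gap_borel lipschitz_on_continuous_on[OF f])
  have "emeasure lborel {s::real. x + s *\<^sub>R v \<in> N} = 0" for x
  proof (rule lipschitz_Dini_gap_null[where g = "\<lambda>s. f (x + s *\<^sub>R v)" and L = "L * norm v", OF _ ab])
    show "(L * norm v)-lipschitz_on UNIV (\<lambda>s. f (x + s *\<^sub>R v))"
    proof (rule lipschitz_onI)
      fix s t :: real
      have "\<bar>f (x + s *\<^sub>R v) - f (x + t *\<^sub>R v)\<bar> \<le> L * norm ((s - t) *\<^sub>R v)"
        using lipschitz_real_bound[OF f, of "x + s *\<^sub>R v" "x + t *\<^sub>R v"] by (simp add: scaleR_diff_left)
      then show "dist (f (x + s *\<^sub>R v)) (f (x + t *\<^sub>R v)) \<le> L * norm v * dist s t"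
        by (simp add: dist_real_def mult_ac)
    qed (use lipschitz_on_nonneg[OF f] in auto)
    show "{s. x + s *\<^sub>R v \<in> N} \<in> sets borel" by measurable
  next
    fix s e :: real assume s: "s \<in> {s. x + s *\<^sub>R v \<in> N}" "0 < e"
    then obtain n where n: "1 / real (Suc n) < e" using nat_approx_posE by metis
    have "\<exists>t>0. t < 1 / real (Suc n) \<and> f (x + s *\<^sub>R v + t *\<^sub>R v) - f (x + s *\<^sub>R v) < a * t"
      "\<exists>t>0. t < 1 / real (Suc n) \<and> b * t < f (x + s *\<^sub>R v + t *\<^sub>R v) - f (x + s *\<^sub>R v)"
      using s unfolding N_def by blast+
    with n show "\<exists>t>0. t < e \<and> f (x + (s + t) *\<^sub>R v) - f (x + s *\<^sub>R v) < a * t"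
      "\<exists>t>0. t < e \<and> b * t < f (x + (s + t) *\<^sub>R v) - f (x + s *\<^sub>R v)"
      by (metis (no_types, lifting) add.assoc scaleR_left.add order.strict_trans)+
  qed
  then have "emeasure lborel N = 0" by (rule lborel_null_if_lines_null[OF N])
  then have "AE x in lborel. x \<notin> N" by (intro AE_not_in) (auto simp: null_sets_def)
  then show ?thesis by (auto simp: N_def)
qed

text \<open>If the lower and upper limits differed, two rationals would fit between them.
  Restricting to rational pairs leaves only countably many exceptional null sets when this is
  applied almost everywhere.\<close>

lemma tendsto_at_right_if_no_gap:
  fixes q :: "real \<Rightarrow> real"
  assumes bdd: "\<And>t. 0 < t \<Longrightarrow> \<bar>q t\<bar> \<le> B"
    and gap: "\<And>a b. a \<in> \<rat> \<Longrightarrow> b \<in> \<rat> \<Longrightarrow> a < b \<Longrightarrow>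
      \<not> ((\<forall>n. \<exists>t. 0 < t \<and> t < 1 / real (Suc n) \<and> q t < a) \<and> (\<forall>n. \<exists>t. 0 < t \<and> t < 1 / real (Suc n) \<and> b < q t))"
  shows "\<exists>D. (q \<longlongrightarrow> D) (at_right 0)"
proof -
  define l where "l = Liminf (at_right 0) (\<lambda>t. ereal (q t))"
  define u where "u = Limsup (at_right 0) (\<lambda>t. ereal (q t))"
  have ev: "\<forall>\<^sub>F t in at_right (0::real). 0 < t" by (rule eventually_at_right_less)
  have nt: "at_right (0::real) \<noteq> bot" by simp
  have lu: "l \<le> u" unfolding l_def u_def by (rule Liminf_le_Limsup[OF nt])
  have lb: "ereal (-B) \<le> l" unfolding l_def
    by (rule Liminf_bounded, rule eventually_mono[OF ev]) (use bdd in \<open>force simp: abs_le_iff\<close>)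
  have ub: "u \<le> ereal B" unfolding u_def
    by (rule Limsup_bounded, rule eventually_mono[OF ev]) (use bdd in \<open>force simp: abs_le_iff\<close>)
  have "u \<le> l"
  proof (rule ccontr)
    assume "\<not> u \<le> l"
    then have "real_of_ereal l < real_of_ereal u"
      using lb ub by (cases l; cases u) auto
    moreover have lr: "l = ereal (real_of_ereal l)" "u = ereal (real_of_ereal u)"
      using lb ub lu by (cases l; cases u; auto)+
    ultimately obtain b where b: "b \<in> \<rat>" "real_of_ereal l < b" "b < real_of_ereal u" using Rats_dense_in_real by blast
    obtain a where a: "a \<in> \<rat>" "real_of_ereal l < a" "a < b" using Rats_dense_in_real b by blast
    have la: "l < ereal a" using a lr by (metis less_ereal.simps(1))
    have bu: "ereal b < u" using b lr by (metis less_ereal.simps(1))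
    have 1: "\<exists>t. 0 < t \<and> t < 1 / real (Suc n) \<and> q t < a" for n
    proof (rule ccontr)
      assume "\<not> ?thesis"
      then have "\<forall>\<^sub>F t in at_right 0. ereal a \<le> ereal (q t)"
        unfolding eventually_at_right_field by (intro exI[of _ "1 / real (Suc n)"]) force
      then have "ereal a \<le> l" unfolding l_def by (rule Liminf_bounded)
      with la show False by simp
    qed
    have 2: "\<exists>t. 0 < t \<and> t < 1 / real (Suc n) \<and> b < q t" for n
    proof (rule ccontr)
      assume "\<not> ?thesis"
      then have "\<forall>\<^sub>F t in at_right 0. ereal (q t) \<le> ereal b"
        unfolding eventually_at_right_field by (intro exI[of _ "1 / real (Suc n)"]) force
      then have "u \<le> ereal b" unfolding u_def by (rule Limsup_bounded)
      with bu show False by simp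
    qed
    from gap[OF a(1) b(1) a(3)] 1 2 show False by blast
  qed
  with lu have "l = u" by simp
  then have "((\<lambda>t. ereal (q t)) \<longlongrightarrow> l) (at_right 0)"
    unfolding l_def u_def by (simp add: tendsto_iff_Liminf_eq_Limsup nt)
  moreover have "l = ereal (real_of_ereal l)"
    using lb ub \<open>l = u\<close> by (cases l) auto
  ultimately show ?thesis by (metis lim_ereal)
qed

lemma AE_right_directional_derivative:
  fixes f :: "'a::euclidean_space \<Rightarrow> real"
  assumes f: "L-lipschitz_on UNIV f"
  shows "AE x in lborel. \<exists>D. ((\<lambda>t. (f (x + t *\<^sub>R v) - f x) / t) \<longlongrightarrow> D) (at_right 0)"
proof -
  have "AE x in lborel. \<forall>p\<in>\<rat>\<times>\<rat>. fst p < snd p \<longrightarrow>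
    \<not> ((\<forall>n. \<exists>t. 0 < t \<and> t < 1 / real (Suc n) \<and> f (x + t *\<^sub>R v) - f x < fst p * t)
    \<and> (\<forall>n. \<exists>t. 0 < t \<and> t < 1 / real (Suc n) \<and> snd p * t < f (x + t *\<^sub>R v) - f x))"
    (is "AE x in lborel. \<forall>p\<in>\<rat>\<times>\<rat>. ?Q p x")
  proof (subst AE_ball_countable)
    show "countable (\<rat> \<times> \<rat> :: (real \<times> real) set)" by (intro countable_SIGMA countable_rat)
    show "\<forall>p\<in>\<rat>\<times>\<rat>. AE x in lborel. ?Q p x"
      using AE_no_Dini_gap[OF f, where v = v] by auto
  qed
  then show ?thesis
  proof eventually_elim
    case (elim x)
    show ?case
    proof (rule tendsto_at_right_if_no_gap[where B = "L * norm v"])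
      fix t :: real assume "0 < t"
      then show "\<bar>(f (x + t *\<^sub>R v) - f x) / t\<bar> \<le> L * norm v"
        using lipschitz_real_bound[OF f, of "x + t *\<^sub>R v" x] by (simp add: field_simps)
    next
      fix a b :: real assume "a \<in> \<rat>" "b \<in> \<rat>" "a < b"
      then have "?Q (a, b) x" using elim by blast
      with \<open>a < b\<close> show "\<not> ((\<forall>n. \<exists>t. 0 < t \<and> t < 1 / real (Suc n) \<and> (f (x + t *\<^sub>R v) - f x) / t < a) \<and>
        (\<forall>n. \<exists>t. 0 < t \<and> t < 1 / real (Suc n) \<and> b < (f (x + t *\<^sub>R v) - f x) / t))"
        by (simp add: pos_divide_less_eq pos_less_divide_eq cong: conj_cong)
    qed
  qed
qed

text \<open>Lebesgue measure is determined by the volumes of boxes. For \<open>K\<close> above the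
  bound on \<open>h\<close>, the function \<open>1 + h x / K\<close> is nonnegative almost
  everywhere and, as a density, gives every box its usual volume. It therefore defines Lebesgue
  measure, and uniqueness of densities makes it equal to 1.\<close>

lemma AE_zero_if_box_integrals_zero:
  fixes h :: "'a::euclidean_space \<Rightarrow> real"
  assumes h[measurable]: "h \<in> borel_measurable borel" and C: "AE x in lborel. \<bar>h x\<bar> \<le> C"
    and box: "\<And>l u. (\<integral>x. indicator (box l u) x * h x \<partial>lborel) = 0"
  shows "AE x in lborel. h x = 0"
proof -
  define K where "K = \<bar>C\<bar> + 1"
  have K: "K > 0" by (simp add: K_def)
  have bd: "AE x in lborel. 0 \<le> 1 + h x / K"
    using C by eventually_elim (auto simp: K_def field_simps abs_le_iff)
  have "lborel = density lborel (\<lambda>x. ennreal (1 + h x / K))"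
  proof (rule lborel_eqI)
    fix l u :: 'a assume lu: "\<And>b. b \<in> Basis \<Longrightarrow> l \<bullet> b \<le> u \<bullet> b"
    have i1: "integrable lborel (indicat_real (box l u))"
      using emeasure_lborel_box_finite[of l u] by (simp add: integrable_indicator_iff)
    have i2: "integrable lborel (\<lambda>x. indicator (box l u) x * h x)"
    proof (rule Bochner_Integration.integrable_bound[OF integrable_mult_right[OF i1, of C]])
      show "AE x in lborel. norm (indicator (box l u) x * h x) \<le> norm (C * indicat_real (box l u) x)"
        using C by eventually_elim (auto simp: indicator_def)
    qed measurable
    have eq: "indicator (box l u) x + indicator (box l u) x * h x / K = indicator (box l u) x * (1 + h x / K)" for x
      by (simp add: algebra_simps)
    have "emeasure (density lborel (\<lambda>x. ennreal (1 + h x / K))) (box l u)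
        = (\<integral>\<^sup>+x. ennreal (1 + h x / K) * indicator (box l u) x \<partial>lborel)"
      by (subst emeasure_density) auto
    also have "\<dots> = (\<integral>\<^sup>+x. ennreal (indicator (box l u) x + indicator (box l u) x * h x / K) \<partial>lborel)"
      by (intro nn_integral_cong) (auto simp: indicator_def)
    also have "\<dots> = ennreal (\<integral>x. indicator (box l u) x + indicator (box l u) x * h x / K \<partial>lborel)"
    proof (rule nn_integral_eq_integral)
      show "integrable lborel (\<lambda>x. indicat_real (box l u) x + indicator (box l u) x * h x / K)"
        using i1 i2 by (intro Bochner_Integration.integrable_add integrable_divide) auto
      show "AE x in lborel. 0 \<le> indicat_real (box l u) x + indicator (box l u) x * h x / K"
        unfolding eq using bd by eventually_elim auto
    qed
    also have "(\<integral>x. indicator (box l u) x + indicator (box l u) x * h x / K \<partial>lborel) = measure lborel (box l u)"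
      using i1 i2 box by (simp add: Bochner_Integration.integral_add integrable_divide)
    also have "ennreal \<dots> = ennreal (\<Prod>b\<in>Basis. (u - l) \<bullet> b)"
      using lu by (simp add: measure_lborel_box)
    finally show "emeasure (density lborel (\<lambda>x. ennreal (1 + h x / K))) (box l u) = ennreal (\<Prod>b\<in>Basis. (u - l) \<bullet> b)" .
  qed simp
  then have "density lborel (\<lambda>_. 1) = density lborel (\<lambda>x. ennreal (1 + h x / K))"
    by (simp add: density_1)
  then have "AE x in lborel. 1 = ennreal (1 + h x / K)"
    by (intro sigma_finite_measure.density_unique[OF sigma_finite_lborel]) auto
  then show ?thesis
    using bd
  proof eventually_elim
    case (elim x)
    then have "1 + h x / K = 1" by (metis ennreal_1 ennreal_inj zero_le_one)
    with K show ?case by simp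
  qed
qed

text \<open>Fixing the increments \<open>1 / (n + 1)\<close> makes this a pointwise limit of a
  sequence of Borel functions, hence Borel everywhere, including where the one-sided derivative does
  not exist and the value is arbitrary.\<close>

definition dir_deriv :: "('a::real_normed_vector \<Rightarrow> real) \<Rightarrow> 'a \<Rightarrow> 'a \<Rightarrow> real" where
  "dir_deriv f v x = lim (\<lambda>n. (f (x + (1 / real (Suc n)) *\<^sub>R v) - f x) / (1 / real (Suc n)))"

lemma inverse_Suc_at_right: "filterlim (\<lambda>n. 1 / real (Suc n)) (at_right 0) sequentially"
  unfolding filterlim_at
  using LIMSEQ_inverse_real_of_nat by (auto simp: inverse_eq_divide)

lemma dir_deriv_eq:
  assumes "((\<lambda>t. (f (x + t *\<^sub>R v) - f x) / t) \<longlongrightarrow> D) (at_right 0)"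
  shows "dir_deriv f v x = D"
  unfolding dir_deriv_def
  by (rule limI) (rule filterlim_compose[OF assms inverse_Suc_at_right])

section \<open>Linearity of directional derivatives and total differentiability\<close>

context
  fixes f :: "'a::euclidean_space \<Rightarrow> real" and L :: real
  assumes lip: "L-lipschitz_on UNIV f"
begin

lemma lipschitz_measurable [measurable]: "f \<in> borel_measurable borel"
  by (intro borel_measurable_continuous_onI lipschitz_on_continuous_on[OF lip])

lemma lipschitz_quotient_bound: "\<bar>(f (x + t *\<^sub>R v) - f x) / t\<bar> \<le> L * norm v"
  using lipschitz_real_bound[OF lip, of "x + t *\<^sub>R v" x] lipschitz_on_nonneg[OF lip]
  by (cases "t = 0") (auto simp: field_simps)

lemma dir_deriv_measurable [measurable]: "dir_deriv f v \<in> borel_measurable borel"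
  unfolding dir_deriv_def by measurable

lemma AE_dir_deriv:
  "AE x in lborel. ((\<lambda>t. (f (x + t *\<^sub>R v) - f x) / t) \<longlongrightarrow> dir_deriv f v x) (at_right 0)"
  using AE_right_directional_derivative[OF lip, of v] by eventually_elim (metis dir_deriv_eq)

lemma AE_dir_deriv_seq:
  "AE x in lborel. (\<lambda>n. (f (x + (1 / real (Suc n)) *\<^sub>R v) - f x) / (1 / real (Suc n))) \<longlonglongrightarrow> dir_deriv f v x"
  using AE_dir_deriv[of v] by eventually_elim (rule filterlim_compose[OF _ inverse_Suc_at_right])

lemma AE_dir_deriv_bound: "AE x in lborel. \<bar>dir_deriv f v x\<bar> \<le> L * norm v"
  using AE_dir_deriv_seq[of v]
  by eventually_elim
    (rule tendsto_upperbound[OF tendsto_rabs always_eventually[OF allI[OF lipschitz_quotient_bound]] sequentially_bot])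

text \<open>The moving box indicator is what a change of variables produces in the proof of
  additivity. It converges to the fixed indicator off the frontier of the box, which is null by
  convexity, and the Lipschitz bound on a larger ball dominates everything.\<close>

lemma box_dir_deriv_limit:
  "(\<lambda>n. \<integral>x. indicator (box l u) (x - (1 / real (Suc n)) *\<^sub>R w) *
      ((f (x + (1 / real (Suc n)) *\<^sub>R v) - f x) / (1 / real (Suc n))) \<partial>lborel)
    \<longlonglongrightarrow> (\<integral>x. indicator (box l u) x * dir_deriv f v x \<partial>lborel)"
  "integrable lborel (\<lambda>x. indicator (box l u) x * dir_deriv f v x)"
  "integrable lborel (\<lambda>x. indicator (box l u) (x - (1 / real (Suc n)) *\<^sub>R w) *
      ((f (x + (1 / real (Suc n)) *\<^sub>R v) - f x) / (1 / real (Suc n))))"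
proof -
  let ?s = "\<lambda>n. 1 / real (Suc n)"
  let ?q = "\<lambda>n x. (f (x + ?s n *\<^sub>R v) - f x) / ?s n"
  obtain R where R: "box l u \<subseteq> cball 0 R"
    using bounded_box[of l u] by (auto simp: bounded_iff subset_eq)
  define W where "W x = (L * norm v) * indicat_real (cball 0 (R + norm w)) x" for x :: 'a
  have W: "integrable lborel W" unfolding W_def
    using emeasure_bounded_finite[of "cball 0 (R + norm w)"] by (intro integrable_mult_right) (simp add: integrable_indicator_iff)
  have frontier: "AE x in lborel. x \<notin> frontier (box l u)"
  proof -
    have "frontier (box l u) \<in> null_sets lebesgue"
      using negligible_convex_frontier[of "box l u"] by (simp add: negligible_iff_null_sets convex_box)
    then have "frontier (box l u) \<in> null_sets lborel" by (simp add: null_sets_completion_iff)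
    then show ?thesis by (rule AE_not_in)
  qed
  have s0: "(\<lambda>n. x - ?s n *\<^sub>R w) \<longlonglongrightarrow> x" for x :: 'a
    using tendsto_diff[OF tendsto_const tendsto_scaleR[OF LIMSEQ_inverse_real_of_nat tendsto_const[of w]], of x]
    by (simp add: inverse_eq_divide)
  have conv: "AE x in lborel. (\<lambda>n. indicator (box l u) (x - ?s n *\<^sub>R w) * ?q n x) \<longlonglongrightarrow> indicator (box l u) x * dir_deriv f v x"
    using frontier AE_dir_deriv_seq[of v]
  proof eventually_elim
    case (elim x)
    have "(\<lambda>n. indicat_real (box l u) (x - ?s n *\<^sub>R w)) \<longlonglongrightarrow> indicator (box l u) x"
    proof (cases "x \<in> box l u")
      case True
      have "\<forall>\<^sub>F n in sequentially. x - ?s n *\<^sub>R w \<in> box l u"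
        using s0 open_box True by (rule topological_tendstoD)
      then show ?thesis using True
        by (intro tendsto_eventually) (auto elim!: eventually_mono)
    next
      case False
      then have "x \<in> - closure (box l u)" using elim(1) interior_subset[of "box l u"] by (auto simp: frontier_def)
      then have "\<forall>\<^sub>F n in sequentially. x - ?s n *\<^sub>R w \<in> - closure (box l u)"
        by (intro topological_tendstoD[OF s0]) auto
      then show ?thesis using False
        by (intro tendsto_eventually) (auto elim!: eventually_mono intro: closure_subset[THEN subsetD] simp: indicator_def)
    qed
    with elim(2) show ?case by (intro tendsto_mult)
  qed
  have bd: "norm (indicator (box l u) (x - ?s n *\<^sub>R w) * ?q n x) \<le> W x" for n x
  proof (cases "x - ?s n *\<^sub>R w \<in> box l u")
    case True
    then have "norm (x - ?s n *\<^sub>R w) \<le> R" using R by auto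
    moreover have "norm (?s n *\<^sub>R w) \<le> norm w"
      using mult_left_mono[of 1 "1 + real n" "norm w"] by (simp add: field_simps)
    ultimately have "norm x \<le> R + norm w"
      using norm_triangle_ineq[of "x - ?s n *\<^sub>R w" "?s n *\<^sub>R w"] by simp
    with True show ?thesis
      using lipschitz_quotient_bound[of x "?s n" v] by (simp add: W_def del: of_nat_Suc)
  next
    case False
    then show ?thesis using lipschitz_on_nonneg[OF lip] by (simp add: W_def)
  qed
  have meas: "(\<lambda>x. indicator (box l u) (x - ?s n *\<^sub>R w) * ?q n x) \<in> borel_measurable lborel" for n
    by measurable
  show "(\<lambda>n. \<integral>x. indicator (box l u) (x - ?s n *\<^sub>R w) * ?q n x \<partial>lborel)
    \<longlonglongrightarrow> (\<integral>x. indicator (box l u) x * dir_deriv f v x \<partial>lborel)"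
    by (rule integral_dominated_convergence[OF _ meas W conv]) (use bd in auto)
  show "integrable lborel (\<lambda>x. indicator (box l u) x * dir_deriv f v x)"
    by (rule integrable_dominated_convergence[OF _ meas W conv]) (use bd in auto)
  show "integrable lborel (\<lambda>x. indicator (box l u) (x - ?s n *\<^sub>R w) * ?q n x)"
    by (rule Bochner_Integration.integrable_bound[OF W meas AE_I2]) (rule order_trans[OF bd], simp)
qed

text \<open>The increment along \<open>v + w\<close> is the increment along \<open>v\<close> at
  \<open>x\<close> plus the increment along \<open>w\<close> at the shifted point
  \<open>x + ?s n *\<^sub>R v\<close>. The shifted point prevents a pointwise limit, but under an
  integral over a box the shift moves onto the box, where it disappears in the limit.\<close>

lemma AE_dir_deriv_add: "AE x in lborel. dir_deriv f (v + w) x = dir_deriv f v x + dir_deriv f w x"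
proof -
  let ?s = "\<lambda>n. 1 / real (Suc n)"
  let ?q = "\<lambda>v n x. (f (x + ?s n *\<^sub>R v) - f x) / ?s n"
  have "AE x in lborel. dir_deriv f (v + w) x - (dir_deriv f v x + dir_deriv f w x) = 0"
  proof (rule AE_zero_if_box_integrals_zero)
    show "AE x in lborel. \<bar>dir_deriv f (v + w) x - (dir_deriv f v x + dir_deriv f w x)\<bar>
      \<le> L * norm (v + w) + L * norm v + L * norm w"
      using AE_dir_deriv_bound[of "v + w"] AE_dir_deriv_bound[of v] AE_dir_deriv_bound[of w]
      by eventually_elim linarith
  next
    fix l u :: 'a
    let ?B = "box l u"
    let ?J = "\<lambda>v w n. \<integral>x. indicator ?B (x - ?s n *\<^sub>R w) * ?q v n x \<partial>lborel"
    note lim = box_dir_deriv_limit(1)[of l u] and int = box_dir_deriv_limit(2)[of l u]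
      and int' = box_dir_deriv_limit(3)[of l u]
    have sh: "(\<integral>x. indicator ?B x * ?q w n (x + ?s n *\<^sub>R v) \<partial>lborel) = ?J w v n"
      "integrable lborel (\<lambda>x. indicator ?B x * ?q w n (x + ?s n *\<^sub>R v))" for n
    proof -
      let ?g = "\<lambda>x. indicator ?B (x - ?s n *\<^sub>R v) * ?q w n x"
      have "?J w v n = (\<integral>x. ?g x \<partial>distr lborel borel ((+) (?s n *\<^sub>R v)))"
        by (simp only: lborel_distr_plus)
      also have "\<dots> = (\<integral>x. ?g (?s n *\<^sub>R v + x) \<partial>lborel)"
        by (rule integral_distr) measurable
      finally show "(\<integral>x. indicator ?B x * ?q w n (x + ?s n *\<^sub>R v) \<partial>lborel) = ?J w v n" by (simp add: add_ac)
      have "integrable (distr lborel borel ((+) (?s n *\<^sub>R v))) ?g"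
        unfolding lborel_distr_plus by (rule int')
      then have "integrable lborel (\<lambda>x. ?g (?s n *\<^sub>R v + x))"
        by (subst (asm) integrable_distr_eq) auto
      then show "integrable lborel (\<lambda>x. indicator ?B x * ?q w n (x + ?s n *\<^sub>R v))" by (simp add: add_ac)
    qed
    have "?J (v + w) 0 n = ?J v 0 n + ?J w v n" for n
    proof -
      have "?q (v + w) n x = ?q v n x + ?q w n (x + ?s n *\<^sub>R v)" for x
        by (simp add: add_divide_distrib[symmetric] scaleR_add_right add_ac diff_divide_distrib[symmetric] algebra_simps)
      then have "?J (v + w) 0 n = (\<integral>x. indicator ?B x * ?q v n x + indicator ?B x * ?q w n (x + ?s n *\<^sub>R v) \<partial>lborel)"
        by (simp add: distrib_left del: of_nat_Suc)
      also have "\<dots> = (\<integral>x. indicator ?B x * ?q v n x \<partial>lborel) + (\<integral>x. indicator ?B x * ?q w n (x + ?s n *\<^sub>R v) \<partial>lborel)"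
        using int'[of n 0 v] sh(2)[of n] by (intro Bochner_Integration.integral_add) auto
      finally show ?thesis unfolding sh(1) by simp
    qed
    then have "?J (v + w) 0 \<longlonglongrightarrow> (\<integral>x. indicator ?B x * dir_deriv f v x \<partial>lborel) + (\<integral>x. indicator ?B x * dir_deriv f w x \<partial>lborel)"
      using tendsto_add[OF lim[of 0 v] lim[of v w]] by presburger
    with lim[of 0 "v + w"] have "(\<integral>x. indicator ?B x * dir_deriv f (v + w) x \<partial>lborel) =
      (\<integral>x. indicator ?B x * dir_deriv f v x \<partial>lborel) + (\<integral>x. indicator ?B x * dir_deriv f w x \<partial>lborel)"
      by (rule LIMSEQ_unique)
    then show "(\<integral>x. indicator ?B x * (dir_deriv f (v + w) x - (dir_deriv f v x + dir_deriv f w x)) \<partial>lborel) = 0"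
      using int by (simp add: distrib_left right_diff_distrib Bochner_Integration.integral_add Bochner_Integration.integral_diff)
  qed measurable
  then show ?thesis by eventually_elim simp
qed

text \<open>A positive factor is a reparametrisation of the increment. A negative one cannot be,
  since the limits are one-sided; there additivity is applied to two opposite vectors, whose sum has
  derivative zero.\<close>

lemma AE_dir_deriv_scale: "AE x in lborel. dir_deriv f (c *\<^sub>R v) x = c * dir_deriv f v x"
proof -
  have pos: "AE x in lborel. dir_deriv f (c *\<^sub>R v) x = c * dir_deriv f v x" if c: "c > 0" for c v
    using AE_dir_deriv[of v]
  proof eventually_elim
    case (elim x)
    have lim: "filterlim (\<lambda>t. c * t) (at_right 0) (at_right (0::real))"
      unfolding filterlim_at
    proof
      show "\<forall>\<^sub>F t in at_right 0. c * t \<in> {0<..} \<and> c * t \<noteq> 0"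
        using eventually_at_right_less[of "0::real"] by eventually_elim (use c in auto)
      show "((*) c \<longlongrightarrow> 0) (at_right 0)"
        by (auto intro!: tendsto_eq_intros)
    qed
    have "((\<lambda>t. c * ((f (x + (c * t) *\<^sub>R v) - f x) / (c * t))) \<longlongrightarrow> c * dir_deriv f v x) (at_right 0)"
      by (intro tendsto_mult_left filterlim_compose[OF elim lim])
    then have "((\<lambda>t. (f (x + t *\<^sub>R (c *\<^sub>R v)) - f x) / t) \<longlongrightarrow> c * dir_deriv f v x) (at_right 0)"
      using c by (simp add: mult.commute)
    then show ?case by (rule dir_deriv_eq)
  qed
  have zero: "dir_deriv f 0 x = 0" for x by (rule dir_deriv_eq) simp
  consider "c > 0" | "c = 0" | "- c > 0" by linarith
  then show ?thesis
  proof cases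
    case 3
    show ?thesis
      using pos[OF 3, of v] AE_dir_deriv_add[of "c *\<^sub>R v" "(- c) *\<^sub>R v"]
      by eventually_elim (simp add: zero)
  qed (use pos zero in auto)
qed

lemma AE_dir_deriv_linear: "AE x in lborel. dir_deriv f v x = v \<bullet> (\<Sum>b\<in>Basis. dir_deriv f b x *\<^sub>R b)"
proof -
  have "AE x in lborel. dir_deriv f (\<Sum>b\<in>F. (v \<bullet> b) *\<^sub>R b) x = (\<Sum>b\<in>F. (v \<bullet> b) * dir_deriv f b x)"
    if "finite F" for F
    using that
  proof induction
    case empty
    have "dir_deriv f 0 x = 0" for x by (rule dir_deriv_eq) simp
    then show ?case by simp
  next
    case (insert b F)
    show ?case
      using insert.IH AE_dir_deriv_scale[of "v \<bullet> b" b] AE_dir_deriv_add[of "(v \<bullet> b) *\<^sub>R b" "\<Sum>b\<in>F. (v \<bullet> b) *\<^sub>R b"]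
      by eventually_elim (use insert.hyps in simp)
  qed
  from this[OF finite_Basis] show ?thesis
    by eventually_elim (simp add: euclidean_representation inner_sum_right mult.commute)
qed

theorem Rademacher: "AE x in lborel. f differentiable (at x)"
proof -
  obtain V :: "'a set" where V: "countable V" "\<And>X. open X \<Longrightarrow> X \<noteq> {} \<Longrightarrow> \<exists>d\<in>V. d \<in> X"
    using countable_dense_exists by blast
  define g where "g x = (\<Sum>b\<in>Basis. dir_deriv f b x *\<^sub>R b)" for x
  have "AE x in lborel. \<forall>v\<in>V. ((\<lambda>t. (f (x + t *\<^sub>R v) - f x) / t) \<longlongrightarrow> v \<bullet> g x) (at_right 0)"
    unfolding AE_ball_countable[OF V(1)]
  proof
    fix v show "AE x in lborel. ((\<lambda>t. (f (x + t *\<^sub>R v) - f x) / t) \<longlongrightarrow> v \<bullet> g x) (at_right 0)"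
      using AE_dir_deriv[of v] AE_dir_deriv_linear[of v] unfolding g_def by eventually_elim simp
  qed
  then show ?thesis
  proof eventually_elim
    case (elim x)
    have "(f has_derivative (\<lambda>h. h \<bullet> g x)) (at x)"
      unfolding has_derivative_at_alt
    proof (intro conjI allI impI)
      show "bounded_linear (\<lambda>h. h \<bullet> g x)" by (rule bounded_linear_inner_left)
      fix e :: real assume e: "0 < e"
      \<comment> \<open>Replacing a unit direction by a net direction at distance below
        \<open>\<eta>\<close> costs \<open>L * \<eta>\<close> in the increment of \<open>f\<close>
        and \<open>norm (g x) * \<eta>\<close> in the linear part. Together these use half of
        \<open>e\<close>; the other half is for the finitely many difference quotients.\<close>
      define \<eta> where "\<eta> = e / (2 * (L + norm (g x) + 1))"
      have L0: "L \<ge> 0" by (rule lipschitz_on_nonneg[OF lip])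
      then have Lg: "0 < L + norm (g x) + 1" by (simp add: add_nonneg_pos)
      then have \<eta>: "\<eta> > 0" using e by (simp add: \<eta>_def)
      have "(L + norm (g x)) * \<eta> \<le> (L + norm (g x) + 1) * \<eta>" using \<eta> by (simp add: mult_right_mono)
      also have "\<dots> = e / 2" using Lg by (simp add: \<eta>_def field_simps)
      finally have \<eta>e: "(L + norm (g x)) * \<eta> \<le> e / 2" .
      have "sphere (0::'a) 1 \<subseteq> (\<Union>v\<in>V. ball v \<eta>)"
      proof
        fix w :: 'a
        obtain v where "v \<in> V" "v \<in> ball w \<eta>" using V(2)[of "ball w \<eta>"] \<eta> by auto
        then show "w \<in> (\<Union>v\<in>V. ball v \<eta>)" by (auto simp: dist_commute)
      qed
      then obtain F where F: "F \<subseteq> V" "finite F" "sphere 0 1 \<subseteq> (\<Union>v\<in>F. ball v \<eta>)"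
        using compactE_image[OF compact_sphere, of V "\<lambda>v. ball v \<eta>"] by (metis open_ball)
      have "\<forall>\<^sub>F t in at_right 0. \<forall>v\<in>F. dist ((f (x + t *\<^sub>R v) - f x) / t) (v \<bullet> g x) < e / 2"
      proof (rule eventually_ball_finite[OF F(2)], rule ballI)
        fix v assume "v \<in> F"
        then show "\<forall>\<^sub>F t in at_right 0. dist ((f (x + t *\<^sub>R v) - f x) / t) (v \<bullet> g x) < e / 2"
          using elim F(1) e by (intro tendstoD) auto
      qed
      then obtain d where d: "0 < d"
        "\<And>t v. 0 < t \<Longrightarrow> t < d \<Longrightarrow> v \<in> F \<Longrightarrow> \<bar>(f (x + t *\<^sub>R v) - f x) / t - v \<bullet> g x\<bar> < e / 2"
        unfolding eventually_at_right_field dist_real_def by auto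
      show "\<exists>d>0. \<forall>y. norm (y - x) < d \<longrightarrow> norm (f y - f x - (y - x) \<bullet> g x) \<le> e * norm (y - x)"
      proof (intro exI[of _ d] conjI allI impI d(1))
        fix y assume y: "norm (y - x) < d"
        show "norm (f y - f x - (y - x) \<bullet> g x) \<le> e * norm (y - x)"
        proof (cases "y = x")
          case False
          define t where "t = norm (y - x)"
          define w where "w = (1 / t) *\<^sub>R (y - x)"
          have t: "0 < t" "t < d" using False y by (auto simp: t_def)
          have w: "norm w = 1" "y = x + t *\<^sub>R w" using t by (auto simp: w_def t_def)
          obtain v where v: "v \<in> F" "norm (v - w) < \<eta>" using F(3) w(1) by (force simp: dist_norm)
          have 1: "\<bar>f y - f (x + t *\<^sub>R v)\<bar> \<le> L * (t * norm (v - w))"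
            using lipschitz_real_bound[OF lip, of y "x + t *\<^sub>R v"] t
            by (simp add: w(2) scaleR_diff_right[symmetric] norm_minus_commute)
          have "\<bar>f (x + t *\<^sub>R v) - f x - t * (v \<bullet> g x)\<bar> = t * \<bar>(f (x + t *\<^sub>R v) - f x) / t - v \<bullet> g x\<bar>"
            using t by (simp add: field_simps abs_mult abs_divide)
          also have "\<dots> \<le> t * (e / 2)" using d(2)[OF t v(1)] t by (intro mult_left_mono) auto
          finally have 2: "\<bar>f (x + t *\<^sub>R v) - f x - t * (v \<bullet> g x)\<bar> \<le> t * (e / 2)" .
          have 3: "\<bar>t * (v \<bullet> g x) - (y - x) \<bullet> g x\<bar> \<le> t * (norm (v - w) * norm (g x))"
          proof -
            have "t * (v \<bullet> g x) - (y - x) \<bullet> g x = t * ((v - w) \<bullet> g x)"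
              by (simp add: w(2) inner_diff_left algebra_simps)
            then show ?thesis using t Cauchy_Schwarz_ineq2[of "v - w" "g x"] by (simp add: abs_mult)
          qed
          have "t * (L * norm (v - w) + norm (v - w) * norm (g x)) = t * ((L + norm (g x)) * norm (v - w))"
            by (simp add: algebra_simps)
          also have "\<dots> \<le> t * (e / 2)"
            using t L0 v(2) by (intro mult_left_mono order_trans[OF _ \<eta>e]) auto
          finally have "\<bar>f y - f x - (y - x) \<bullet> g x\<bar> \<le> t * (e / 2) + t * (e / 2)"
            using 1 2 3 unfolding distrib_left mult.left_commute[of t L] by linarith
          then show ?thesis by (simp add: t_def mult.commute)
        qed simp
      qed
    qed
    then show ?case by (rule differentiableI)
  qed
qed

end

section \<open>Gaussian smoothing\<close>

lemma sets_std_gaussian [simp, measurable_cong]: "sets std_gaussian = sets borel"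
  and space_std_gaussian [simp]: "space std_gaussian = UNIV"
  by (simp_all add: std_gaussian_def)

lemma norm_power2_Basis: "(norm (u::'a::euclidean_space))\<^sup>2 = (\<Sum>b\<in>Basis. (u \<bullet> b)\<^sup>2)"
  unfolding power2_norm_eq_inner by (subst euclidean_inner) (simp add: power2_eq_square)

text \<open>The exponent 1/4 is half of the 1/2 in the Gaussian density. In each coordinate the
  product is then \<open>sqrt 2\<close> times the density of a normal variable of variance 2, which
  gives one factor \<open>sqrt 2\<close> per dimension.\<close>

lemma nn_integral_std_gaussian_exp:
  "(\<integral>\<^sup>+u. ennreal (exp ((norm (u::'a::euclidean_space))\<^sup>2 / 4)) \<partial>std_gaussian) = ennreal (sqrt 2 ^ DIM('a))"
proof -
  have one: "(\<integral>\<^sup>+x. ennreal (std_normal_density x * exp (x\<^sup>2 / 4)) \<partial>lborel) = ennreal (sqrt 2)"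
  proof -
    have eq: "std_normal_density x * exp (x\<^sup>2 / 4) = sqrt 2 * normal_density 0 (sqrt 2) x" for x
    proof -
      have "- x\<^sup>2 / 2 + x\<^sup>2 / 4 = - x\<^sup>2 / 4" by simp
      then have "exp (- x\<^sup>2 / 2) * exp (x\<^sup>2 / 4) = exp (- x\<^sup>2 / 4)" by (simp only: exp_add[symmetric])
      then show ?thesis
        by (simp add: std_normal_density_def normal_density_def real_sqrt_mult field_simps)
    qed
    have "(\<integral>\<^sup>+x. ennreal (std_normal_density x * exp (x\<^sup>2 / 4)) \<partial>lborel)
        = ennreal (sqrt 2) * (\<integral>\<^sup>+x. ennreal (normal_density 0 (sqrt 2) x) \<partial>lborel)"
      unfolding eq by (simp add: ennreal_mult nn_integral_cmult)
    also have "(\<integral>\<^sup>+x. ennreal (normal_density 0 (sqrt 2) x) \<partial>lborel) = 1"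
      by (subst nn_integral_eq_integral) (simp_all add: integrable_normal_density integral_normal_density)
    finally show ?thesis by simp
  qed
  have eq: "ennreal (\<Prod>b\<in>Basis. std_normal_density (u \<bullet> b)) * ennreal (exp ((norm u)\<^sup>2 / 4))
      = (\<Prod>b\<in>Basis. ennreal (std_normal_density (u \<bullet> b) * exp ((u \<bullet> b)\<^sup>2 / 4)))" for u :: 'a
  proof -
    have "(norm u)\<^sup>2 / 4 = (\<Sum>b\<in>Basis. (u \<bullet> b)\<^sup>2 / 4)"
      by (simp only: norm_power2_Basis sum_divide_distrib)
    then have "exp ((norm u)\<^sup>2 / 4) = (\<Prod>b\<in>Basis. exp ((u \<bullet> b)\<^sup>2 / 4))"
      by (simp add: exp_sum)
    then show ?thesis
      by (simp add: ennreal_mult[symmetric] prod_ennreal prod.distrib prod_nonneg)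
  qed
  have "(\<integral>\<^sup>+u. ennreal (exp ((norm (u::'a))\<^sup>2 / 4)) \<partial>std_gaussian)
      = (\<integral>\<^sup>+u. (\<Prod>b\<in>Basis. ennreal (std_normal_density ((u::'a) \<bullet> b) * exp ((u \<bullet> b)\<^sup>2 / 4))) \<partial>lborel)"
    unfolding std_gaussian_def by (subst nn_integral_density) (simp_all add: eq)
  also have "\<dots> = (\<Prod>b\<in>(Basis::'a set). (\<integral>\<^sup>+x. ennreal (std_normal_density x * exp (x\<^sup>2 / 4)) \<partial>lborel))"
    by (rule nn_integral_lborel_prod[where f = "\<lambda>_ x. ennreal (std_normal_density x * exp (x\<^sup>2 / 4))"]) auto
  finally show ?thesis by (simp add: one ennreal_power)
qed

lemma prob_space_std_gaussian: "prob_space (std_gaussian :: 'a::euclidean_space measure)"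
proof
  have "(\<integral>\<^sup>+x. ennreal (std_normal_density x) \<partial>lborel) = 1"
    by (subst nn_integral_eq_integral) (simp_all add: integrable_normal_density integral_normal_density)
  then have "emeasure std_gaussian (UNIV :: 'a set) = 1"
    unfolding std_gaussian_def
    by (simp add: emeasure_density prod_ennreal[symmetric]) (subst nn_integral_lborel_prod[where f = "\<lambda>_ x. ennreal (std_normal_density x)"], auto)
  then show "emeasure std_gaussian (space std_gaussian :: 'a set) = 1" by simp
qed

interpretation gauss: prob_space "std_gaussian :: 'a::euclidean_space measure"
  by (rule prob_space_std_gaussian)

lemma integrable_std_gaussian_exp_sq:
  "integrable std_gaussian (\<lambda>u::'a::euclidean_space. exp ((norm u)\<^sup>2 / 4))"
  by (rule integrableI_nonneg) (simp_all add: nn_integral_std_gaussian_exp)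

text \<open>A common integrability test for everything below: oracles, their squares and the weights
  from shifting the Gaussian grow at most exponentially in \<open>norm u\<close>. Expanding
  \<open>(c - norm u / 2)\<^sup>2 \<ge> 0\<close> dominates such growth by
  \<open>exp ((norm u)\<^sup>2 / 4)\<close>.\<close>

lemma integrable_std_gaussian_exp_bound:
  fixes g :: "'a::euclidean_space \<Rightarrow> 'b::{banach, second_countable_topology}"
  assumes g: "g \<in> borel_measurable borel" and bd: "\<And>u. norm (g u) \<le> C * exp (c * norm u)"
  shows "integrable std_gaussian g"
proof (rule Bochner_Integration.integrable_bound)
  show "integrable std_gaussian (\<lambda>u::'a. \<bar>C\<bar> * exp (c\<^sup>2) * exp ((norm u)\<^sup>2 / 4))"
    by (intro integrable_mult_right integrable_std_gaussian_exp_sq)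
  show "AE u in std_gaussian. norm (g u) \<le> norm (\<bar>C\<bar> * exp (c\<^sup>2) * exp ((norm u)\<^sup>2 / 4))"
  proof (rule AE_I2)
    fix u :: 'a
    have "0 \<le> (c - norm u / 2)\<^sup>2" by simp
    then have "c * norm u \<le> c\<^sup>2 + (norm u)\<^sup>2 / 4" by (simp add: power2_eq_square algebra_simps)
    then have "exp (c * norm u) \<le> exp (c\<^sup>2) * exp ((norm u)\<^sup>2 / 4)" by (simp add: exp_add[symmetric])
    then have "\<bar>C\<bar> * exp (c * norm u) \<le> \<bar>C\<bar> * (exp (c\<^sup>2) * exp ((norm u)\<^sup>2 / 4))"
      by (intro mult_left_mono) auto
    moreover have "norm (g u) \<le> \<bar>C\<bar> * exp (c * norm u)"
      using bd[of u] by (rule order_trans) (simp add: mult_right_mono)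
    ultimately show "norm (g u) \<le> norm (\<bar>C\<bar> * exp (c\<^sup>2) * exp ((norm u)\<^sup>2 / 4))" by (simp add: abs_mult mult.assoc)
  qed
qed (use g in simp)

lemma std_gaussian_tail:
  assumes "0 \<le> R"
  shows "measure std_gaussian {u::'a::euclidean_space. R \<le> norm u} \<le> sqrt 2 ^ DIM('a) * exp (- R\<^sup>2 / 4)"
proof -
  have "measure std_gaussian {u::'a. R \<le> norm u} = (\<integral>u. indicator {u::'a. R \<le> norm u} u \<partial>std_gaussian)"
    by simp
  also have "\<dots> \<le> (\<integral>u. exp (- R\<^sup>2 / 4) * exp ((norm (u::'a))\<^sup>2 / 4) \<partial>std_gaussian)"
  proof (rule integral_mono)
    show "integrable std_gaussian (indicat_real {u::'a. R \<le> norm u})"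
      by (intro integrable_real_indicator) (auto simp: less_top[symmetric])
    show "integrable std_gaussian (\<lambda>u::'a. exp (- R\<^sup>2 / 4) * exp ((norm u)\<^sup>2 / 4))"
      by (intro integrable_mult_right integrable_std_gaussian_exp_sq)
    fix u :: 'a
    have "1 \<le> exp (- R\<^sup>2 / 4) * exp ((norm u)\<^sup>2 / 4)" if "R \<le> norm u"
      unfolding exp_add[symmetric] one_le_exp_iff using power_mono[OF that assms, of 2] by simp
    then show "indicat_real {u. R \<le> norm u} u \<le> exp (- R\<^sup>2 / 4) * exp ((norm u)\<^sup>2 / 4)"
      by (simp add: indicator_def)
  qed
  also have "\<dots> = exp (- R\<^sup>2 / 4) * (\<integral>u. exp ((norm (u::'a))\<^sup>2 / 4) \<partial>std_gaussian)" by simp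
  also have "(\<integral>u. exp ((norm (u::'a))\<^sup>2 / 4) \<partial>std_gaussian) = sqrt 2 ^ DIM('a)"
    by (simp add: integral_eq_nn_integral nn_integral_std_gaussian_exp)
  finally show ?thesis by (simp add: mult.commute)
qed

text \<open>The finite-dimensional Cameron-Martin formula. It moves a displacement from the merely
  Lipschitz \<open>f\<close> onto an exponential weight that can be expanded to second
  order.\<close>

lemma integral_std_gaussian_shift:
  fixes g :: "'a::euclidean_space \<Rightarrow> real"
  assumes [measurable]: "g \<in> borel_measurable borel"
  shows "(\<integral>u. g (u + p) \<partial>std_gaussian) = (\<integral>u. g u * exp (u \<bullet> p - (norm p)\<^sup>2 / 2) \<partial>std_gaussian)"
proof -
  let ?\<gamma> = "\<lambda>u::'a. \<Prod>b\<in>Basis. std_normal_density (u \<bullet> b)"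
  have shift: "?\<gamma> (u - p) = ?\<gamma> u * exp (u \<bullet> p - (norm p)\<^sup>2 / 2)" for u
  proof -
    have "u \<bullet> p - (norm p)\<^sup>2 / 2 = (\<Sum>b\<in>Basis. (u \<bullet> b) * (p \<bullet> b) - (p \<bullet> b)\<^sup>2 / 2)"
      by (simp only: norm_power2_Basis euclidean_inner[of u p] sum_divide_distrib sum_subtractf)
    then have "exp (u \<bullet> p - (norm p)\<^sup>2 / 2) = (\<Prod>b\<in>Basis. exp ((u \<bullet> b) * (p \<bullet> b) - (p \<bullet> b)\<^sup>2 / 2))"
      by (simp add: exp_sum)
    moreover have "std_normal_density ((u - p) \<bullet> b) = std_normal_density (u \<bullet> b) * exp ((u \<bullet> b) * (p \<bullet> b) - (p \<bullet> b)\<^sup>2 / 2)" for b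
    proof -
      have "- ((u - p) \<bullet> b)\<^sup>2 / 2 = - (u \<bullet> b)\<^sup>2 / 2 + ((u \<bullet> b) * (p \<bullet> b) - (p \<bullet> b)\<^sup>2 / 2)"
        by (simp add: power2_eq_square inner_diff_left field_simps)
      then show ?thesis unfolding std_normal_density_def by (simp only: exp_add mult.assoc)
    qed
    ultimately show ?thesis by (simp add: prod.distrib)
  qed
  have "(\<integral>u. g (u + p) \<partial>std_gaussian) = (\<integral>u. ?\<gamma> u * g (u + p) \<partial>lborel)"
    unfolding std_gaussian_def by (subst integral_density) (auto intro!: prod_nonneg)
  also have "\<dots> = (\<integral>u. ?\<gamma> (p + u - p) * g (p + u) \<partial>lborel)"
    by (simp add: add.commute)
  also have "\<dots> = (\<integral>u. ?\<gamma> (u - p) * g u \<partial>distr lborel borel ((+) p))"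
    by (subst integral_distr) auto
  also have "\<dots> = (\<integral>u. ?\<gamma> u * (g u * exp (u \<bullet> p - (norm p)\<^sup>2 / 2)) \<partial>lborel)"
    unfolding lborel_distr_plus shift by (simp add: mult_ac)
  also have "\<dots> = (\<integral>u. g u * exp (u \<bullet> p - (norm p)\<^sup>2 / 2) \<partial>std_gaussian)"
    unfolding std_gaussian_def by (subst integral_density) (auto intro!: prod_nonneg)
  finally show ?thesis .
qed

section \<open>Differentiating the smoothing\<close>

lemma GDERIV_unique: "GDERIV f x :> a \<Longrightarrow> GDERIV f x :> b \<Longrightarrow> a = b"
  unfolding gderiv_def by (drule (1) has_derivative_unique) (metis inner_eq_zero_iff inner_diff_right right_minus_eq)

lemma grad_eq: "GDERIV f x :> g \<Longrightarrow> grad f x = g"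
  unfolding grad_def by (auto intro: GDERIV_unique)

text \<open>The shape is made for \<open>r = norm u\<close> and \<open>p\<close> the size of a
  displacement: quadratic in \<open>p\<close>, as differentiability requires, and exponential in
  \<open>r\<close>, hence Gaussian integrable. In \<open>exp (3 * r)\<close> one factor comes from
  the Taylor remainder and two from bounding \<open>(r + 1)\<^sup>2\<close> by
  \<open>(exp r)\<^sup>2\<close>.\<close>

lemma exp_second_order_bound:
  fixes s p r :: real
  assumes p: "0 \<le> p" "p \<le> 1" and r: "0 \<le> r" and s: "\<bar>s\<bar> \<le> r * p"
  shows "\<bar>exp (s - p\<^sup>2 / 2) - 1 - s\<bar> \<le> p\<^sup>2 * exp 1 * exp (3 * r)"
proof -
  define y where "y = s - p\<^sup>2 / 2"
  have "p\<^sup>2 \<le> p" using p by (simp add: power2_eq_square mult_left_le_one_le)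
  then have y: "\<bar>y\<bar> \<le> p * (r + 1)" using s zero_le_power2[of p] unfolding y_def distrib_left mult.commute[of r p] by linarith
  then have y1: "\<bar>y\<bar> \<le> r + 1" using p r by (meson add_nonneg_nonneg mult_left_le_one_le order_trans zero_le_one)
  obtain t where t: "\<bar>t\<bar> \<le> \<bar>y\<bar>" "exp y = (\<Sum>m<2. y ^ m / fact m) + exp t / fact 2 * y ^ 2"
    using Maclaurin_exp_le[of y 2] by auto
  have e: "exp y - 1 - y = exp t / 2 * y\<^sup>2" using t(2) by (simp add: numeral_2_eq_2)
  have "exp t \<le> exp (r + 1)" using t y1 by simp
  moreover have "y\<^sup>2 \<le> (p * (r + 1))\<^sup>2" using y p r by (simp add: abs_le_square_iff[symmetric] abs_mult)
  ultimately have "exp t * y\<^sup>2 \<le> exp (r + 1) * (p * (r + 1))\<^sup>2" by (intro mult_mono) auto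
  also have "\<dots> = p\<^sup>2 * (exp (r + 1) * (r + 1)\<^sup>2)" by (simp add: power_mult_distrib)
  also have "\<dots> \<le> p\<^sup>2 * (exp (r + 1) * (exp r)\<^sup>2)"
    using r exp_ge_add_one_self[of r] by (intro mult_left_mono power_mono) (auto simp: add.commute)
  also have "exp (r + 1) * (exp r)\<^sup>2 = exp 1 * exp (3 * r)"
    by (simp add: power2_eq_square exp_add[symmetric])
  finally have 1: "exp t * y\<^sup>2 \<le> p\<^sup>2 * (exp 1 * exp (3 * r))" .
  have "1 * 1 \<le> exp 1 * exp (3 * r)" using r by (intro mult_mono) auto
  then have 2: "p\<^sup>2 * 1 \<le> p\<^sup>2 * (exp 1 * exp (3 * r))" by (intro mult_left_mono) auto
  have "exp (s - p\<^sup>2 / 2) - 1 - s = exp t * y\<^sup>2 / 2 - p\<^sup>2 / 2" using e by (simp add: y_def)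
  moreover have "0 \<le> exp t * y\<^sup>2" "0 \<le> p\<^sup>2" by simp_all
  ultimately show ?thesis using 1 2 unfolding mult.assoc by linarith
qed

lemma real_le_exp: "(x::real) \<le> exp x"
  using exp_ge_add_one_self[of x] by linarith

context
  fixes f :: "'a::euclidean_space \<Rightarrow> real" and L \<mu> :: real
  assumes lip: "L-lipschitz_on UNIV f" and \<mu>: "\<mu> > 0"
begin

lemmas [measurable] = lipschitz_measurable[OF lip]

lemma lipschitz_exp_growth: "\<bar>f (z + \<mu> *\<^sub>R u)\<bar> \<le> (\<bar>f z\<bar> + L * \<mu>) * exp (norm u)"
proof -
  have "\<bar>f (z + \<mu> *\<^sub>R u)\<bar> \<le> \<bar>f z\<bar> * 1 + L * \<mu> * norm u"
    using lipschitz_real_bound[OF lip, of "z + \<mu> *\<^sub>R u" z] \<mu> by (simp add: mult.assoc)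
  also have "\<dots> \<le> \<bar>f z\<bar> * exp (norm u) + L * \<mu> * exp (norm u)"
    using lipschitz_on_nonneg[OF lip] \<mu> real_le_exp by (intro add_mono mult_left_mono) auto
  finally show ?thesis by (simp add: distrib_right)
qed

text \<open>After the shift, the increment of the smoothing minus its linear part is the integral of
  \<open>f\<close> against the second-order remainder of the exponential weight. Growth
  \<open>exp (norm u)\<close> of \<open>f\<close> and \<open>exp (3 * norm u)\<close> of the
  remainder combine to the moment \<open>I\<close>. This gives an error quadratic in the
  displacement, as long as the latter is at most \<open>\<mu>\<close>.\<close>

lemma gaussian_smoothing_GDERIV:
  "GDERIV (gaussian_smoothing f \<mu>) z :> (\<integral>u. (f (z + \<mu> *\<^sub>R u) / \<mu>) *\<^sub>R u \<partial>std_gaussian)" (is "GDERIV _ _ :> ?g")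
proof -
  define A where "A = \<bar>f z\<bar> + L * \<mu>"
  have A: "A \<ge> 0" using lipschitz_on_nonneg[OF lip] \<mu> by (simp add: A_def)
  have fA: "\<bar>f (z + \<mu> *\<^sub>R u)\<bar> \<le> A * exp (norm u)" for u
    unfolding A_def by (rule lipschitz_exp_growth)
  have int0: "integrable std_gaussian (\<lambda>u. f (z + \<mu> *\<^sub>R u))"
    by (rule integrable_std_gaussian_exp_bound[where C = A and c = 1]) (use fA in auto)
  have int1: "integrable std_gaussian (\<lambda>u. (f (z + \<mu> *\<^sub>R u) / \<mu>) *\<^sub>R u)"
  proof (rule integrable_std_gaussian_exp_bound[where C = "A / \<mu>" and c = 2])
    fix u :: 'a
    have "\<bar>f (z + \<mu> *\<^sub>R u)\<bar> * norm u \<le> A * exp (norm u) * exp (norm u)"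
      using A by (intro mult_mono fA real_le_exp) auto
    then show "norm ((f (z + \<mu> *\<^sub>R u) / \<mu>) *\<^sub>R u) \<le> A / \<mu> * exp (2 * norm u)"
      using \<mu> unfolding mult_2 exp_add by (simp add: field_simps)
  qed measurable
  define I where "I = (\<integral>u. exp (4 * norm (u::'a)) \<partial>std_gaussian)"
  have intI: "integrable std_gaussian (\<lambda>u::'a. exp (4 * norm u))"
    by (rule integrable_std_gaussian_exp_bound[where C = 1 and c = 4]) auto
  define K where "K = A * exp 1 * I / \<mu>\<^sup>2"
  have "I \<ge> 0" unfolding I_def by simp
  then have K: "K \<ge> 0" using A by (simp add: K_def)
  have bound: "\<bar>gaussian_smoothing f \<mu> (z + w) - gaussian_smoothing f \<mu> z - w \<bullet> ?g\<bar> \<le> K * (norm w)\<^sup>2"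
    if w: "norm w \<le> \<mu>" for w
  proof -
    define p where "p = (1 / \<mu>) *\<^sub>R w"
    have p: "w = \<mu> *\<^sub>R p" "norm p \<le> 1" "norm p = norm w / \<mu>" using w \<mu> by (auto simp: p_def)
    have e1: "gaussian_smoothing f \<mu> (z + w) = (\<integral>u. f (z + \<mu> *\<^sub>R u) * exp (u \<bullet> p - (norm p)\<^sup>2 / 2) \<partial>std_gaussian)"
      unfolding gaussian_smoothing_def
      by (subst integral_std_gaussian_shift[symmetric]) (simp_all add: p(1) scaleR_add_right add_ac)
    have int2: "integrable std_gaussian (\<lambda>u. f (z + \<mu> *\<^sub>R u) * exp (u \<bullet> p - (norm p)\<^sup>2 / 2))"
    proof (rule integrable_std_gaussian_exp_bound[where C = A and c = 2])
      fix u :: 'a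
      have "u \<bullet> p - (norm p)\<^sup>2 / 2 \<le> u \<bullet> p" by simp
      also have "\<dots> \<le> norm u * norm p" by (rule norm_cauchy_schwarz)
      also have "\<dots> \<le> norm u" using p(2) by (simp add: mult_left_le)
      finally have "\<bar>f (z + \<mu> *\<^sub>R u)\<bar> * exp (u \<bullet> p - (norm p)\<^sup>2 / 2) \<le> A * exp (norm u) * exp (norm u)"
        using A by (intro mult_mono fA) auto
      then show "norm (f (z + \<mu> *\<^sub>R u) * exp (u \<bullet> p - (norm p)\<^sup>2 / 2)) \<le> A * exp (2 * norm u)"
        unfolding mult_2 exp_add by (simp add: abs_mult mult.assoc)
    qed measurable
    have e2: "w \<bullet> ?g = (\<integral>u. f (z + \<mu> *\<^sub>R u) * (u \<bullet> p) \<partial>std_gaussian)"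
    proof -
      have "w \<bullet> ?g = (\<integral>u. w \<bullet> ((f (z + \<mu> *\<^sub>R u) / \<mu>) *\<^sub>R u) \<partial>std_gaussian)"
        by (rule integral_inner_right[symmetric, OF int1])
      also have "\<dots> = (\<integral>u. f (z + \<mu> *\<^sub>R u) * (u \<bullet> p) \<partial>std_gaussian)"
        using \<mu> by (intro Bochner_Integration.integral_cong) (auto simp: p(1) inner_commute)
      finally show ?thesis .
    qed
    have int3: "integrable std_gaussian (\<lambda>u. f (z + \<mu> *\<^sub>R u) * (u \<bullet> p))"
    proof -
      have "integrable std_gaussian (\<lambda>u. w \<bullet> ((f (z + \<mu> *\<^sub>R u) / \<mu>) *\<^sub>R u))"
        by (rule integrable_inner_right[OF int1])
      then show ?thesis using \<mu> by (simp add: p(1) inner_commute)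
    qed
    let ?h = "\<lambda>u. f (z + \<mu> *\<^sub>R u) * (exp (u \<bullet> p - (norm p)\<^sup>2 / 2) - 1 - u \<bullet> p)"
    have "gaussian_smoothing f \<mu> (z + w) - gaussian_smoothing f \<mu> z - w \<bullet> ?g = (\<integral>u. ?h u \<partial>std_gaussian)"
      unfolding e1 e2 unfolding gaussian_smoothing_def using int0 int2 int3 by (simp add: right_diff_distrib)
    also have "\<bar>\<dots>\<bar> \<le> (\<integral>u. \<bar>?h u\<bar> \<partial>std_gaussian)"
      by (rule integral_abs_bound)
    also have "\<dots> \<le> (\<integral>u. A * (norm p)\<^sup>2 * exp 1 * exp (4 * norm (u::'a)) \<partial>std_gaussian)"
    proof (rule integral_mono)
      show "integrable std_gaussian (\<lambda>u. \<bar>?h u\<bar>)"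
        using int0 int2 int3 by (intro integrable_abs) (simp add: right_diff_distrib)
      show "integrable std_gaussian (\<lambda>u::'a. A * (norm p)\<^sup>2 * exp 1 * exp (4 * norm u))"
        by (intro integrable_mult_right intI)
      fix u :: 'a
      have "\<bar>?h u\<bar> \<le> (A * exp (norm u)) * ((norm p)\<^sup>2 * exp 1 * exp (3 * norm u))"
        unfolding abs_mult using p(2) A Cauchy_Schwarz_ineq2[of u p]
        by (intro mult_mono fA exp_second_order_bound) auto
      also have "\<dots> = A * (norm p)\<^sup>2 * exp 1 * exp (norm u + 3 * norm u)" by (simp only: exp_add mult_ac)
      finally show "\<bar>?h u\<bar> \<le> A * (norm p)\<^sup>2 * exp 1 * exp (4 * norm u)" by simp
    qed
    also have "\<dots> = K * (norm w)\<^sup>2" by (simp add: I_def[symmetric] K_def p(3) power_divide)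
    finally show ?thesis .
  qed
  show ?thesis
    unfolding gderiv_def has_derivative_at_alt
  proof (intro conjI allI impI)
    show "bounded_linear (\<lambda>h. h \<bullet> ?g)" by (rule bounded_linear_inner_left)
    fix e :: real assume e: "0 < e"
    show "\<exists>d>0. \<forall>y. norm (y - z) < d \<longrightarrow>
      norm (gaussian_smoothing f \<mu> y - gaussian_smoothing f \<mu> z - (y - z) \<bullet> ?g) \<le> e * norm (y - z)"
    proof (intro exI[of _ "min \<mu> (e / (K + 1))"] conjI allI impI)
      show "0 < min \<mu> (e / (K + 1))" using e \<mu> K by simp
      fix y assume y: "norm (y - z) < min \<mu> (e / (K + 1))"
      then have "norm (y - z) < e / (K + 1)" by simp
      then have "norm (y - z) * (K + 1) < e" using K by (subst (asm) pos_less_divide_eq) auto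
      moreover have "norm (y - z) * K \<le> norm (y - z) * (K + 1)" by (intro mult_left_mono) auto
      ultimately have "K * norm (y - z) \<le> e" unfolding mult.commute[of _ "norm (y - z)"] by linarith
      then have "K * norm (y - z) * norm (y - z) \<le> e * norm (y - z)"
        by (intro mult_right_mono) auto
      then have "K * (norm (y - z))\<^sup>2 \<le> e * norm (y - z)"
        by (simp add: power2_eq_square mult.assoc)
      with bound[of "y - z"] y
      show "norm (gaussian_smoothing f \<mu> y - gaussian_smoothing f \<mu> z - (y - z) \<bullet> ?g) \<le> e * norm (y - z)"
        by simp
    qed
  qed
qed

end

section \<open>The Goldstein subdifferential\<close>

lemma differentiable_imp_GDERIV:
  fixes f :: "'a::euclidean_space \<Rightarrow> real"
  assumes "f differentiable (at x)"
  shows "GDERIV f x :> grad f x"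
proof -
  obtain f' where f': "(f has_derivative f') (at x)" using assms by (auto simp: differentiable_def)
  then have lin: "linear f'" by (rule has_derivative_linear)
  have "f' = (\<lambda>h. h \<bullet> (\<Sum>b\<in>Basis. f' b *\<^sub>R b))"
  proof
    fix h :: 'a
    have "f' h = f' (\<Sum>b\<in>Basis. (h \<bullet> b) *\<^sub>R b)" by (simp add: euclidean_representation)
    also have "\<dots> = (\<Sum>b\<in>Basis. (h \<bullet> b) * f' b)"
      using lin by (simp add: linear_sum linear_scale)
    finally show "f' h = h \<bullet> (\<Sum>b\<in>Basis. f' b *\<^sub>R b)" by (simp add: inner_sum_right mult.commute)
  qed
  with f' have "GDERIV f x :> (\<Sum>b\<in>Basis. f' b *\<^sub>R b)" by (simp add: gderiv_def)
  then show ?thesis by (metis grad_eq)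
qed

lemma GDERIV_directional:
  assumes "GDERIV f x :> g"
  shows "((\<lambda>t. (f (x + t *\<^sub>R v) - f x) / t) \<longlongrightarrow> v \<bullet> g) (at_right 0)"
proof -
  have "((\<lambda>t. f (x + t *\<^sub>R v)) has_derivative (\<lambda>t. (t *\<^sub>R v) \<bullet> g)) (at (0::real))"
  proof (rule has_derivative_compose[of "\<lambda>t. x + t *\<^sub>R v", where s = UNIV])
    show "((\<lambda>t. x + t *\<^sub>R v) has_derivative (\<lambda>t. t *\<^sub>R v)) (at 0)"
      by (auto intro!: derivative_eq_intros)
    show "(f has_derivative (\<lambda>h. h \<bullet> g)) (at (x + 0 *\<^sub>R v))"
      using assms by (simp add: gderiv_def)
  qed
  then have "((\<lambda>t. f (x + t *\<^sub>R v)) has_field_derivative (v \<bullet> g)) (at 0)"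
    by (simp add: has_field_derivative_def mult_commute_abs)
  then have "((\<lambda>t. (f (x + t *\<^sub>R v) - f (x + 0 *\<^sub>R v)) / (t - 0)) \<longlongrightarrow> v \<bullet> g) (at 0)"
    by (simp add: has_field_derivative_iff)
  then show ?thesis by (simp add: filterlim_at_split)
qed

lemma AE_std_gaussian_affine:
  fixes z :: "'a::euclidean_space"
  assumes P: "AE x in lborel. P x" and \<mu>: "\<mu> \<noteq> 0"
  shows "AE u in std_gaussian. P (z + \<mu> *\<^sub>R u)"
proof -
  have "AE x in density (distr lborel borel (\<lambda>x. z + \<mu> *\<^sub>R x)) (\<lambda>_. ennreal (\<bar>\<mu>\<bar> ^ DIM('a))). P x"
    using P by (subst lborel_affine[OF \<mu>, of z, symmetric])
  then have "AE x in distr lborel borel (\<lambda>x. z + \<mu> *\<^sub>R x). P x"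
    using \<mu> by (subst (asm) AE_density) auto
  then have "AE u in lborel. P (z + \<mu> *\<^sub>R u)"
    by (rule AE_distrD[rotated]) simp
  then show ?thesis
    unfolding std_gaussian_def by (subst AE_density) (auto elim: eventually_mono)
qed

text \<open>Limits of gradients along sequences are encoded as points of one closed set in the
  product space, whose vertical sections generate the Clarke subdifferentials. Closedness of this
  set yields both compactness and semicontinuity.\<close>

definition gradient_graph :: "('a::euclidean_space \<Rightarrow> real) \<Rightarrow> ('a \<times> 'a) set" where
  "gradient_graph f = closure {(w, grad f w) |w. f differentiable (at w)}"

definition limiting_gradients :: "('a::euclidean_space \<Rightarrow> real) \<Rightarrow> real \<Rightarrow> 'a \<Rightarrow> 'a set" where
  "limiting_gradients f \<delta> z = {g. \<exists>x\<in>cball z \<delta>. (x, g) \<in> gradient_graph f}"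

text \<open>Collapsing the nested convex hulls leaves a single hull of a set that is a projection of
  a piece of \<open>gradient_graph f\<close>.\<close>

lemma goldstein_subdifferential_eq:
  "goldstein_subdifferential f \<delta> z = convex hull (limiting_gradients f \<delta> z)"
proof -
  define S where "S = (\<lambda>x. {g. (x, g) \<in> gradient_graph f})"
  have clarke: "clarke_subdifferential f x = convex hull (S x)" for x
  proof -
    have "(\<exists>w. w \<longlonglongrightarrow> x \<and> (\<forall>j. f differentiable (at (w j))) \<and> (\<lambda>j. grad f (w j)) \<longlonglongrightarrow> g) \<longleftrightarrow>
        (x, g) \<in> gradient_graph f" for g
    proof
      assume "\<exists>w. w \<longlonglongrightarrow> x \<and> (\<forall>j. f differentiable (at (w j))) \<and> (\<lambda>j. grad f (w j)) \<longlonglongrightarrow> g"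
      then obtain w where w: "w \<longlonglongrightarrow> x" "\<And>j. f differentiable (at (w j))" "(\<lambda>j. grad f (w j)) \<longlonglongrightarrow> g" by blast
      then have "(\<lambda>j. (w j, grad f (w j))) \<longlonglongrightarrow> (x, g)" by (intro tendsto_Pair)
      with w(2) show "(x, g) \<in> gradient_graph f"
        unfolding gradient_graph_def closure_sequential by (intro exI[of _ "\<lambda>j. (w j, grad f (w j))"]) auto
    next
      assume "(x, g) \<in> gradient_graph f"
      then obtain p where p: "\<And>j. p j \<in> {(w, grad f w) |w. f differentiable (at w)}" "p \<longlonglongrightarrow> (x, g)"
        unfolding gradient_graph_def closure_sequential by blast
      have pf: "snd (p j) = grad f (fst (p j))" "f differentiable (at (fst (p j)))" for j
        using p(1)[of j] by auto
      show "\<exists>w. w \<longlonglongrightarrow> x \<and> (\<forall>j. f differentiable (at (w j))) \<and> (\<lambda>j. grad f (w j)) \<longlonglongrightarrow> g"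
        using tendsto_fst[OF p(2)] tendsto_snd[OF p(2)] pf by (intro exI[of _ "\<lambda>j. fst (p j)"]) auto
    qed
    then show ?thesis by (simp add: clarke_subdifferential_def S_def)
  qed
  have lim: "limiting_gradients f \<delta> z = (\<Union>x\<in>cball z \<delta>. S x)"
    by (auto simp: limiting_gradients_def S_def)
  show ?thesis
    unfolding goldstein_subdifferential_def clarke lim
  proof (rule antisym)
    show "convex hull (\<Union>x\<in>cball z \<delta>. convex hull (S x)) \<subseteq> convex hull (\<Union>x\<in>cball z \<delta>. S x)"
      by (intro hull_minimal convex_convex_hull UN_least hull_mono) auto
    show "convex hull (\<Union>x\<in>cball z \<delta>. S x) \<subseteq> convex hull (\<Union>x\<in>cball z \<delta>. convex hull (S x))"
      by (intro hull_mono UN_mono hull_subset) auto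
  qed
qed

section \<open>Attainment and measurability of the least norm, and comparison with the
  smoothing\<close>

context
  fixes f :: "'a::euclidean_space \<Rightarrow> real" and L :: real
  assumes lip: "L-lipschitz_on UNIV f"
begin

lemma norm_GDERIV_lipschitz:
  assumes "GDERIV f x :> g" shows "norm g \<le> L"
proof -
  have "g \<bullet> g \<le> L * norm g"
  proof (rule tendsto_upperbound[OF GDERIV_directional[OF assms, of g]])
    show "\<forall>\<^sub>F t in at_right 0. (f (x + t *\<^sub>R g) - f x) / t \<le> L * norm g"
      by (intro always_eventually allI order_trans[OF abs_ge_self lipschitz_quotient_bound[OF lip]])
  qed simp
  then show ?thesis
    using lipschitz_on_nonneg[OF lip] by (cases "g = 0") (auto simp: power2_norm_eq_inner[symmetric] power2_eq_square)
qed

lemma gradient_graph_bounded: "gradient_graph f \<subseteq> UNIV \<times> cball 0 L"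
  unfolding gradient_graph_def
  by (rule closure_minimal) (auto simp: closed_Times norm_GDERIV_lipschitz[OF differentiable_imp_GDERIV])

lemma norm_limiting_gradients: "g \<in> limiting_gradients f \<delta> z \<Longrightarrow> norm g \<le> L"
  using gradient_graph_bounded by (auto simp: limiting_gradients_def)

lemma compact_limiting_gradients: "compact (limiting_gradients f \<delta> z)"
proof -
  have "compact ((cball z \<delta> \<times> cball 0 L) \<inter> gradient_graph f)"
    by (intro compact_Int_closed compact_Times compact_cball) (simp add: gradient_graph_def)
  then have "compact (snd ` ((cball z \<delta> \<times> cball 0 L) \<inter> gradient_graph f))"
    by (intro compact_continuous_image continuous_on_snd continuous_on_id)
  also have "snd ` ((cball z \<delta> \<times> cball 0 L) \<inter> gradient_graph f) = limiting_gradients f \<delta> z"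
    using gradient_graph_bounded by (force simp: limiting_gradients_def)
  finally show ?thesis .
qed

lemma grad_in_limiting_gradients:
  "f differentiable (at x) \<Longrightarrow> x \<in> cball z \<delta> \<Longrightarrow> grad f x \<in> limiting_gradients f \<delta> z"
  unfolding limiting_gradients_def gradient_graph_def by (blast intro: closure_subset[THEN subsetD])

text \<open>A ball has positive measure, so by Rademacher's theorem it contains a point of
  differentiability, whose gradient belongs to the set.\<close>

lemma limiting_gradients_nonempty:
  assumes "\<delta> > 0" shows "limiting_gradients f \<delta> z \<noteq> {}"
proof -
  have "\<exists>x\<in>ball z \<delta>. f differentiable (at x)"
  proof (rule ccontr)
    assume "\<not> ?thesis"
    with Rademacher[OF lip] have "AE x in lborel. x \<notin> ball z \<delta>" by (auto elim: eventually_mono)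
    then have "ball z \<delta> \<in> null_sets lebesgue"
      by (intro null_sets_completionI) (simp add: AE_iff_null_sets)
    then have "negligible (ball z \<delta>)" by (simp add: negligible_iff_null_sets)
    moreover have "\<not> negligible (ball z \<delta>)" using assms by (intro open_not_negligible) auto
    ultimately show False by blast
  qed
  then obtain x where "x \<in> ball z \<delta>" "f differentiable (at x)" by blast
  then show ?thesis using grad_in_limiting_gradients[of x z \<delta>] by auto
qed

text \<open>The hull of a compact set is compact in finite dimension, so the \<open>LEAST\<close> is
  a true minimum. The last inequality is the variational characterisation of the point of a convex
  set nearest to the origin.\<close>

lemma goldstein_min_norm_attained:
  assumes "\<delta> > 0"
  obtains p where "p \<in> convex hull (limiting_gradients f \<delta> z)" "goldstein_min_norm f \<delta> z = norm p"
    "\<And>g. g \<in> limiting_gradients f \<delta> z \<Longrightarrow> p \<bullet> p \<le> p \<bullet> g"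
proof -
  let ?H = "convex hull (limiting_gradients f \<delta> z)"
  have H: "compact ?H" "?H \<noteq> {}"
    using compact_convex_hull[OF compact_limiting_gradients] limiting_gradients_nonempty[OF assms] by auto
  obtain p where p: "p \<in> ?H" "\<And>g. g \<in> ?H \<Longrightarrow> norm p \<le> norm g"
    using continuous_attains_inf[OF H, of norm] by (auto intro: continuous_intros)
  have "goldstein_min_norm f \<delta> z = norm p"
    unfolding goldstein_min_norm_def goldstein_subdifferential_eq
    by (rule Least_equality) (use p in auto)
  moreover have "p \<bullet> p \<le> p \<bullet> g" if "g \<in> limiting_gradients f \<delta> z" for g
    using any_closest_point_dot[of ?H p g 0] p hull_inc[OF that, of convex] H(1)
    by (auto simp: inner_diff_right compact_imp_closed)
  ultimately show ?thesis using p(1) that by blast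
qed

lemma goldstein_min_norm_bounds:
  assumes "\<delta> > 0" shows "0 \<le> goldstein_min_norm f \<delta> z" "goldstein_min_norm f \<delta> z \<le> L"
proof -
  obtain p where p: "p \<in> convex hull (limiting_gradients f \<delta> z)" "goldstein_min_norm f \<delta> z = norm p"
    using goldstein_min_norm_attained[OF assms] by blast
  have "convex hull (limiting_gradients f \<delta> z) \<subseteq> cball 0 L"
    by (intro hull_minimal) (auto simp: norm_limiting_gradients)
  with p show "0 \<le> goldstein_min_norm f \<delta> z" "goldstein_min_norm f \<delta> z \<le> L" by auto
qed

text \<open>All superlevel sets are open. If the least norm at \<open>z\<close> exceeds
  \<open>a \<ge> 0\<close> and is attained at \<open>p\<close>, the limiting gradients at
  \<open>z\<close> lie in the open half-space \<open>p \<bullet> g > a * norm p\<close>. This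
  persists for nearby points, and the half-space passes to the convex hull and keeps it outside the
  ball of radius \<open>a\<close>.\<close>

lemma goldstein_min_norm_measurable [measurable]:
  assumes \<delta>: "\<delta> > 0"
  shows "goldstein_min_norm f \<delta> \<in> borel_measurable borel"
proof (rule borel_measurableI_greater)
  fix a :: real
  have "open {z. a < goldstein_min_norm f \<delta> z}"
  proof (cases "a < 0")
    case True
    then have "{z. a < goldstein_min_norm f \<delta> z} = UNIV"
      using goldstein_min_norm_bounds(1)[OF \<delta>] by (auto intro: less_le_trans)
    then show ?thesis by simp
  next
    case False
    show ?thesis
    proof (subst open_subopen, safe)
      fix z assume z: "a < goldstein_min_norm f \<delta> z"
      obtain p where p: "goldstein_min_norm f \<delta> z = norm p"
        "\<And>g. g \<in> limiting_gradients f \<delta> z \<Longrightarrow> p \<bullet> p \<le> p \<bullet> g"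
        using goldstein_min_norm_attained[OF \<delta>] by metis
      have np: "a < norm p" "0 < norm p" using z p False by auto
      \<comment> \<open>Writing the base point as \<open>y + e\<close> keeps the pair
        \<open>(e, g)\<close> in one compact set for all \<open>y\<close>. The projection of a
        closed set along a compact factor is closed, so \<open>U\<close> is open.\<close>
      define U where "U = - {y. \<exists>x. x \<in> cball 0 \<delta> \<times> cball 0 L \<and>
        (x, y) \<in> {((e, g), y). (y + e, g) \<in> gradient_graph f \<and> p \<bullet> g \<le> a * norm p}}"
      have "closed ({q. (snd q + fst (fst q), snd (fst q)) \<in> gradient_graph f} \<inter> {q :: ('a \<times> 'a) \<times> 'a. p \<bullet> snd (fst q) \<le> a * norm p})"
      proof (intro closed_Int closed_Collect_le continuous_intros)
        have "closed ((\<lambda>q :: ('a \<times> 'a) \<times> 'a. (snd q + fst (fst q), snd (fst q))) -` gradient_graph f)"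
          by (intro closed_vimage continuous_intros) (simp add: gradient_graph_def)
        then show "closed {q :: ('a \<times> 'a) \<times> 'a. (snd q + fst (fst q), snd (fst q)) \<in> gradient_graph f}"
          by (simp add: vimage_def)
      qed
      also have "{q. (snd q + fst (fst q), snd (fst q)) \<in> gradient_graph f} \<inter> {q :: ('a \<times> 'a) \<times> 'a. p \<bullet> snd (fst q) \<le> a * norm p}
        = {((e, g), y). (y + e, g) \<in> gradient_graph f \<and> p \<bullet> g \<le> a * norm p}" by auto
      finally have "open U"
        unfolding U_def open_closed double_complement by (intro closed_compact_projection compact_Times compact_cball)
      have U: "y \<in> U \<longleftrightarrow> (\<forall>g\<in>limiting_gradients f \<delta> y. a * norm p < p \<bullet> g)" for y
      proof
        assume y: "y \<in> U"
        show "\<forall>g\<in>limiting_gradients f \<delta> y. a * norm p < p \<bullet> g"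
        proof (rule ballI, rule ccontr)
          fix g assume g: "g \<in> limiting_gradients f \<delta> y" "\<not> a * norm p < p \<bullet> g"
          then obtain x where x: "x \<in> cball y \<delta>" "(x, g) \<in> gradient_graph f" by (auto simp: limiting_gradients_def)
          have "(x - y, g) \<in> cball 0 \<delta> \<times> cball 0 L" "(y + (x - y), g) \<in> gradient_graph f"
            using x norm_limiting_gradients[OF g(1)] by (auto simp: dist_norm norm_minus_commute)
          with g(2) y show False unfolding U_def by (auto simp: not_less)
        qed
      next
        assume y: "\<forall>g\<in>limiting_gradients f \<delta> y. a * norm p < p \<bullet> g"
        show "y \<in> U"
          unfolding U_def
        proof (rule ComplI, clarify)
          fix e g assume g: "e \<in> cball 0 \<delta>" "(y + e, g) \<in> gradient_graph f" "p \<bullet> g \<le> a * norm p"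
          then have "g \<in> limiting_gradients f \<delta> y" by (force simp: limiting_gradients_def dist_norm)
          with y g(3) show False by auto
        qed
      qed
      have "z \<in> U"
        unfolding U
      proof
        fix g assume "g \<in> limiting_gradients f \<delta> z"
        then have "p \<bullet> p \<le> p \<bullet> g" by (rule p(2))
        moreover have "a * norm p < p \<bullet> p" using np by (simp add: power2_norm_eq_inner[symmetric] power2_eq_square)
        ultimately show "a * norm p < p \<bullet> g" by simp
      qed
      moreover have "a < goldstein_min_norm f \<delta> y" if y: "y \<in> U" for y
      proof -
        obtain q where q: "q \<in> convex hull (limiting_gradients f \<delta> y)" "goldstein_min_norm f \<delta> y = norm q"
          using goldstein_min_norm_attained[OF \<delta>] by metis
        have "convex hull (limiting_gradients f \<delta> y) \<subseteq> {g. p \<bullet> g > a * norm p}"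
          using y U by (intro hull_minimal convex_halfspace_gt) auto
        then have "a * norm p < p \<bullet> q" using q(1) by auto
        also have "\<dots> \<le> norm q * norm p" using norm_cauchy_schwarz[of p q] by (simp add: mult.commute)
        finally show ?thesis using np(2) q(2) by simp
      qed
      ultimately show "\<exists>T. open T \<and> z \<in> T \<and> T \<subseteq> {z. a < goldstein_min_norm f \<delta> z}"
        using \<open>open U\<close> by blast
    qed
  qed
  then show "{z \<in> space borel. a < goldstein_min_norm f \<delta> z} \<in> sets borel" by simp
qed

text \<open>With \<open>e\<close> the normalised least element \<open>p\<close>, the number
  \<open>e \<bullet> g\<close> is the Gaussian average of directional derivatives of
  \<open>f\<close> along \<open>e\<close>, by dominated convergence of difference quotients. At
  points of differentiability within \<open>\<delta>\<close> of \<open>z\<close> these are at least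
  \<open>norm p\<close>, and their average is at most \<open>norm g\<close>.\<close>

lemma goldstein_min_norm_le_smoothing:
  assumes \<delta>: "\<delta> > 0" and \<mu>: "\<mu> > 0" and g: "GDERIV (gaussian_smoothing f \<mu>) z :> g"
  shows "goldstein_min_norm f \<delta> z \<le> norm g + 2 * L * measure std_gaussian {u::'a. \<delta> / \<mu> \<le> norm u}"
proof -
  obtain p where p: "goldstein_min_norm f \<delta> z = norm p" "\<And>g. g \<in> limiting_gradients f \<delta> z \<Longrightarrow> p \<bullet> p \<le> p \<bullet> g"
    using goldstein_min_norm_attained[OF \<delta>] by metis
  have L: "L \<ge> 0" by (rule lipschitz_on_nonneg[OF lip])
  have pL: "norm p \<le> L" using goldstein_min_norm_bounds(2)[OF \<delta>, of z] p(1) by simp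
  note [measurable] = lipschitz_measurable[OF lip] dir_deriv_measurable[OF lip]
  show ?thesis
  proof (cases "p = 0")
    case False
    define e where "e = (1 / norm p) *\<^sub>R p"
    have e: "norm e = 1" using False by (simp add: e_def)
    have ge: "norm p \<le> e \<bullet> g'" if "g' \<in> limiting_gradients f \<delta> z" for g'
      using p(2)[OF that] False by (simp add: e_def power2_norm_eq_inner[symmetric] power2_eq_square field_simps)
    let ?s = "\<lambda>n. 1 / real (Suc n)"
    let ?q = "\<lambda>n x. (f (x + ?s n *\<^sub>R e) - f x) / ?s n"
    have int: "integrable std_gaussian (\<lambda>u. f (x + \<mu> *\<^sub>R u))" for x
      by (rule integrable_std_gaussian_exp_bound[where C = "\<bar>f x\<bar> + L * \<mu>" and c = 1])
        (use lipschitz_exp_growth[OF lip \<mu>] in auto)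
    have lim: "(\<lambda>n. \<integral>u. ?q n (z + \<mu> *\<^sub>R u) \<partial>std_gaussian) \<longlonglongrightarrow> (\<integral>u. dir_deriv f e (z + \<mu> *\<^sub>R u) \<partial>std_gaussian)"
    proof (rule integral_dominated_convergence[where w = "\<lambda>_. L"])
      show "AE u in std_gaussian. (\<lambda>n. ?q n (z + \<mu> *\<^sub>R u)) \<longlonglongrightarrow> dir_deriv f e (z + \<mu> *\<^sub>R u)"
        using \<mu> by (intro AE_std_gaussian_affine[OF AE_dir_deriv_seq[OF lip]]) simp
      show "AE u in std_gaussian. norm (?q n (z + \<mu> *\<^sub>R u)) \<le> L" for n
      proof (rule AE_I2)
        fix u show "norm (?q n (z + \<mu> *\<^sub>R u)) \<le> L"
          using lipschitz_quotient_bound[OF lip, of "z + \<mu> *\<^sub>R u" "?s n" e] e unfolding real_norm_def by simp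
      qed
    qed simp_all
    have q_eq: "(\<integral>u. ?q n (z + \<mu> *\<^sub>R u) \<partial>std_gaussian) = (gaussian_smoothing f \<mu> (z + ?s n *\<^sub>R e) - gaussian_smoothing f \<mu> z) / ?s n" for n
    proof -
      have "(\<integral>u. ?q n (z + \<mu> *\<^sub>R u) \<partial>std_gaussian) = (\<integral>u. (f (z + ?s n *\<^sub>R e + \<mu> *\<^sub>R u) - f (z + \<mu> *\<^sub>R u)) / ?s n \<partial>std_gaussian)"
        by (simp add: add_ac)
      also have "\<dots> = (\<integral>u. (f (z + ?s n *\<^sub>R e + \<mu> *\<^sub>R u) - f (z + \<mu> *\<^sub>R u)) \<partial>std_gaussian) / ?s n"
        by (rule integral_divide_zero)
      also have "\<dots> = (gaussian_smoothing f \<mu> (z + ?s n *\<^sub>R e) - gaussian_smoothing f \<mu> z) / ?s n"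
        unfolding gaussian_smoothing_def using int by (subst Bochner_Integration.integral_diff) auto
      finally show ?thesis .
    qed
    from lim have "(\<lambda>n. (gaussian_smoothing f \<mu> (z + ?s n *\<^sub>R e) - gaussian_smoothing f \<mu> z) / ?s n) \<longlonglongrightarrow> (\<integral>u. dir_deriv f e (z + \<mu> *\<^sub>R u) \<partial>std_gaussian)"
      unfolding q_eq .
    moreover have "(\<lambda>n. (gaussian_smoothing f \<mu> (z + ?s n *\<^sub>R e) - gaussian_smoothing f \<mu> z) / ?s n) \<longlonglongrightarrow> e \<bullet> g"
      by (rule filterlim_compose[OF GDERIV_directional[OF g] inverse_Suc_at_right])
    ultimately have eg: "e \<bullet> g = (\<integral>u. dir_deriv f e (z + \<mu> *\<^sub>R u) \<partial>std_gaussian)"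
      by (rule LIMSEQ_unique[symmetric])
    let ?A = "{u::'a. \<delta> / \<mu> \<le> norm u}"
    have bdd: "AE u in std_gaussian. \<bar>dir_deriv f e (z + \<mu> *\<^sub>R u)\<bar> \<le> L"
      using AE_std_gaussian_affine[OF AE_dir_deriv_bound[OF lip, of e], of \<mu> z] \<mu> e by simp
    have intA: "integrable std_gaussian (indicat_real ?A)"
      by (intro integrable_real_indicator) (auto simp: less_top[symmetric])
    have "norm p - 2 * L * measure std_gaussian ?A = (\<integral>u. norm p - 2 * L * indicator ?A u \<partial>std_gaussian)"
      using intA by (simp add: gauss.prob_space[unfolded space_std_gaussian])
    also have "\<dots> \<le> (\<integral>u. dir_deriv f e (z + \<mu> *\<^sub>R u) \<partial>std_gaussian)"
    proof (rule integral_mono_AE)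
      show "integrable std_gaussian (\<lambda>u. norm p - 2 * L * indicat_real ?A u)"
        using intA by simp
      show "integrable std_gaussian (\<lambda>u. dir_deriv f e (z + \<mu> *\<^sub>R u))"
        by (rule gauss.integrable_const_bound[of _ L]) (use bdd in auto)
      have "AE u in std_gaussian. f differentiable (at (z + \<mu> *\<^sub>R u))"
        using \<mu> by (intro AE_std_gaussian_affine[OF Rademacher[OF lip]]) simp
      then show "AE u in std_gaussian. norm p - 2 * L * indicator ?A u \<le> dir_deriv f e (z + \<mu> *\<^sub>R u)"
        using bdd
      proof eventually_elim
        case (elim u)
        show ?case
        proof (cases "u \<in> ?A")
          case True
          \<comment> \<open>Far from \<open>z\<close> only \<open>- L\<close> is available as a
            lower bound; as \<open>norm p \<le> L\<close>, the loss there is at most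
            \<open>2 * L\<close>, the factor in the statement.\<close>
          then show ?thesis using elim(2) pL by (simp add: abs_le_iff)
        next
          case False
          then have "z + \<mu> *\<^sub>R u \<in> cball z \<delta>" using \<mu> by (simp add: dist_norm field_simps)
          then have "norm p \<le> e \<bullet> grad f (z + \<mu> *\<^sub>R u)"
            by (intro ge grad_in_limiting_gradients elim)
          also have "\<dots> = dir_deriv f e (z + \<mu> *\<^sub>R u)"
            by (rule dir_deriv_eq[symmetric, OF GDERIV_directional[OF differentiable_imp_GDERIV[OF elim(1)]]])
          finally show ?thesis using False by simp
        qed
      qed
    qed
    also have "\<dots> \<le> norm g" unfolding eg[symmetric] using norm_cauchy_schwarz[of e g] e by simp
    finally show ?thesis using p(1) by simp
  qed (use p(1) L in auto)
qed

end

text \<open>In terms of \<open>s = R\<^sup>2 / d\<close> the tail bound is the \<open>d\<close>-th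
  power of \<open>sqrt 2 * exp (- s / 4)\<close>, so it suffices to compare \<open>d\<close>-th
  roots. The hypothesis on \<open>\<mu>\<close> says that \<open>sqrt (pi * exp 1 / s)\<close> is at
  most the \<open>d\<close>-th root of \<open>\<eta>\<close>. After squaring,
  \<open>2 * exp (- s / 2) \<le> 4 / s\<close> follows from \<open>x \<le> exp x\<close>, and 4 is
  below \<open>pi * exp 1\<close>.\<close>

lemma std_gaussian_smoothing_tail:
  fixes \<eta> \<mu> \<delta> :: real
  assumes \<mu>: "0 < \<mu>" "\<mu> \<le> \<delta> / sqrt (real DIM('a::euclidean_space) * pi * exp 1) * \<eta> powr (1 / real DIM('a))"
    and \<eta>: "0 < \<eta>"
  shows "measure std_gaussian {u::'a. \<delta> / \<mu> \<le> norm u} \<le> \<eta>"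
proof -
  let ?d = "real DIM('a)"
  define R where "R = \<delta> / \<mu>"
  define s where "s = R\<^sup>2 / ?d"
  have d: "?d > 0" by simp
  have C: "0 < sqrt (?d * pi * exp 1)" using d by simp
  have "0 < \<delta> / sqrt (?d * pi * exp 1) * \<eta> powr (1 / ?d)" using \<mu> by linarith
  moreover have "\<delta> / sqrt (?d * pi * exp 1) * \<eta> powr (1 / ?d) \<le> 0" if "\<delta> \<le> 0"
    using that C by (intro mult_nonpos_nonneg divide_nonpos_pos) auto
  ultimately have "\<delta> > 0" by (meson not_le)
  then have R: "R > 0" using \<mu> by (simp add: R_def)
  then have s: "s > 0" using d by (simp add: s_def)
  have RC: "sqrt (?d * pi * exp 1) / R \<le> \<eta> powr (1 / ?d)"
    using \<mu> C \<open>\<delta> > 0\<close> by (simp add: R_def field_simps)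
  have "2 * exp (- s / 2) \<le> 4 / s"
  proof -
    have "s / 2 \<le> exp (s / 2)" using real_le_exp .
    then show ?thesis using s by (simp add: exp_minus field_simps)
  qed
  also have "\<dots> \<le> pi * exp 1 / s"
  proof -
    have "3 * 2 \<le> pi * exp 1" using pi_gt3 exp_ge_add_one_self[of "1::real"] by (intro mult_mono) auto
    then show ?thesis using s by (simp add: divide_right_mono)
  qed
  finally have "sqrt (2 * exp (- s / 2)) \<le> sqrt (pi * exp 1 / s)" by simp
  also have "pi * exp 1 / s = ?d * pi * exp 1 / R\<^sup>2" using d R by (simp add: s_def)
  also have "sqrt \<dots> = sqrt (?d * pi * exp 1) / R" using R by (simp add: real_sqrt_divide)
  also note RC
  finally have "sqrt 2 * sqrt (exp (- s / 2)) \<le> \<eta> powr (1 / ?d)" by (simp add: real_sqrt_mult)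
  moreover have "sqrt (exp (- s / 2)) = exp (- s / 4)"
    by (rule real_sqrt_unique) (simp_all add: power2_eq_square exp_add[symmetric])
  ultimately have b: "sqrt 2 * exp (- s / 4) \<le> \<eta> powr (1 / ?d)" by simp
  have "measure std_gaussian {u::'a. R \<le> norm u} \<le> sqrt 2 ^ DIM('a) * exp (- R\<^sup>2 / 4)"
    using R by (intro std_gaussian_tail) simp
  also have "exp (- R\<^sup>2 / 4) = exp (- s / 4) ^ DIM('a)"
    by (simp add: exp_of_nat_mult[symmetric] s_def)
  also have "sqrt 2 ^ DIM('a) * exp (- s / 4) ^ DIM('a) = (sqrt 2 * exp (- s / 4)) ^ DIM('a)"
    by (simp add: power_mult_distrib)
  also have "\<dots> \<le> (\<eta> powr (1 / ?d)) ^ DIM('a)" using b by (intro power_mono) auto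
  also have "\<dots> = \<eta>" using \<eta> by (simp add: powr_realpow[symmetric] powr_powr)
  finally show ?thesis by (simp add: R_def)
qed

section \<open>The extragradient iteration\<close>

lemma GDERIV_partial:
  fixes f :: "'a::euclidean_space \<times> 'b::euclidean_space \<Rightarrow> real"
  assumes "GDERIV f z :> g"
  shows "GDERIV (\<lambda>x. f (x, snd z)) (fst z) :> fst g" "GDERIV (\<lambda>y. f (fst z, y)) (snd z) :> snd g"
proof -
  have f: "(f has_derivative (\<lambda>h. h \<bullet> g)) (at (fst z, snd z))"
    using assms by (simp add: gderiv_def)
  have "((\<lambda>x. f (x, snd z)) has_derivative (\<lambda>h. (h, 0) \<bullet> g)) (at (fst z))"
    by (rule has_derivative_compose[of "\<lambda>x. (x, snd z)" "\<lambda>h. (h, 0)" "fst z" UNIV f "\<lambda>h. h \<bullet> g"])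
      (use f in \<open>auto intro!: derivative_eq_intros\<close>)
  then show "GDERIV (\<lambda>x. f (x, snd z)) (fst z) :> fst g"
    by (simp add: gderiv_def inner_prod_def)
  have "((\<lambda>y. f (fst z, y)) has_derivative (\<lambda>h. (0, h) \<bullet> g)) (at (snd z))"
    by (rule has_derivative_compose[of "\<lambda>y. (fst z, y)" "\<lambda>h. (0, h)" "snd z" UNIV f "\<lambda>h. h \<bullet> g"])
      (use f in \<open>auto intro!: derivative_eq_intros\<close>)
  then show "GDERIV (\<lambda>y. f (fst z, y)) (snd z) :> snd g"
    by (simp add: gderiv_def inner_prod_def)
qed

lemma norm_diff_sq: "(norm (x - y :: 'a::real_inner))\<^sup>2 = (norm x)\<^sup>2 - 2 * (x \<bullet> y) + (norm y)\<^sup>2"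
  by (simp add: power2_norm_eq_inner inner_diff_left inner_diff_right inner_commute)

text \<open>The gradient formula for smoothings, applied to the constant function 1, expresses the
  mean of the Gaussian as the gradient of a constant.\<close>

lemma integral_std_gaussian_id: "(\<integral>u. u \<partial>(std_gaussian :: 'a::euclidean_space measure)) = 0"
proof -
  have "GDERIV (gaussian_smoothing (\<lambda>_::'a. 1) 1) 0 :> (\<integral>u. u \<partial>std_gaussian)"
    using gaussian_smoothing_GDERIV[of 0 "\<lambda>_::'a. 1" 1 0] by (simp add: lipschitz_on_def)
  moreover have "gaussian_smoothing (\<lambda>_::'a. 1) 1 = (\<lambda>_. 1)"
    by (simp add: gaussian_smoothing_def gauss.prob_space[unfolded space_std_gaussian] fun_eq_iff)
  moreover have "GDERIV (\<lambda>_::'a. 1) 0 :> 0" by (rule GDERIV_const)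
  ultimately show ?thesis by (metis GDERIV_unique)
qed

section \<open>Mean and moments of the random oracle\<close>

context
  fixes f :: "'a::euclidean_space \<times> 'b::euclidean_space \<Rightarrow> real" and L \<mu> :: real
  assumes lip: "L-lipschitz_on UNIV f" and \<mu>: "\<mu> > 0"
begin

lemma gaussian_smoothing_grad: "GDERIV (gaussian_smoothing f \<mu>) z :> grad (gaussian_smoothing f \<mu>) z"
  unfolding grad_eq[OF gaussian_smoothing_GDERIV[OF lip \<mu>]] by (rule gaussian_smoothing_GDERIV[OF lip \<mu>])

lemma F_smooth_eq:
  "F_smooth f \<mu> z = (fst (grad (gaussian_smoothing f \<mu>) z), - snd (grad (gaussian_smoothing f \<mu>) z))"
  unfolding F_smooth_def
  using grad_eq[OF GDERIV_partial(1)[OF gaussian_smoothing_grad]] grad_eq[OF GDERIV_partial(2)[OF gaussian_smoothing_grad]]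
  by auto

lemma norm_F_smooth: "norm (F_smooth f \<mu> z) = norm (grad (gaussian_smoothing f \<mu>) z)"
  unfolding F_smooth_eq by (simp add: norm_prod_def)

lemma norm_F_smooth_diff: "norm (F_smooth f \<mu> z - F_smooth f \<mu> w) =
    norm (grad (gaussian_smoothing f \<mu>) z - grad (gaussian_smoothing f \<mu>) w)"
  unfolding F_smooth_eq by (simp add: norm_prod_def norm_minus_commute)

lemma G_oracle_measurable [measurable (raw)]:
  assumes [measurable]: "z \<in> borel_measurable M" "u \<in> borel_measurable M"
  shows "(\<lambda>x. G_oracle f \<mu> (z x) (u x)) \<in> borel_measurable M"
proof -
  note [measurable] = lipschitz_measurable[OF lip]
  have [measurable]: "(\<lambda>p::'a \<times> 'b. (fst p, - snd p)) \<in> borel_measurable borel"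
    by (intro borel_measurable_continuous_onI continuous_intros)
  show ?thesis unfolding G_oracle_def by measurable
qed

lemma norm_G_oracle: "norm (G_oracle f \<mu> z u) \<le> L * exp (2 * norm u)"
proof -
  have n: "norm (fst u, - snd u) = norm u" by (simp add: norm_prod_def)
  have "\<bar>f (z + \<mu> *\<^sub>R u) - f z\<bar> / \<mu> \<le> L * norm u"
    using lipschitz_real_bound[OF lip, of "z + \<mu> *\<^sub>R u" z] \<mu> by (simp add: field_simps)
  then have "norm (G_oracle f \<mu> z u) \<le> L * norm u * norm u"
    unfolding G_oracle_def norm_scaleR n using \<mu> by (intro mult_right_mono) auto
  also have "\<dots> \<le> L * exp (norm u) * exp (norm u)"
    using real_le_exp lipschitz_on_nonneg[OF lip] by (intro mult_mono) auto
  finally show ?thesis unfolding mult_2 exp_add by simp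
qed

lemma G_oracle_integrable: "integrable std_gaussian (G_oracle f \<mu> z)"
  by (rule integrable_std_gaussian_exp_bound[OF _ norm_G_oracle]) measurable

lemma G_oracle_sq_integrable: "integrable std_gaussian (\<lambda>u. (norm (G_oracle f \<mu> z u - a))\<^sup>2)"
proof (rule integrable_std_gaussian_exp_bound[where C = "(L + norm a)\<^sup>2" and c = 4])
  fix u
  have "norm (G_oracle f \<mu> z u - a) \<le> L * exp (2 * norm u) + norm a * 1"
    using norm_G_oracle[of z u] norm_triangle_ineq4[of "G_oracle f \<mu> z u" a] by simp
  also have "\<dots> \<le> L * exp (2 * norm u) + norm a * exp (2 * norm u)"
    by (intro add_left_mono mult_left_mono) auto
  finally have "norm (G_oracle f \<mu> z u - a) \<le> (L + norm a) * exp (2 * norm u)" by (simp add: distrib_right)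
  then have "(norm (G_oracle f \<mu> z u - a))\<^sup>2 \<le> ((L + norm a) * exp (2 * norm u))\<^sup>2" by (intro power_mono) auto
  also have "\<dots> = (L + norm a)\<^sup>2 * exp (4 * norm u)"
    by (simp add: power_mult_distrib exp_double[symmetric])
  finally show "norm ((norm (G_oracle f \<mu> z u - a))\<^sup>2) \<le> (L + norm a)\<^sup>2 * exp (4 * norm u)" by simp
qed measurable

text \<open>The subtracted baseline \<open>f z\<close> contributes only a multiple of the mean of
  the Gaussian, which is zero. The sign change in the second block is a bounded linear map and
  commutes with the integral.\<close>

lemma integral_G_oracle: "(\<integral>u. G_oracle f \<mu> z u \<partial>std_gaussian) = F_smooth f \<mu> z"
proof -
  let ?J = "\<lambda>p::'a \<times> 'b. (fst p, - snd p)"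
  have J: "bounded_linear ?J"
    by (intro bounded_linear_Pair bounded_linear_fst bounded_linear_minus bounded_linear_snd)
  have int1: "integrable std_gaussian (\<lambda>u. (f (z + \<mu> *\<^sub>R u) / \<mu>) *\<^sub>R u)"
  proof (rule integrable_std_gaussian_exp_bound[where C = "(\<bar>f z\<bar> + L * \<mu>) / \<mu>" and c = 2])
    note [measurable] = lipschitz_measurable[OF lip]
    show "(\<lambda>u. (f (z + \<mu> *\<^sub>R u) / \<mu>) *\<^sub>R u) \<in> borel_measurable borel" by measurable
    fix u :: "'a \<times> 'b"
    have "\<bar>f (z + \<mu> *\<^sub>R u)\<bar> * norm u \<le> (\<bar>f z\<bar> + L * \<mu>) * exp (norm u) * exp (norm u)"
      using lipschitz_on_nonneg[OF lip] \<mu> by (intro mult_mono lipschitz_exp_growth[OF lip \<mu>] real_le_exp) auto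
    then show "norm ((f (z + \<mu> *\<^sub>R u) / \<mu>) *\<^sub>R u) \<le> (\<bar>f z\<bar> + L * \<mu>) / \<mu> * exp (2 * norm u)"
      using \<mu> unfolding mult_2 exp_add by (simp add: field_simps)
  qed
  have int2: "integrable std_gaussian (\<lambda>u::'a \<times> 'b. u)"
    by (rule integrable_std_gaussian_exp_bound[where C = 1 and c = 1]) (auto simp: real_le_exp)
  have "(\<integral>u. G_oracle f \<mu> z u \<partial>std_gaussian)
      = (\<integral>u. ?J ((f (z + \<mu> *\<^sub>R u) / \<mu>) *\<^sub>R u - (f z / \<mu>) *\<^sub>R u) \<partial>std_gaussian)"
    by (intro Bochner_Integration.integral_cong) (auto simp: G_oracle_def diff_divide_distrib scaleR_diff_left algebra_simps)
  also have "\<dots> = ?J (\<integral>u. (f (z + \<mu> *\<^sub>R u) / \<mu>) *\<^sub>R u - (f z / \<mu>) *\<^sub>R u \<partial>std_gaussian)"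
    using int1 int2 by (intro integral_bounded_linear[OF J]) auto
  also have "(\<integral>u. (f (z + \<mu> *\<^sub>R u) / \<mu>) *\<^sub>R u - (f z / \<mu>) *\<^sub>R u \<partial>std_gaussian)
      = grad (gaussian_smoothing f \<mu>) z"
    using int1 int2 grad_eq[OF gaussian_smoothing_GDERIV[OF lip \<mu>, of z]]
    by (simp add: Bochner_Integration.integral_diff integral_std_gaussian_id)
  finally show ?thesis unfolding F_smooth_eq .
qed

end

section \<open>Expected decrease in one step from a fixed point\<close>

locale zoeg =
  fixes f :: "'a::euclidean_space \<times> 'b::euclidean_space \<Rightarrow> real"
    and L\<^sub>0 \<mu> L\<^sub>1 \<sigma> \<rho> h\<^sub>1 h\<^sub>2 :: real and zstar :: "'a \<times> 'b"
  assumes lip: "L\<^sub>0-lipschitz_on UNIV f" and \<mu>: "\<mu> > 0"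
    and L1: "L\<^sub>1 > 0" "L\<^sub>1-lipschitz_on UNIV (grad (gaussian_smoothing f \<mu>))"
    and variance: "\<And>z. (\<integral>v. (norm (G_oracle f \<mu> z v - F_smooth f \<mu> z))\<^sup>2 \<partial>std_gaussian) \<le> \<sigma>\<^sup>2"
    and rho: "0 \<le> \<rho>"
    and weak_minty: "\<And>z. F_smooth f \<mu> z \<bullet> (z - zstar) + \<rho> / 2 * (norm (F_smooth f \<mu> z))\<^sup>2 \<ge> 0"
    and h1: "h\<^sub>1 > 0" "h\<^sub>1 \<le> 1 / L\<^sub>1"
    and h2: "h\<^sub>2 > 0" "h\<^sub>2 \<le> h\<^sub>1 / 2"
begin

abbreviation "F \<equiv> F_smooth f \<mu>"
abbreviation "G \<equiv> G_oracle f \<mu>"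

text \<open>This is \<open>h\<^sub>2\<^sup>2 - \<rho> / L\<^sub>1\<close>, the share of the squared
  norm of \<open>F\<close> at the extrapolated point that each step gains. It is positive exactly
  when \<open>h\<^sub>2\<close> exceeds \<open>sqrt (\<rho> / L\<^sub>1)\<close>.\<close>

definition rate :: real where "rate = (L\<^sub>1 * h\<^sub>2\<^sup>2 - \<rho>) / L\<^sub>1"

lemmas G_measurable [measurable (raw)] = G_oracle_measurable[OF lip \<mu>]

lemma F_lipschitz: "norm (F z - F w) \<le> L\<^sub>1 * norm (z - w)"
  using lipschitz_onD[OF L1(2), of z w] by (simp add: norm_F_smooth_diff[OF lip \<mu>] dist_norm)

lemma F_measurable [measurable]: "F \<in> borel_measurable borel"
proof -
  have "L\<^sub>1-lipschitz_on UNIV F"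
    using F_lipschitz L1(1) by (intro lipschitz_onI) (auto simp: dist_norm)
  then show ?thesis by (intro borel_measurable_continuous_onI lipschitz_on_continuous_on)
qed

lemma zoeg_extrapolate_measurable [measurable (raw)]:
  assumes [measurable]: "z \<in> borel_measurable M" "v \<in> borel_measurable M"
  shows "(\<lambda>x. zoeg_extrapolate f \<mu> h\<^sub>1 (z x) (v x)) \<in> borel_measurable M"
  unfolding zoeg_extrapolate_def by measurable

text \<open>The square is expanded around the mean step \<open>?a\<close>. The oracle is unbiased,
  so the cross term integrates to zero and the noise costs only its variance times
  \<open>h\<^sub>2\<^sup>2\<close>.\<close>

lemma update_bound:
  "integrable std_gaussian (\<lambda>w. (norm (z - h\<^sub>2 *\<^sub>R G x w - zstar))\<^sup>2)"
  "(\<integral>w. (norm (z - h\<^sub>2 *\<^sub>R G x w - zstar))\<^sup>2 \<partial>std_gaussian)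
    \<le> (norm (z - zstar))\<^sup>2 - 2 * h\<^sub>2 * (F x \<bullet> (z - zstar)) + h\<^sub>2\<^sup>2 * ((norm (F x))\<^sup>2 + \<sigma>\<^sup>2)"
proof -
  let ?a = "z - zstar - h\<^sub>2 *\<^sub>R F x"
  have eq: "(norm (z - h\<^sub>2 *\<^sub>R G x w - zstar))\<^sup>2 =
      (norm ?a)\<^sup>2 - 2 * h\<^sub>2 * (?a \<bullet> (G x w - F x)) + h\<^sub>2\<^sup>2 * (norm (G x w - F x))\<^sup>2" for w
  proof -
    have e: "z - h\<^sub>2 *\<^sub>R G x w - zstar = ?a - h\<^sub>2 *\<^sub>R (G x w - F x)" by (simp add: algebra_simps)
    show ?thesis unfolding e norm_diff_sq[of ?a] by (simp add: power_mult_distrib)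
  qed
  have i1: "integrable std_gaussian (\<lambda>w. ?a \<bullet> (G x w - F x))"
    using G_oracle_integrable[OF lip \<mu>, of x] by (intro integrable_inner_right Bochner_Integration.integrable_diff) auto
  have i2: "integrable std_gaussian (\<lambda>w. (norm (G x w - F x))\<^sup>2)"
    by (rule G_oracle_sq_integrable[OF lip \<mu>])
  show "integrable std_gaussian (\<lambda>w. (norm (z - h\<^sub>2 *\<^sub>R G x w - zstar))\<^sup>2)"
    unfolding eq using i1 i2 by auto
  have i0: "integrable std_gaussian (\<lambda>w. G x w - F x)"
    using G_oracle_integrable[OF lip \<mu>, of x] by auto
  have zero: "(\<integral>w. ?a \<bullet> (G x w - F x) \<partial>std_gaussian) = 0"
  proof -
    have "(\<integral>w. ?a \<bullet> (G x w - F x) \<partial>std_gaussian) = ?a \<bullet> (\<integral>w. G x w - F x \<partial>std_gaussian)"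
      by (rule integral_inner_right[OF i0])
    also have "(\<integral>w. G x w - F x \<partial>std_gaussian) = 0"
      using G_oracle_integrable[OF lip \<mu>, of x]
      by (simp add: integral_G_oracle[OF lip \<mu>] gauss.prob_space[unfolded space_std_gaussian])
    finally show ?thesis by simp
  qed
  have "(\<integral>w. (norm (z - h\<^sub>2 *\<^sub>R G x w - zstar))\<^sup>2 \<partial>std_gaussian)
      = (norm ?a)\<^sup>2 - 2 * h\<^sub>2 * (\<integral>w. ?a \<bullet> (G x w - F x) \<partial>std_gaussian)
        + h\<^sub>2\<^sup>2 * (\<integral>w. (norm (G x w - F x))\<^sup>2 \<partial>std_gaussian)"
    unfolding eq using i1 i2 by (simp add: gauss.prob_space[unfolded space_std_gaussian])
  also have "\<dots> \<le> (norm ?a)\<^sup>2 + h\<^sub>2\<^sup>2 * \<sigma>\<^sup>2"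
    unfolding zero using variance[of x] by (simp add: mult_left_mono)
  also have "(norm ?a)\<^sup>2 = (norm (z - zstar))\<^sup>2 - 2 * h\<^sub>2 * (F x \<bullet> (z - zstar)) + h\<^sub>2\<^sup>2 * (norm (F x))\<^sup>2"
    by (simp add: norm_diff_sq[of "z - zstar"] power_mult_distrib inner_commute)
  finally show "(\<integral>w. (norm (z - h\<^sub>2 *\<^sub>R G x w - zstar))\<^sup>2 \<partial>std_gaussian)
    \<le> (norm (z - zstar))\<^sup>2 - 2 * h\<^sub>2 * (F x \<bullet> (z - zstar)) + h\<^sub>2\<^sup>2 * ((norm (F x))\<^sup>2 + \<sigma>\<^sup>2)"
    unfolding distrib_left by linarith
qed

text \<open>The second inequality makes the total coefficient of the squared norm of
  \<open>F\<close> at the extrapolated point nonpositive: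
  \<open>h\<^sub>1 * h\<^sub>2 \<ge> 2 * h\<^sub>2\<^sup>2\<close> leaves
  \<open>- h\<^sub>2\<^sup>2\<close>, and
  \<open>h\<^sub>2 * \<rho> \<le> \<rho> / L\<^sub>1\<close>. The third collects the noise of both
  oracle calls: at most \<open>7 / 4\<close> over \<open>L\<^sub>1\<^sup>2\<close>, rounded up to
  3.\<close>

lemma step_sizes: "L\<^sub>1 * h\<^sub>1 \<le> 1" "h\<^sub>2 * \<rho> - h\<^sub>1 * h\<^sub>2 + h\<^sub>2\<^sup>2 + rate \<le> 0"
  "h\<^sub>2\<^sup>2 * \<sigma>\<^sup>2 + 3 * (h\<^sub>1 * h\<^sub>2) * \<sigma>\<^sup>2 \<le> 3 * \<sigma>\<^sup>2 / L\<^sub>1\<^sup>2"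
proof -
  show L1h1: "L\<^sub>1 * h\<^sub>1 \<le> 1" using h1 L1(1) by (simp add: field_simps)
  have h2L: "h\<^sub>2 \<le> 1 / L\<^sub>1" using h1 h2 by simp
  have "h\<^sub>2 * (2 * h\<^sub>2) \<le> h\<^sub>2 * h\<^sub>1" using h2 by (intro mult_left_mono) auto
  moreover have "h\<^sub>2 * \<rho> \<le> 1 / L\<^sub>1 * \<rho>" using h2L rho by (intro mult_right_mono)
  moreover have "rate = h\<^sub>2 * h\<^sub>2 - 1 / L\<^sub>1 * \<rho>"
    using L1(1) by (simp add: rate_def power2_eq_square diff_divide_distrib)
  ultimately show "h\<^sub>2 * \<rho> - h\<^sub>1 * h\<^sub>2 + h\<^sub>2\<^sup>2 + rate \<le> 0"
    unfolding power2_eq_square by (simp add: algebra_simps)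
  have h2L': "h\<^sub>2 \<le> 1 / (2 * L\<^sub>1)" using h1 h2 by simp
  have "h\<^sub>2 * h\<^sub>2 \<le> (1 / (2 * L\<^sub>1)) * (1 / (2 * L\<^sub>1))" "h\<^sub>1 * h\<^sub>2 \<le> (1 / L\<^sub>1) * (1 / (2 * L\<^sub>1))"
    using h1 h2 L1(1) h2L' by (intro mult_mono; simp)+
  then have "h\<^sub>2\<^sup>2 + 3 * (h\<^sub>1 * h\<^sub>2) \<le> (1 / (2 * L\<^sub>1)) * (1 / (2 * L\<^sub>1)) + 3 * ((1 / L\<^sub>1) * (1 / (2 * L\<^sub>1)))"
    unfolding power2_eq_square by (intro add_mono mult_left_mono) auto
  also have "\<dots> \<le> 3 / L\<^sub>1\<^sup>2" using L1(1) by (simp add: field_simps power2_eq_square)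
  finally have "(h\<^sub>2\<^sup>2 + 3 * (h\<^sub>1 * h\<^sub>2)) * \<sigma>\<^sup>2 \<le> 3 / L\<^sub>1\<^sup>2 * \<sigma>\<^sup>2" by (intro mult_right_mono) auto
  then show "h\<^sub>2\<^sup>2 * \<sigma>\<^sup>2 + 3 * (h\<^sub>1 * h\<^sub>2) * \<sigma>\<^sup>2 \<le> 3 * \<sigma>\<^sup>2 / L\<^sub>1\<^sup>2" by (simp add: algebra_simps)
qed

text \<open>Comparing \<^term>\<open>F\<close> at the stochastic extrapolation point with its value at the deterministic
  one \<^term>\<open>z - h\<^sub>1 *\<^sub>R F z\<close> isolates a noise term that is linear in the oracle error and hence has mean zero.\<close>

lemma extrapolation_inner:
  fixes z v :: "'a \<times> 'b"
  defines "x \<equiv> zoeg_extrapolate f \<mu> h\<^sub>1 z v" and "\<xi> \<equiv> G z v - F z"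
  shows "- 2 * (F x \<bullet> G z v) \<le> 3 * (norm \<xi>)\<^sup>2 - (norm (F x))\<^sup>2 - 2 * ((F (z - h\<^sub>1 *\<^sub>R F z) - F z) \<bullet> \<xi>)"
proof -
  let ?q = "G z v" and ?a = "F x" and ?b = "F z" and ?c = "F (z - h\<^sub>1 *\<^sub>R F z)"
  have Lh: "L\<^sub>1 * norm (h\<^sub>1 *\<^sub>R y) \<le> norm y" for y :: "'a \<times> 'b"
    using mult_right_mono[OF step_sizes(1) norm_ge_zero[of y]] h1(1) by (simp add: mult.assoc)
  have "norm (?a - ?b) \<le> L\<^sub>1 * norm (h\<^sub>1 *\<^sub>R ?q)"
    using F_lipschitz[of x z] by (simp add: x_def zoeg_extrapolate_def)
  also have "\<dots> \<le> norm ?q" by (rule Lh)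
  \<comment> \<open>This cancels the \<open>(norm ?q)\<^sup>2\<close> that appears when
    \<open>?a \<bullet> ?q\<close> is read off from the square of
    \<open>norm (?a - ?q)\<close>.\<close>
  finally have ab: "(norm (?a - ?b))\<^sup>2 \<le> (norm ?q)\<^sup>2" by (intro power_mono) auto
  have "x - (z - h\<^sub>1 *\<^sub>R F z) = - (h\<^sub>1 *\<^sub>R \<xi>)"
    by (simp add: x_def zoeg_extrapolate_def \<xi>_def algebra_simps)
  then have "norm (?a - ?c) \<le> L\<^sub>1 * norm (h\<^sub>1 *\<^sub>R \<xi>)"
    using F_lipschitz[of x "z - h\<^sub>1 *\<^sub>R F z"] by simp
  also have "\<dots> \<le> norm \<xi>" by (rule Lh)
  finally have "norm (?a - ?c) * norm \<xi> \<le> norm \<xi> * norm \<xi>" by (intro mult_right_mono) auto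
  \<comment> \<open>Doubled, this contributes two of the three copies of
    \<open>(norm \<xi>)\<^sup>2\<close>; the third is the square of the noise in
    \<open>?a - ?q = (?a - ?b) - \<xi>\<close>.\<close>
  then have "- ((?a - ?c) \<bullet> \<xi>) \<le> (norm \<xi>)\<^sup>2"
    using Cauchy_Schwarz_ineq2[of "?a - ?c" \<xi>] by (simp add: power2_eq_square abs_le_iff)
  moreover have "(?a - ?b) \<bullet> \<xi> = (?a - ?c) \<bullet> \<xi> + (?c - ?b) \<bullet> \<xi>"
    by (simp add: inner_add_left[symmetric])
  moreover have "(norm (?a - ?q))\<^sup>2 = (norm (?a - ?b))\<^sup>2 - 2 * ((?a - ?b) \<bullet> \<xi>) + (norm \<xi>)\<^sup>2"
    using norm_diff_sq[of "?a - ?b" \<xi>] by (simp add: \<xi>_def)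
  moreover have "(norm (?a - ?q))\<^sup>2 = (norm ?a)\<^sup>2 - 2 * (?a \<bullet> ?q) + (norm ?q)\<^sup>2"
    by (rule norm_diff_sq)
  ultimately show ?thesis using ab by linarith
qed

text \<open>Integrating over the update sample \<open>w\<close> uses \<open>update_bound\<close>,
  the weak Minty inequality at the extrapolated point and \<open>extrapolation_inner\<close>. The
  resulting bound \<open>B v\<close> still contains the extrapolation noise linearly, so it cannot
  be improved pointwise in \<open>v\<close>; that term disappears only on integrating over
  \<open>v\<close>.\<close>

lemma one_step:
  "(\<integral>\<^sup>+v. \<integral>\<^sup>+w. ennreal ((norm (z - h\<^sub>2 *\<^sub>R G (zoeg_extrapolate f \<mu> h\<^sub>1 z v) w - zstar))\<^sup>2
      + rate * (norm (F (zoeg_extrapolate f \<mu> h\<^sub>1 z v)))\<^sup>2) \<partial>std_gaussian \<partial>std_gaussian)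
    \<le> ennreal ((norm (z - zstar))\<^sup>2 + 3 * \<sigma>\<^sup>2 / L\<^sub>1\<^sup>2)"
  if rate: "rate \<ge> 0" for z
proof -
  define X where "X = zoeg_extrapolate f \<mu> h\<^sub>1 z"
  define \<xi> where "\<xi> v = G z v - F z" for v
  define B where "B v = (norm (z - zstar))\<^sup>2 + h\<^sub>2\<^sup>2 * \<sigma>\<^sup>2 + 3 * (h\<^sub>1 * h\<^sub>2) * (norm (\<xi> v))\<^sup>2
    - 2 * (h\<^sub>1 * h\<^sub>2) * ((F (z - h\<^sub>1 *\<^sub>R F z) - F z) \<bullet> \<xi> v)" for v
  have inner: "(\<integral>w. (norm (z - h\<^sub>2 *\<^sub>R G (X v) w - zstar))\<^sup>2 + rate * (norm (F (X v)))\<^sup>2 \<partial>std_gaussian) \<le> B v" for v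
  proof -
    let ?a = "F (X v)" and ?D = "(F (z - h\<^sub>1 *\<^sub>R F z) - F z) \<bullet> \<xi> v"
    have split: "?a \<bullet> (z - zstar) = ?a \<bullet> (X v - zstar) + h\<^sub>1 * (?a \<bullet> G z v)"
      by (simp add: X_def zoeg_extrapolate_def inner_diff_right algebra_simps)
    have "2 * h\<^sub>2 * (- (?a \<bullet> (X v - zstar))) \<le> 2 * h\<^sub>2 * (\<rho> / 2 * (norm ?a)\<^sup>2)"
      using weak_minty[of "X v"] h2(1) by (intro mult_left_mono) auto
    then have minty: "- (2 * h\<^sub>2 * (?a \<bullet> (X v - zstar))) \<le> h\<^sub>2 * \<rho> * (norm ?a)\<^sup>2" by simp
    have extra: "h\<^sub>1 * h\<^sub>2 * (- 2 * (?a \<bullet> G z v)) \<le> h\<^sub>1 * h\<^sub>2 * (3 * (norm (\<xi> v))\<^sup>2 - (norm ?a)\<^sup>2 - 2 * ?D)"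
      using extrapolation_inner[of z v] h1(1) h2(1) unfolding X_def \<xi>_def by (intro mult_left_mono) auto
    have neg: "(h\<^sub>2 * \<rho> - h\<^sub>1 * h\<^sub>2 + h\<^sub>2\<^sup>2 + rate) * (norm ?a)\<^sup>2 \<le> 0"
      using step_sizes(2) by (intro mult_nonpos_nonneg) auto
    have "(\<integral>w. (norm (z - h\<^sub>2 *\<^sub>R G (X v) w - zstar))\<^sup>2 + rate * (norm ?a)\<^sup>2 \<partial>std_gaussian)
        = (\<integral>w. (norm (z - h\<^sub>2 *\<^sub>R G (X v) w - zstar))\<^sup>2 \<partial>std_gaussian) + rate * (norm ?a)\<^sup>2"
      using update_bound(1) by (simp add: gauss.prob_space[unfolded space_std_gaussian])
    also have "\<dots> \<le> (norm (z - zstar))\<^sup>2 - 2 * h\<^sub>2 * (?a \<bullet> (z - zstar)) + h\<^sub>2\<^sup>2 * ((norm ?a)\<^sup>2 + \<sigma>\<^sup>2) + rate * (norm ?a)\<^sup>2"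
      using update_bound(2)[of z "X v"] by simp
    also have "\<dots> \<le> B v"
      using minty extra neg unfolding split B_def by (simp add: algebra_simps)
    finally show ?thesis .
  qed
  \<comment> \<open>\<open>ennreal\<close> sends negative numbers to zero, so the linear noise term
    can cancel only if \<open>B v\<close> is known to be nonnegative. It dominates the integral of a
    nonnegative function.\<close>
  have Bnn: "0 \<le> B v" for v
    by (rule order_trans[OF _ inner]) (intro Bochner_Integration.integral_nonneg add_nonneg_nonneg mult_nonneg_nonneg rate zero_le_power2)
  have i0: "integrable std_gaussian \<xi>"
    unfolding \<xi>_def using G_oracle_integrable[OF lip \<mu>, of z] by auto
  have i2: "integrable std_gaussian (\<lambda>v. (norm (\<xi> v))\<^sup>2)"
    unfolding \<xi>_def by (rule G_oracle_sq_integrable[OF lip \<mu>])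
  have i1: "integrable std_gaussian (\<lambda>v. (F (z - h\<^sub>1 *\<^sub>R F z) - F z) \<bullet> \<xi> v)"
    by (rule integrable_inner_right[OF i0])
  have zero: "(\<integral>v. (F (z - h\<^sub>1 *\<^sub>R F z) - F z) \<bullet> \<xi> v \<partial>std_gaussian) = 0"
  proof -
    have "(\<integral>v. (F (z - h\<^sub>1 *\<^sub>R F z) - F z) \<bullet> \<xi> v \<partial>std_gaussian) = (F (z - h\<^sub>1 *\<^sub>R F z) - F z) \<bullet> (\<integral>v. \<xi> v \<partial>std_gaussian)"
      by (rule integral_inner_right[OF i0])
    also have "(\<integral>v. \<xi> v \<partial>std_gaussian) = 0"
      unfolding \<xi>_def using G_oracle_integrable[OF lip \<mu>, of z]
      by (simp add: integral_G_oracle[OF lip \<mu>] gauss.prob_space[unfolded space_std_gaussian])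
    finally show ?thesis by simp
  qed
  have "(\<integral>\<^sup>+w. ennreal ((norm (z - h\<^sub>2 *\<^sub>R G (X v) w - zstar))\<^sup>2 + rate * (norm (F (X v)))\<^sup>2) \<partial>std_gaussian) \<le> ennreal (B v)" for v
  proof -
    have "(\<integral>\<^sup>+w. ennreal ((norm (z - h\<^sub>2 *\<^sub>R G (X v) w - zstar))\<^sup>2 + rate * (norm (F (X v)))\<^sup>2) \<partial>std_gaussian)
        = ennreal (\<integral>w. (norm (z - h\<^sub>2 *\<^sub>R G (X v) w - zstar))\<^sup>2 + rate * (norm (F (X v)))\<^sup>2 \<partial>std_gaussian)"
      using update_bound(1) rate by (intro nn_integral_eq_integral) auto
    also have "\<dots> \<le> ennreal (B v)" by (intro ennreal_leI inner)
    finally show ?thesis .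
  qed
  then have "(\<integral>\<^sup>+v. \<integral>\<^sup>+w. ennreal ((norm (z - h\<^sub>2 *\<^sub>R G (X v) w - zstar))\<^sup>2 + rate * (norm (F (X v)))\<^sup>2) \<partial>std_gaussian \<partial>std_gaussian)
      \<le> (\<integral>\<^sup>+v. ennreal (B v) \<partial>std_gaussian)" by (intro nn_integral_mono)
  also have "\<dots> = ennreal (\<integral>v. B v \<partial>std_gaussian)"
  proof (rule nn_integral_eq_integral)
    show "integrable std_gaussian B" unfolding B_def using i1 i2 by auto
  qed (use Bnn in auto)
  finally have le: "(\<integral>\<^sup>+v. \<integral>\<^sup>+w. ennreal ((norm (z - h\<^sub>2 *\<^sub>R G (X v) w - zstar))\<^sup>2 + rate * (norm (F (X v)))\<^sup>2) \<partial>std_gaussian \<partial>std_gaussian)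
      \<le> ennreal (\<integral>v. B v \<partial>std_gaussian)" .
  have "(\<integral>v. B v \<partial>std_gaussian) = (norm (z - zstar))\<^sup>2 + h\<^sub>2\<^sup>2 * \<sigma>\<^sup>2 + 3 * (h\<^sub>1 * h\<^sub>2) * (\<integral>v. (norm (\<xi> v))\<^sup>2 \<partial>std_gaussian)"
    unfolding B_def using i1 i2 by (simp add: zero gauss.prob_space[unfolded space_std_gaussian])
  also have "\<dots> \<le> (norm (z - zstar))\<^sup>2 + h\<^sub>2\<^sup>2 * \<sigma>\<^sup>2 + 3 * (h\<^sub>1 * h\<^sub>2) * \<sigma>\<^sup>2"
    using variance[of z] h1(1) h2(1) by (intro add_left_mono mult_left_mono) (auto simp: \<xi>_def)
  also have "\<dots> \<le> (norm (z - zstar))\<^sup>2 + 3 * \<sigma>\<^sup>2 / L\<^sub>1\<^sup>2" using step_sizes(3) by simp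
  finally show ?thesis using le unfolding X_def by (meson ennreal_leI order_trans)
qed

end

section \<open>The random iterates and their expectations\<close>

locale zoeg_process = zoeg f L\<^sub>0 \<mu> L\<^sub>1 \<sigma> \<rho> h\<^sub>1 h\<^sub>2 zstar + P: prob_space M
  for f :: "'a::euclidean_space \<times> 'b::euclidean_space \<Rightarrow> real"
    and L\<^sub>0 \<mu> L\<^sub>1 \<sigma> \<rho> h\<^sub>1 h\<^sub>2 zstar and M :: "'w measure" +
  fixes u uhat :: "nat \<Rightarrow> 'w \<Rightarrow> 'a \<times> 'b" and z\<^sub>0 :: "'a \<times> 'b" and N :: nat
  assumes gaussian: "\<And>k. k \<le> N \<Longrightarrow> distr M borel (uhat k) = std_gaussian"
      "\<And>k. k \<le> N \<Longrightarrow> distr M borel (u k) = std_gaussian"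
    and indep: "P.indep_vars (\<lambda>_. borel) (case_sum uhat u) ({..N} <+> {..N})"
begin

abbreviation "Z k \<omega> \<equiv> zoeg_z f \<mu> h\<^sub>1 h\<^sub>2 z\<^sub>0 (\<lambda>j. uhat j \<omega>) (\<lambda>j. u j \<omega>) k"
abbreviation "Zhat k \<omega> \<equiv> zoeg_zhat f \<mu> h\<^sub>1 h\<^sub>2 z\<^sub>0 (\<lambda>j. uhat j \<omega>) (\<lambda>j. u j \<omega>) k"

text \<open>\<open>Inl\<close> marks extrapolation samples and \<open>Inr\<close> update samples.
  These are the indices on which the iterate \<open>Z k\<close> depends; they avoid the fresh pair
  \<open>Inl k\<close>, \<open>Inr k\<close>.\<close>

abbreviation past :: "nat \<Rightarrow> (nat + nat) set" where "past k \<equiv> {..<k} <+> {..<k}"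

lemma zoeg_z_cong:
  assumes "\<And>j. j < k \<Longrightarrow> v j = v' j" "\<And>j. j < k \<Longrightarrow> w j = w' j"
  shows "zoeg_z f \<mu> h\<^sub>1 h\<^sub>2 z\<^sub>0 v w k = zoeg_z f \<mu> h\<^sub>1 h\<^sub>2 z\<^sub>0 v' w' k"
  using assms by (induction k) auto

lemma zoeg_z_measurable:
  assumes "past k \<subseteq> A"
  shows "(\<lambda>x. zoeg_z f \<mu> h\<^sub>1 h\<^sub>2 z\<^sub>0 (\<lambda>j. x (Inl j)) (\<lambda>j. x (Inr j)) k) \<in> PiM A (\<lambda>_. borel) \<rightarrow>\<^sub>M borel"
  using assms
proof (induction k)
  case (Suc k)
  have "past k \<subseteq> A" and k: "Inl k \<in> A" "Inr k \<in> A" using Suc.prems by auto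
  note [measurable] = Suc.IH[OF this(1)] measurable_component_singleton[OF k(1), of "\<lambda>_. borel"]
    measurable_component_singleton[OF k(2), of "\<lambda>_. borel"]
  show ?case by simp
qed simp

lemma u_measurable [measurable]: "k \<le> N \<Longrightarrow> uhat k \<in> borel_measurable M" "k \<le> N \<Longrightarrow> u k \<in> borel_measurable M"
proof -
  have "P.random_variable borel (case_sum uhat u i)" if "i \<in> {..N} <+> {..N}" for i
    using indep that unfolding P.indep_vars_def by blast
  from this[of "Inl k"] this[of "Inr k"]
  show "k \<le> N \<Longrightarrow> uhat k \<in> borel_measurable M" "k \<le> N \<Longrightarrow> u k \<in> borel_measurable M" by auto
qed

text \<open>Factoring the iterate through a restriction to finitely many coordinates makes
  independence of disjoint blocks of samples applicable to it.\<close>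

lemma Z_eq: "Z k \<omega> = (\<lambda>x. zoeg_z f \<mu> h\<^sub>1 h\<^sub>2 z\<^sub>0 (\<lambda>j. x (Inl j)) (\<lambda>j. x (Inr j)) k)
    (restrict (\<lambda>i. case_sum uhat u i \<omega>) (past k))"
  by (rule zoeg_z_cong) auto

lemma Z_measurable [measurable]: "k \<le> Suc N \<Longrightarrow> Z k \<in> borel_measurable M"
proof -
  assume k: "k \<le> Suc N"
  have "(\<lambda>\<omega>. restrict (\<lambda>i. case_sum uhat u i \<omega>) (past k)) \<in> M \<rightarrow>\<^sub>M PiM (past k) (\<lambda>_. borel)"
    using k by (intro measurable_restrict) (auto split: sum.split)
  from measurable_compose[OF this zoeg_z_measurable[OF order_refl]] show ?thesis
    unfolding Z_eq .
qed

lemma Zhat_measurable [measurable]: "k \<le> N \<Longrightarrow> Zhat k \<in> borel_measurable M"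
  unfolding zoeg_zhat_def by measurable

text \<open>The iterate is a Borel function of the block \<open>past k\<close>, and the fresh
  samples form a disjoint block, so the two are independent. Within the fresh block, independence of
  the two singletons gives the product of Gaussians.\<close>

lemma joint_distribution:
  assumes k: "k \<le> N"
  shows "distr M (borel \<Otimes>\<^sub>M (borel \<Otimes>\<^sub>M borel)) (\<lambda>\<omega>. (Z k \<omega>, uhat k \<omega>, u k \<omega>))
    = distr M borel (Z k) \<Otimes>\<^sub>M (std_gaussian \<Otimes>\<^sub>M std_gaussian)"
proof -
  have "P.indep_var (PiM {Inl k} (\<lambda>_. borel)) (\<lambda>\<omega>. restrict (\<lambda>i. case_sum uhat u i \<omega>) {Inl k})
      (PiM {Inr k} (\<lambda>_. borel)) (\<lambda>\<omega>. restrict (\<lambda>i. case_sum uhat u i \<omega>) {Inr k})"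
    using k by (intro P.indep_var_restrict[OF indep]) auto
  from P.indep_var_compose[OF this measurable_component_singleton measurable_component_singleton, of "Inl k" "Inr k"]
  have "P.indep_var borel (uhat k) borel (u k)" by (simp add: comp_def)
  then have 1: "distr M (borel \<Otimes>\<^sub>M borel) (\<lambda>\<omega>. (uhat k \<omega>, u k \<omega>)) = std_gaussian \<Otimes>\<^sub>M std_gaussian"
    unfolding P.indep_var_distribution_eq using gaussian[OF k] by simp
  let ?A = "PiM (past k) (\<lambda>_. borel) :: (nat + nat \<Rightarrow> 'a \<times> 'b) measure"
    and ?B = "PiM {Inl k, Inr k} (\<lambda>_. borel) :: (nat + nat \<Rightarrow> 'a \<times> 'b) measure"
  let ?X = "\<lambda>\<omega>. restrict (\<lambda>i. case_sum uhat u i \<omega>) (past k)"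
    and ?Y = "\<lambda>\<omega>. restrict (\<lambda>i. case_sum uhat u i \<omega>) {Inl k, Inr k}"
  let ?\<phi> = "\<lambda>x. zoeg_z f \<mu> h\<^sub>1 h\<^sub>2 z\<^sub>0 (\<lambda>j. x (Inl j)) (\<lambda>j. x (Inr j)) k"
    and ?\<psi> = "\<lambda>x::nat + nat \<Rightarrow> 'a \<times> 'b. (x (Inl k), x (Inr k))"
  have "P.indep_var ?A ?X ?B ?Y"
    using k by (intro P.indep_var_restrict[OF indep]) auto
  then have X[measurable]: "?X \<in> M \<rightarrow>\<^sub>M ?A" and Y[measurable]: "?Y \<in> M \<rightarrow>\<^sub>M ?B"
    and XY: "distr M ?A ?X \<Otimes>\<^sub>M distr M ?B ?Y = distr M (?A \<Otimes>\<^sub>M ?B) (\<lambda>\<omega>. (?X \<omega>, ?Y \<omega>))"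
    unfolding P.indep_var_distribution_eq by auto
  have \<phi>[measurable]: "?\<phi> \<in> ?A \<rightarrow>\<^sub>M borel" by (rule zoeg_z_measurable) simp
  have \<psi>[measurable]: "?\<psi> \<in> ?B \<rightarrow>\<^sub>M borel \<Otimes>\<^sub>M borel"
    by (intro measurable_Pair measurable_component_singleton) auto
  have dZ: "distr (distr M ?A ?X) borel ?\<phi> = distr M borel (Z k)"
    unfolding distr_distr[OF \<phi> X] comp_def Z_eq[symmetric] ..
  have dU: "distr (distr M ?B ?Y) (borel \<Otimes>\<^sub>M borel) ?\<psi> = std_gaussian \<Otimes>\<^sub>M std_gaussian"
    unfolding distr_distr[OF \<psi> Y] comp_def 1[symmetric] by simp
  have "distr M borel (Z k) \<Otimes>\<^sub>M (std_gaussian \<Otimes>\<^sub>M std_gaussian)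
      = distr (distr M ?A ?X) borel ?\<phi> \<Otimes>\<^sub>M distr (distr M ?B ?Y) (borel \<Otimes>\<^sub>M borel) ?\<psi>"
    by (simp only: dZ dU)
  also have "\<dots> = distr (distr M ?A ?X \<Otimes>\<^sub>M distr M ?B ?Y) (borel \<Otimes>\<^sub>M (borel \<Otimes>\<^sub>M borel)) (\<lambda>(x, y). (?\<phi> x, ?\<psi> y))"
  proof (rule pair_measure_distr)
    interpret D: prob_space "distr (distr M ?B ?Y) (borel \<Otimes>\<^sub>M borel) ?\<psi>"
      by (intro prob_space.prob_space_distr P.prob_space_distr) auto
    show "sigma_finite_measure (distr (distr M ?B ?Y) (borel \<Otimes>\<^sub>M borel) ?\<psi>)" ..
  qed auto
  also have "\<dots> = distr M (borel \<Otimes>\<^sub>M (borel \<Otimes>\<^sub>M borel)) ((\<lambda>(x, y). (?\<phi> x, ?\<psi> y)) \<circ> (\<lambda>\<omega>. (?X \<omega>, ?Y \<omega>)))"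
    unfolding XY by (rule distr_distr) measurable
  also have "((\<lambda>(x, y). (?\<phi> x, ?\<psi> y)) \<circ> (\<lambda>\<omega>. (?X \<omega>, ?Y \<omega>))) = (\<lambda>\<omega>. (Z k \<omega>, uhat k \<omega>, u k \<omega>))"
    unfolding Z_eq by (simp add: fun_eq_iff)
  finally show ?thesis ..
qed

text \<open>This takes the place of conditioning on the past: the iterate is frozen while the two
  fresh samples are integrated out, so a bound valid for each fixed starting point transfers to the
  random iterate.\<close>

lemma nn_integral_step:
  assumes k: "k \<le> N" and H[measurable]: "(\<lambda>(z, v, w). H z v w) \<in> borel_measurable (borel \<Otimes>\<^sub>M (borel \<Otimes>\<^sub>M borel))"
  shows "(\<integral>\<^sup>+\<omega>. H (Z k \<omega>) (uhat k \<omega>) (u k \<omega>) \<partial>M)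
    = (\<integral>\<^sup>+\<omega>. (\<integral>\<^sup>+v. \<integral>\<^sup>+w. H (Z k \<omega>) v w \<partial>std_gaussian \<partial>std_gaussian) \<partial>M)"
proof -
  let ?H = "\<lambda>(z, v, w). H z v w"
  note [measurable] = u_measurable[OF k] Z_measurable[of k, simplified le_SucI[OF k]]
  interpret GG: pair_prob_space "std_gaussian :: ('a \<times> 'b) measure" "std_gaussian :: ('a \<times> 'b) measure" ..
  have Hm: "?H \<in> borel_measurable (distr M borel (Z k) \<Otimes>\<^sub>M (std_gaussian \<Otimes>\<^sub>M std_gaussian))"
    using H by (simp cong: measurable_cong_sets sets_pair_measure_cong)
  have Hz: "(\<lambda>(v, w). H z v w) \<in> borel_measurable (std_gaussian \<Otimes>\<^sub>M std_gaussian)" for z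
  proof -
    have "(\<lambda>p. ?H (z, p)) \<in> borel_measurable (borel \<Otimes>\<^sub>M borel)"
      by (rule measurable_compose[OF measurable_Pair1' H]) simp
    then show ?thesis by (simp add: case_prod_unfold cong: measurable_cong_sets sets_pair_measure_cong)
  qed
  have "(\<integral>\<^sup>+\<omega>. H (Z k \<omega>) (uhat k \<omega>) (u k \<omega>) \<partial>M)
      = (\<integral>\<^sup>+p. ?H p \<partial>distr M (borel \<Otimes>\<^sub>M (borel \<Otimes>\<^sub>M borel)) (\<lambda>\<omega>. (Z k \<omega>, uhat k \<omega>, u k \<omega>)))"
    by (subst nn_integral_distr) auto
  also have "\<dots> = (\<integral>\<^sup>+z. \<integral>\<^sup>+q. ?H (z, q) \<partial>(std_gaussian \<Otimes>\<^sub>M std_gaussian) \<partial>distr M borel (Z k))"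
    unfolding joint_distribution[OF k] by (rule GG.P.nn_integral_fst[symmetric, OF Hm])
  also have "\<dots> = (\<integral>\<^sup>+\<omega>. \<integral>\<^sup>+q. ?H (Z k \<omega>, q) \<partial>(std_gaussian \<Otimes>\<^sub>M std_gaussian) \<partial>M)"
    using GG.P.borel_measurable_nn_integral_fst[OF Hm] by (subst nn_integral_distr) auto
  also have "\<dots> = (\<integral>\<^sup>+\<omega>. (\<integral>\<^sup>+v. \<integral>\<^sup>+w. H (Z k \<omega>) v w \<partial>std_gaussian \<partial>std_gaussian) \<partial>M)"
    using gauss.nn_integral_fst[OF Hz] by simp
  finally show ?thesis .
qed

lemma one_step_expectation:
  assumes k: "k \<le> N" and rate: "rate \<ge> 0"
  shows "(\<integral>\<^sup>+\<omega>. ennreal ((norm (Z (Suc k) \<omega> - zstar))\<^sup>2) \<partial>M) + ennreal rate * (\<integral>\<^sup>+\<omega>. ennreal ((norm (F (Zhat k \<omega>)))\<^sup>2) \<partial>M)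
    \<le> (\<integral>\<^sup>+\<omega>. ennreal ((norm (Z k \<omega> - zstar))\<^sup>2) \<partial>M) + ennreal (3 * \<sigma>\<^sup>2 / L\<^sub>1\<^sup>2)"
proof -
  note [measurable] = u_measurable[OF k] Z_measurable[of k, simplified le_SucI[OF k]] Z_measurable[of "Suc k", simplified k] Zhat_measurable[OF k]
  let ?H = "\<lambda>z v w. ennreal ((norm (z - h\<^sub>2 *\<^sub>R G (zoeg_extrapolate f \<mu> h\<^sub>1 z v) w - zstar))\<^sup>2
      + rate * (norm (F (zoeg_extrapolate f \<mu> h\<^sub>1 z v)))\<^sup>2)"
  have "(\<integral>\<^sup>+\<omega>. ennreal ((norm (Z (Suc k) \<omega> - zstar))\<^sup>2) \<partial>M) + ennreal rate * (\<integral>\<^sup>+\<omega>. ennreal ((norm (F (Zhat k \<omega>)))\<^sup>2) \<partial>M)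
      = (\<integral>\<^sup>+\<omega>. ennreal ((norm (Z (Suc k) \<omega> - zstar))\<^sup>2) + ennreal rate * ennreal ((norm (F (Zhat k \<omega>)))\<^sup>2) \<partial>M)"
    by (subst nn_integral_add) (auto simp: nn_integral_cmult)
  also have "\<dots> = (\<integral>\<^sup>+\<omega>. ?H (Z k \<omega>) (uhat k \<omega>) (u k \<omega>) \<partial>M)"
    using rate by (intro nn_integral_cong) (simp add: zoeg_zhat_def ennreal_mult)
  also have "\<dots> = (\<integral>\<^sup>+\<omega>. (\<integral>\<^sup>+v. \<integral>\<^sup>+w. ?H (Z k \<omega>) v w \<partial>std_gaussian \<partial>std_gaussian) \<partial>M)"
    by (rule nn_integral_step[OF k]) measurable
  also have "\<dots> \<le> (\<integral>\<^sup>+\<omega>. ennreal ((norm (Z k \<omega> - zstar))\<^sup>2 + 3 * \<sigma>\<^sup>2 / L\<^sub>1\<^sup>2) \<partial>M)"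
    by (intro nn_integral_mono one_step[OF rate])
  also have "\<dots> = (\<integral>\<^sup>+\<omega>. ennreal ((norm (Z k \<omega> - zstar))\<^sup>2) \<partial>M) + ennreal (3 * \<sigma>\<^sup>2 / L\<^sub>1\<^sup>2)"
    by (simp add: nn_integral_add P.emeasure_space_1)
  finally show ?thesis .
qed

lemma exists_small_gradient:
  assumes rate: "rate > 0"
  shows "\<exists>k\<le>N. integrable M (\<lambda>\<omega>. (norm (F (Zhat k \<omega>)))\<^sup>2) \<and>
    rate * (\<integral>\<omega>. (norm (F (Zhat k \<omega>)))\<^sup>2 \<partial>M) \<le> (norm (z\<^sub>0 - zstar))\<^sup>2 / real (N + 1) + 3 * \<sigma>\<^sup>2 / L\<^sub>1\<^sup>2"
proof -
  define R where "R k = (\<integral>\<^sup>+\<omega>. ennreal ((norm (Z k \<omega> - zstar))\<^sup>2) \<partial>M)" for k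
  define Q where "Q k = (\<integral>\<^sup>+\<omega>. ennreal ((norm (F (Zhat k \<omega>)))\<^sup>2) \<partial>M)" for k
  define C where "C = 3 * \<sigma>\<^sup>2 / L\<^sub>1\<^sup>2"
  define r where "r = (norm (z\<^sub>0 - zstar))\<^sup>2"
  have C: "C \<ge> 0" by (simp add: C_def)
  have step: "R (Suc k) + ennreal rate * Q k \<le> R k + ennreal C" if "k \<le> N" for k
    using one_step_expectation[OF that] rate by (simp add: R_def Q_def C_def)
  have R0: "R 0 = ennreal r" by (simp add: R_def r_def P.emeasure_space_1)
  have tele: "R n + (\<Sum>k<n. ennreal rate * Q k) \<le> ennreal (r + real n * C)" if "n \<le> Suc N" for n
    using that
  proof (induction n)
    case (Suc n)
    have "R (Suc n) + (\<Sum>k<Suc n. ennreal rate * Q k) = (R (Suc n) + ennreal rate * Q n) + (\<Sum>k<n. ennreal rate * Q k)"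
      by (simp add: ac_simps)
    also have "\<dots> \<le> (R n + ennreal C) + (\<Sum>k<n. ennreal rate * Q k)"
      using Suc.prems by (intro add_right_mono step) simp
    also have "\<dots> = (R n + (\<Sum>k<n. ennreal rate * Q k)) + ennreal C" by (simp add: ac_simps)
    also have "\<dots> \<le> ennreal (r + real n * C) + ennreal C"
      using Suc by (intro add_right_mono) simp
    also have "\<dots> = ennreal (r + real (Suc n) * C)"
      using C by (simp add: ennreal_plus[symmetric] r_def algebra_simps del: ennreal_plus)
    finally show ?case .
  qed (simp add: R0)
  have sum: "(\<Sum>k<Suc N. ennreal rate * Q k) \<le> ennreal (r + real (N + 1) * C)"
  proof -
    have "(\<Sum>k<Suc N. ennreal rate * Q k) \<le> R (Suc N) + (\<Sum>k<Suc N. ennreal rate * Q k)"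
      by (rule add_increasing) simp_all
    also have "\<dots> \<le> ennreal (r + real (Suc N) * C)" by (rule tele) simp
    finally show ?thesis by (simp only: Suc_eq_plus1)
  qed
  \<comment> \<open>Since \<open>rate\<close> is positive and the telescoped sum is finite, each
    single second moment is finite. Only from here on can real-valued integrals be used.\<close>
  have Qfin: "Q k < \<infinity>" if "k \<le> N" for k
  proof -
    have "ennreal rate * Q k \<le> (\<Sum>k<Suc N. ennreal rate * Q k)"
      using that by (intro member_le_sum) auto
    also note sum
    finally have "ennreal rate * Q k < \<infinity>" by (simp add: le_less_trans)
    then show ?thesis using rate by (auto simp: ennreal_mult_less_top ennreal_eq_0_iff)
  qed
  have int: "integrable M (\<lambda>\<omega>. (norm (F (Zhat k \<omega>)))\<^sup>2)" if k: "k \<le> N" for k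
  proof (rule integrableI_nonneg)
    note [measurable] = Zhat_measurable[OF k]
    show "(\<lambda>\<omega>. (norm (F (Zhat k \<omega>)))\<^sup>2) \<in> borel_measurable M" by measurable
  qed (use Qfin[OF k] in \<open>auto simp: Q_def\<close>)
  define q where "q k = (\<integral>\<omega>. (norm (F (Zhat k \<omega>)))\<^sup>2 \<partial>M)" for k
  have Qq: "Q k = ennreal (q k)" "0 \<le> q k" if "k \<le> N" for k
    unfolding Q_def q_def using int[OF that] by (auto intro: nn_integral_eq_integral)
  have "(\<Sum>k<Suc N. ennreal rate * Q k) = (\<Sum>k<Suc N. ennreal (rate * q k))"
    using Qq rate by (intro sum.cong) (auto simp: ennreal_mult)
  also have "\<dots> = ennreal (\<Sum>k<Suc N. rate * q k)"
    using Qq rate by (intro sum_ennreal) auto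
  finally have "ennreal (\<Sum>k<Suc N. rate * q k) \<le> ennreal (r + real (N + 1) * C)"
    using sum by (simp only:)
  moreover have "0 \<le> r + real (N + 1) * C" using C by (simp add: r_def)
  ultimately have sumq: "(\<Sum>k<Suc N. rate * q k) \<le> r + real (N + 1) * C"
    by (simp only: ennreal_le_iff)
  \<comment> \<open>An average over the \<open>N + 1\<close> indices: if every term exceeded the
    mean bound, so would the sum.\<close>
  have "\<exists>k<Suc N. rate * q k \<le> r / real (N + 1) + C"
  proof (rule ccontr)
    assume "\<not> ?thesis"
    then have "(\<Sum>k<Suc N. r / real (N + 1) + C) < (\<Sum>k<Suc N. rate * q k)"
      by (intro sum_strict_mono) (auto simp: not_le)
    also note sumq
    finally show False by (simp add: field_simps del: sum.lessThan_Suc)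
  qed
  then show ?thesis using int by (auto simp: q_def r_def C_def less_Suc_eq_le)
qed

lemma expectation_goldstein_min_norm:
  fixes \<epsilon> \<delta> :: real
  assumes rate: "rate > 0" and \<delta>: "\<delta> > 0" and \<epsilon>: "\<epsilon> > 0" and L0: "L\<^sub>0 > 0" and \<sigma>: "\<sigma> \<ge> 0"
    and \<mu>\<epsilon>: "\<mu> \<le> \<delta> / sqrt (real DIM('a \<times> 'b) * pi * exp 1) * (\<epsilon> / (8 * L\<^sub>0)) powr (1 / real DIM('a \<times> 'b))"
    and N: "8 * (norm (z\<^sub>0 - zstar))\<^sup>2 \<le> real (N + 1) * rate * \<epsilon>\<^sup>2"
  shows "\<exists>k\<le>N. integrable M (\<lambda>\<omega>. goldstein_min_norm f \<delta> (Zhat k \<omega>)) \<and>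
    P.expectation (\<lambda>\<omega>. goldstein_min_norm f \<delta> (Zhat k \<omega>)) \<le> \<epsilon> + sqrt (3 / (L\<^sub>1\<^sup>2 * rate)) * \<sigma>"
proof -
  obtain k where k: "k \<le> N" and int: "integrable M (\<lambda>\<omega>. (norm (F (Zhat k \<omega>)))\<^sup>2)"
    and q: "rate * (\<integral>\<omega>. (norm (F (Zhat k \<omega>)))\<^sup>2 \<partial>M) \<le> (norm (z\<^sub>0 - zstar))\<^sup>2 / real (N + 1) + 3 * \<sigma>\<^sup>2 / L\<^sub>1\<^sup>2"
    using exists_small_gradient[OF rate] by blast
  note [measurable] = Zhat_measurable[OF k] goldstein_min_norm_measurable[OF lip \<delta>]
  define s where "s = sqrt (3 / (L\<^sub>1\<^sup>2 * rate))"
  have s: "s \<ge> 0" "s\<^sup>2 = 3 / (L\<^sub>1\<^sup>2 * rate)" using rate by (auto simp: s_def)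
  have "8 * (norm (z\<^sub>0 - zstar))\<^sup>2 / real (N + 1) \<le> rate * \<epsilon>\<^sup>2"
    using N by (simp add: pos_divide_le_eq mult_ac del: of_nat_Suc of_nat_add)
  moreover have "3 * \<sigma>\<^sup>2 / L\<^sub>1\<^sup>2 = rate * (s\<^sup>2 * \<sigma>\<^sup>2)" using rate L1(1) by (simp add: s(2) field_simps)
  ultimately have "rate * (\<integral>\<omega>. (norm (F (Zhat k \<omega>)))\<^sup>2 \<partial>M) \<le> rate * (\<epsilon>\<^sup>2 / 8 + s\<^sup>2 * \<sigma>\<^sup>2)"
    using q by (simp add: distrib_left)
  then have q': "(\<integral>\<omega>. (norm (F (Zhat k \<omega>)))\<^sup>2 \<partial>M) \<le> \<epsilon>\<^sup>2 / 8 + s\<^sup>2 * \<sigma>\<^sup>2"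
    using rate by simp
  have int1: "integrable M (\<lambda>\<omega>. norm (F (Zhat k \<omega>)))"
    by (rule P.square_integrable_imp_integrable[OF _ int]) measurable
  \<comment> \<open>Nonnegative variance serves as Jensen's inequality, passing from the second
    moment of the gradient norm to its mean.\<close>
  have "0 \<le> P.variance (\<lambda>\<omega>. norm (F (Zhat k \<omega>)))" by (rule P.variance_positive)
  also have "\<dots> = (\<integral>\<omega>. (norm (F (Zhat k \<omega>)))\<^sup>2 \<partial>M) - (\<integral>\<omega>. norm (F (Zhat k \<omega>)) \<partial>M)\<^sup>2"
    by (rule P.variance_eq[OF int1 int])
  finally have "(\<integral>\<omega>. norm (F (Zhat k \<omega>)) \<partial>M)\<^sup>2 \<le> \<epsilon>\<^sup>2 / 8 + s\<^sup>2 * \<sigma>\<^sup>2" using q' by simp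
  \<comment> \<open>The mixed term of the square is nonnegative and
    \<open>1 / 8 \<le> 1 / 4\<close>. With the \<open>\<epsilon> / 4\<close> lost in passing from
    the smoothed gradient to the least norm, the total stays below
    \<open>\<epsilon>\<close>.\<close>
  also have "\<dots> \<le> (\<epsilon> / 2 + s * \<sigma>)\<^sup>2"
    using \<epsilon> s(1) \<sigma> by (simp add: power2_sum power_mult_distrib power_divide)
  finally have EF: "(\<integral>\<omega>. norm (F (Zhat k \<omega>)) \<partial>M) \<le> \<epsilon> / 2 + s * \<sigma>"
    by (rule power2_le_imp_le) (use \<epsilon> s(1) \<sigma> in simp)
  \<comment> \<open>The 8 in the hypothesis on \<open>\<mu>\<close> is chosen so that the right-hand
    side equals \<open>\<epsilon> / 4\<close>.\<close>
  have tail: "2 * L\<^sub>0 * measure std_gaussian {u::'a \<times> 'b. \<delta> / \<mu> \<le> norm u} \<le> 2 * L\<^sub>0 * (\<epsilon> / (8 * L\<^sub>0))"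
    using L0 \<epsilon> by (intro mult_left_mono std_gaussian_smoothing_tail[OF \<mu> \<mu>\<epsilon>]) auto
  have le: "goldstein_min_norm f \<delta> z \<le> norm (F z) + \<epsilon> / 4" for z
    using goldstein_min_norm_le_smoothing[OF lip \<delta> \<mu> gaussian_smoothing_grad[OF lip \<mu>], of z] tail L0
    by (simp add: norm_F_smooth[OF lip \<mu>])
  have intm: "integrable M (\<lambda>\<omega>. goldstein_min_norm f \<delta> (Zhat k \<omega>))"
    by (rule P.integrable_const_bound[of _ L\<^sub>0]) (use goldstein_min_norm_bounds[OF lip \<delta>] in auto)
  have "(\<integral>\<omega>. goldstein_min_norm f \<delta> (Zhat k \<omega>) \<partial>M) \<le> (\<integral>\<omega>. norm (F (Zhat k \<omega>)) + \<epsilon> / 4 \<partial>M)"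
    using intm int1 le by (intro integral_mono) auto
  also have "\<dots> = (\<integral>\<omega>. norm (F (Zhat k \<omega>)) \<partial>M) + \<epsilon> / 4"
    using int1 by (simp add: P.prob_space)
  also have "\<dots> \<le> \<epsilon> + s * \<sigma>" using EF \<epsilon> by simp
  finally show ?thesis using k intm unfolding s_def by blast
qed

end

theorem corollary11:
  fixes f :: "(real ^ 'n) \<times> (real ^ 'm) \<Rightarrow> real"
    and M :: "'w measure"
    and u uhat :: "nat \<Rightarrow> 'w \<Rightarrow> (real ^ 'n) \<times> (real ^ 'm)"
    and z\<^sub>0 zstar :: "(real ^ 'n) \<times> (real ^ 'm)"
    and L\<^sub>0 L\<^sub>1 \<delta> \<gamma> \<mu> \<sigma> \<rho> h\<^sub>1 h\<^sub>2 r\<^sub>0 \<epsilon> :: real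
    and N d :: nat
  assumes d: "d = CARD('n) + CARD('m)"
    and L0: "L\<^sub>0 > 0" "L\<^sub>0-lipschitz_on UNIV f"
    and delta: "0 < \<delta>" "\<delta> < 1"
    and gamma: "0 < \<gamma>" "\<gamma> \<le> min (5 * L\<^sub>0) 1"
    and mu: "\<mu> > 0" "\<mu> \<le> \<delta> / sqrt (real d * pi * exp 1) * (\<gamma> / (4 * L\<^sub>0)) powr (1 / real d)"
    and L1: "L\<^sub>1 > 0" "L\<^sub>1-lipschitz_on UNIV (grad (gaussian_smoothing f \<mu>))"
    and sigma: "\<sigma> \<ge> 0"
      "\<And>z. (\<integral>v. (norm (G_oracle f \<mu> z v - F_smooth f \<mu> z))\<^sup>2 \<partial>std_gaussian) \<le> \<sigma>\<^sup>2"
    and rho: "0 \<le> \<rho>" "\<rho> < 1 / (4 * L\<^sub>1)"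
    and weak_minty: "\<And>z. F_smooth f \<mu> z \<bullet> (z - zstar) + \<rho> / 2 * (norm (F_smooth f \<mu> z))\<^sup>2 \<ge> 0"
    and h1: "h\<^sub>1 > 0" "h\<^sub>1 \<le> 1 / L\<^sub>1"
    and h2: "h\<^sub>2 > 0" "sqrt (\<rho> / L\<^sub>1) < h\<^sub>2" "h\<^sub>2 \<le> h\<^sub>1 / 2"
    and M: "prob_space M"
    and gaussian: "\<And>k. k \<le> N \<Longrightarrow> distr M borel (uhat k) = std_gaussian"
      "\<And>k. k \<le> N \<Longrightarrow> distr M borel (u k) = std_gaussian"
    and indep: "prob_space.indep_vars M (\<lambda>_. borel) (case_sum uhat u) ({..N} <+> {..N})"
    and r0: "r\<^sub>0 = norm (z\<^sub>0 - zstar)"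
    and eps: "\<epsilon> > 0"
    and mu_eps: "\<mu> \<le> \<delta> / sqrt (real d * pi * exp 1) * (\<epsilon> / (8 * L\<^sub>0)) powr (1 / real d)"
    and N: "int N \<ge> \<lceil>(8 * r\<^sub>0\<^sup>2 * L\<^sub>1 / (L\<^sub>1 * h\<^sub>2\<^sup>2 - \<rho>)) * \<epsilon> powi (-2) - 1\<rceil>"
  shows "\<exists>k\<in>{0..N}.
    integrable M (\<lambda>\<omega>. goldstein_min_norm f \<delta>
      (zoeg_zhat f \<mu> h\<^sub>1 h\<^sub>2 z\<^sub>0 (\<lambda>j. uhat j \<omega>) (\<lambda>j. u j \<omega>) k)) \<and>
    prob_space.expectation M (\<lambda>\<omega>. goldstein_min_norm f \<delta>
      (zoeg_zhat f \<mu> h\<^sub>1 h\<^sub>2 z\<^sub>0 (\<lambda>j. uhat j \<omega>) (\<lambda>j. u j \<omega>) k))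
      \<le> \<epsilon> + sqrt (3 / (L\<^sub>1 * (L\<^sub>1 * h\<^sub>2\<^sup>2 - \<rho>))) * \<sigma>"
proof -
  have "sqrt (\<rho> / L\<^sub>1) < sqrt (h\<^sub>2\<^sup>2)" using h2(1,2) by (simp only: real_sqrt_abs abs_of_pos)
  then have "\<rho> / L\<^sub>1 < h\<^sub>2\<^sup>2" by (simp only: real_sqrt_less_iff)
  then have pos: "0 < L\<^sub>1 * h\<^sub>2\<^sup>2 - \<rho>" using L1(1) by (simp add: field_simps)
  interpret prob_space M by (rule M)
  interpret zoeg_process f L\<^sub>0 \<mu> L\<^sub>1 \<sigma> \<rho> h\<^sub>1 h\<^sub>2 zstar M u uhat z\<^sub>0 N
    by unfold_locales (use L0 mu L1 sigma rho weak_minty h1 h2 gaussian indep in auto)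
  have rate: "rate > 0" using pos L1(1) by (simp add: rate_def)
  have L1rate: "L\<^sub>1\<^sup>2 * rate = L\<^sub>1 * (L\<^sub>1 * h\<^sub>2\<^sup>2 - \<rho>)"
    using L1(1) by (simp add: rate_def power2_eq_square)
  have dim: "real d = real DIM((real ^ 'n) \<times> (real ^ 'm))" by (simp add: d)
  have "8 * r\<^sub>0\<^sup>2 * L\<^sub>1 / (L\<^sub>1 * h\<^sub>2\<^sup>2 - \<rho>) = 8 * r\<^sub>0\<^sup>2 / rate"
    using L1(1) by (simp add: rate_def)
  moreover have "8 * r\<^sub>0\<^sup>2 * L\<^sub>1 / (L\<^sub>1 * h\<^sub>2\<^sup>2 - \<rho>) * \<epsilon> powi (-2) - 1 \<le> real_of_int (int N)"
    using N by (simp only: ceiling_le_iff)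
  moreover have "\<epsilon> powi (-2) = 1 / \<epsilon>\<^sup>2" by (simp add: power_int_minus inverse_eq_divide)
  ultimately have "8 * r\<^sub>0\<^sup>2 / (rate * \<epsilon>\<^sup>2) - 1 \<le> real N" by simp
  \<comment> \<open>The \<open>- 1\<close> inside the ceiling accounts for the index running from 0
    to \<open>N\<close>, that is, for \<open>N + 1\<close> iterates.\<close>
  then have "8 * r\<^sub>0\<^sup>2 / (rate * \<epsilon>\<^sup>2) \<le> real (N + 1)" by simp
  moreover have "0 < rate * \<epsilon>\<^sup>2" using rate eps by simp
  ultimately have "8 * (norm (z\<^sub>0 - zstar))\<^sup>2 \<le> real (N + 1) * rate * \<epsilon>\<^sup>2"
    unfolding r0 by (simp only: pos_divide_le_eq mult.assoc)
  from expectation_goldstein_min_norm[OF rate delta(1) eps L0(1) sigma(1) mu_eps[unfolded dim] this]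
  obtain k where "k \<le> N" "integrable M (\<lambda>\<omega>. goldstein_min_norm f \<delta> (Zhat k \<omega>))"
    "expectation (\<lambda>\<omega>. goldstein_min_norm f \<delta> (Zhat k \<omega>)) \<le> \<epsilon> + sqrt (3 / (L\<^sub>1\<^sup>2 * rate)) * \<sigma>"
    by blast
  then show ?thesis unfolding L1rate by (intro bexI[of _ k]) auto
qed

end
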